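(* For any constant $\alpha_0<1$, there exists a constant $\varepsilon_0>0$ such that any two-sided, adaptive relative-error testing algorithm for deciding whether a function $f:\{0,1\}^n\to\{0,1\}$ with $|f^{-1}(1)|=\Theta(N)$, for some given parameter $N\le 2^{\alpha_0 n}$, is unate or has $\mathrm{reldist}(f,\mathsf{Unate})\ge\varepsilon_0$, must make $\tilde{\Omega}((\log N)^{2/3})$ queries.
   Context: Relative-error testing model: the algorithm has access to the membership oracle $\mathrm{MQ}(f)$ (returns $f(x)$ on query $x$) and the sampling oracle $\mathrm{SAMP}(f)$ (each call returns an independent uniformly random element of $f^{-1}(1)$), and may choose its calls adaptively; the number of queries is the total number of calls to both oracles. A two-sided tester must accept with probability at least $2/3$ if $f$ is unate and reject with probability at least $2/3$ if $\mathrm{reldist}(f,\mathsf{Unate})\ge\varepsilon_0$. $f$ is unate if for every $i\in[n]$, $f$ is either monotone non-decreasing or monotone non-increasing in the $i$-th variable; $\mathsf{Unate}$ is the class of unate functions. $\mathrm{reldist}(f,g)=|f^{-1}(1)\triangle g^{-1}(1)|/|f^{-1}(1)|$, $\mathrm{reldist}(f,\mathsf{Unate})=\min_{g\in\mathsf{Unate}}\mathrm{reldist}(f,g)$. $N$ is given to the algorithm. $\tilde{\Omega}$ hides polylogarithmic factors. *)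

theory Defs
  imports "HOL-Probability.Probability" "HOL-Library.Landau_Symbols"
begin

text \<open>
  A point of $\{0,1\}^n$ is a Boolean list of length \<open>n\<close>. A function $\{0,1\}^n \to \{0,1\}$ is a
  predicate on Boolean lists that is false off the cube, so that extensionally equal functions are
  equal and \<open>{x. f x}\<close> is $f^{-1}(1)$.
\<close>

definition cube :: "nat \<Rightarrow> bool list set" where
  "cube n = {x. length x = n}"

definition boolfun :: "nat \<Rightarrow> (bool list \<Rightarrow> bool) set" where
  "boolfun n = {f. \<forall>x. f x \<longrightarrow> x \<in> cube n}"

definition ones :: "(bool list \<Rightarrow> bool) \<Rightarrow> bool list set" where
  "ones f = {x. f x}"

definition nondecreasing_in :: "nat \<Rightarrow> (bool list \<Rightarrow> bool) \<Rightarrow> nat \<Rightarrow> bool" where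
  "nondecreasing_in n f i \<longleftrightarrow> (\<forall>x\<in>cube n. f (x[i := False]) \<le> f (x[i := True]))"

definition nonincreasing_in :: "nat \<Rightarrow> (bool list \<Rightarrow> bool) \<Rightarrow> nat \<Rightarrow> bool" where
  "nonincreasing_in n f i \<longleftrightarrow> (\<forall>x\<in>cube n. f (x[i := True]) \<le> f (x[i := False]))"

definition Unate :: "nat \<Rightarrow> (bool list \<Rightarrow> bool) set" where
  "Unate n = {f \<in> boolfun n. \<forall>i<n. nondecreasing_in n f i \<or> nonincreasing_in n f i}"

definition reldist :: "(bool list \<Rightarrow> bool) \<Rightarrow> (bool list \<Rightarrow> bool) \<Rightarrow> real" where
  "reldist f g = real (card (sym_diff (ones f) (ones g))) / real (card (ones f))"

definition reldist_class :: "(bool list \<Rightarrow> bool) \<Rightarrow> (bool list \<Rightarrow> bool) set \<Rightarrow> real" where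
  "reldist_class f C = (MIN g\<in>C. reldist f g)"

text \<open>The minimum defining \<open>reldist_class f (Unate n)\<close> is over a finite nonempty set.\<close>

lemma finite_cube: "finite (cube n)"
  using finite_lists_length_eq[of "UNIV :: bool set" n] by (simp add: cube_def)

lemma finite_boolfun: "finite (boolfun n)"
proof (rule finite_subset)
  show "boolfun n \<subseteq> (\<lambda>S x. x \<in> S) ` Pow (cube n)"
  proof
    fix f assume "f \<in> boolfun n"
    then have "{x. f x} \<in> Pow (cube n)" by (auto simp: boolfun_def)
    moreover have "f = (\<lambda>x. x \<in> {x. f x})" by simp
    ultimately show "f \<in> (\<lambda>S x. x \<in> S) ` Pow (cube n)" by (metis image_eqI)
  qed
qed (simp add: finite_cube)

lemma finite_Unate: "finite (Unate n)"
  by (rule finite_subset[OF _ finite_boolfun]) (auto simp: Unate_def)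

lemma Unate_nonempty: "Unate n \<noteq> {}"
proof -
  have "(\<lambda>_. False) \<in> Unate n"
    by (simp add: Unate_def boolfun_def nondecreasing_in_def)
  then show ?thesis by blast
qed

text \<open>
  A deterministic adaptive algorithm is a decision tree: each call to one of the two oracles
  determines the continuation by its answer, and \<open>Output True\<close> means accept. A randomized algorithm
  is a distribution on such trees. For fixed \<open>n\<close> and a bound on the number of calls there are only
  finitely many behaviours on functions in \<open>boolfun n\<close>, so discrete distributions lose no generality.
\<close>

datatype alg =
    Output bool
  | MQ "bool list" "bool \<Rightarrow> alg"
  | SAMP "bool list \<Rightarrow> alg"

text \<open>
  Joint distribution of the output and the number of oracle calls. The oracle \<open>SAMP\<close> is meaningful
  only for \<open>f\<close> with finite nonempty \<open>ones f\<close>.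
\<close>

primrec run_det :: "(bool list \<Rightarrow> bool) \<Rightarrow> alg \<Rightarrow> (bool \<times> nat) pmf" where
  "run_det f (Output b) = return_pmf (b, 0)"
| "run_det f (MQ x k) = map_pmf (apsnd Suc) (run_det f (k (f x)))"
| "run_det f (SAMP k) =
     bind_pmf (pmf_of_set (ones f)) (\<lambda>x. map_pmf (apsnd Suc) (run_det f (k x)))"

definition run :: "(bool list \<Rightarrow> bool) \<Rightarrow> alg pmf \<Rightarrow> (bool \<times> nat) pmf" where
  "run f A = bind_pmf A (run_det f)"

definition prob_accept :: "(bool list \<Rightarrow> bool) \<Rightarrow> alg pmf \<Rightarrow> real" where
  "prob_accept f A = measure_pmf.prob (run f A) {r. fst r}"

definition prob_reject :: "(bool list \<Rightarrow> bool) \<Rightarrow> alg pmf \<Rightarrow> real" where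
  "prob_reject f A = measure_pmf.prob (run f A) {r. \<not> fst r}"

text \<open>The tester only has to work under the promise that the input function belongs to \<open>F\<close>.\<close>

definition two_sided_unateness_tester ::
  "nat \<Rightarrow> real \<Rightarrow> (bool list \<Rightarrow> bool) set \<Rightarrow> alg pmf \<Rightarrow> bool" where
  "two_sided_unateness_tester n \<epsilon> F A \<longleftrightarrow>
     (\<forall>f\<in>F. (f \<in> Unate n \<longrightarrow> prob_accept f A \<ge> 2/3) \<and>
            (reldist_class f (Unate n) \<ge> \<epsilon> \<longrightarrow> prob_reject f A \<ge> 2/3))"

definition makes_at_most :: "nat \<Rightarrow> (bool list \<Rightarrow> bool) set \<Rightarrow> alg pmf \<Rightarrow> bool" where
  "makes_at_most q F A \<longleftrightarrow> (\<forall>f\<in>F. \<forall>r\<in>set_pmf (run f A). snd r \<le> q)"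

text \<open>Functions with $|f^{-1}(1)| = \Theta(N)$, the constants hidden in $\Theta$ being \<open>c\<^sub>1\<close> and \<open>c\<^sub>2\<close>.\<close>

definition size_promise :: "nat \<Rightarrow> real \<Rightarrow> real \<Rightarrow> nat \<Rightarrow> (bool list \<Rightarrow> bool) set" where
  "size_promise n c\<^sub>1 c\<^sub>2 N =
     {f \<in> boolfun n. c\<^sub>1 * real N \<le> real (card (ones f)) \<and> real (card (ones f)) \<le> c\<^sub>2 * real N}"

text \<open>
  The class $\tilde\Omega(g)$, hiding factors polylogarithmic in \<open>g\<close>. Since \<^const>\<open>bigomega\<close> compares
  norms, membership is a genuine lower bound only for nonnegative functions.
\<close>

definition soft_Omega :: "(nat \<Rightarrow> real) \<Rightarrow> (nat \<Rightarrow> real) set" where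
  "soft_Omega g = (\<Union>k::nat. \<Omega>(\<lambda>N. g N / ln (g N) ^ k))"

end

theory Submission
  imports Defs "HOL-Real_Asymp.Real_Asymp"
begin

text \<open>
  The hard functions are two-level Talagrand functions that are nonconstant only on two adjacent layers,
  of weight $3m$ and $3m+1$, of $\{0,1\}^{4m}$ with $m = \Theta(\log N)$. Random terms $T_i$ and, below each
  term, random clauses $C_{ij}$ cut these layers into regions; on a region the function is $x_s$ (then
  it is monotone) or $\neg x_s$ (then it is far from unate with constant probability) for a secret
  variable $s$ of the region. The two cases can only be told apart by two queries in one region that differ
  in $s$. Terms and clauses contain each variable with probability $1/2$, so a query that stays in
  a region can change only logarithmically many variables not already known to be safe to change. As the
  layers are adjacent, as many variables must be turned on as off: those turned on must be safe for the
  clause, which has to be learned inside the region, while those turned off must be safe for the term,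
  which is shared by many regions. With $r$ visits to a region at most $\tilde O(\min(r^2, Q))$
  variables are tested there, hence at most $\tilde O(Q^{3/2})$ in total, which must exceed $m$.

  Adaptivity is handled by counting worlds: changing one hidden set or secret without changing the previous
  answers leaves the next query unchanged. The sampling oracle gives nothing, since the accepted points
  are a constant fraction of all points of weight at least $3m$.
\<close>

section \<open>Decision trees and counting\<close>

text \<open>The weight \<open>3 * m\<close> out of \<open>4 * m\<close> is chosen for the relative
  error: above it the layers shrink geometrically, so the layer of weight \<open>3 * m\<close> is a
  constant fraction of everything accepted, and a constant fraction of violating edges starting
  there gives constant relative distance. Near the middle layer that fraction would tend to 0. The
  numbers of terms and clauses match the probabilities \<open>2 ^ -m\<close> and
  \<open>2 ^ -(3 * m)\<close> that a point of weight \<open>3 * m\<close> satisfies a given term or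
  falsifies a given clause, so lying in some region has constant probability. The obstacle to
  comparing the two cases is that their adaptive histories might diverge. Only runs on the monotone
  function are therefore analysed, one decision tree at a time; outside a small set of worlds, an
  injective map of worlds carries such a run to an identical run on the far function. One direction
  is enough: acceptance is transferred from the monotone functions to the far ones, where it must be
  rare on a constant fraction of the worlds.\<close>

datatype dtree = Out bool | Ask "nat set" "bool \<Rightarrow> dtree"

primrec queries :: "(nat set \<Rightarrow> bool) \<Rightarrow> dtree \<Rightarrow> nat set list" where
  "queries g (Out b) = []"
| "queries g (Ask x k) = x # queries g (k (g x))"

primrec verdict :: "(nat set \<Rightarrow> bool) \<Rightarrow> dtree \<Rightarrow> bool" where
  "verdict g (Out b) = b"
| "verdict g (Ask x k) = verdict g (k (g x))"

text \<open>Agreement on the first \<open>k\<close> answers also fixes the query that follows, hence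
  \<open>Suc k\<close>: an event about query \<open>k\<close> survives every change of the world
  that respects the earlier answers.\<close>

lemma queries_agree:
  assumes "set (take k (queries g d)) \<subseteq> {x. g x = h x}"
  shows "take (Suc k) (queries h d) = take (Suc k) (queries g d)"
  using assms
proof (induction d arbitrary: k)
  case (Out b)
  then show ?case by simp
next
  case (Ask x f)
  show ?case
  proof (cases k)
    case 0
    then show ?thesis by simp
  next
    case (Suc k')
    have *: "x \<in> {x. g x = h x} \<and> set (take k' (queries g (f (g x)))) \<subseteq> {x. g x = h x}"
      using Ask.prems unfolding Suc by (simp only: queries.simps take_Suc_Cons list.set insert_subset)
    then have "g x = h x" by blast
    note sub = conjunct2[OF *]
    from Ask.IH[OF rangeI sub] show ?thesis using Suc \<open>g x = h x\<close> by simp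
  qed
qed

lemma verdict_agree:
  assumes "set (queries g d) \<subseteq> {x. g x = h x}"
  shows "queries h d = queries g d \<and> verdict h d = verdict g d"
  using assms
proof (induction d)
  case (Ask x f)
  have *: "x \<in> {x. g x = h x} \<and> set (queries g (f (g x))) \<subseteq> {x. g x = h x}"
    using Ask.prems by (simp only: queries.simps list.set insert_subset)
  then have "g x = h x" by blast
  note sub = conjunct2[OF *]
  from Ask.IH[OF rangeI sub] show ?case using \<open>g x = h x\<close> by simp
qed simp

text \<open>
  The updates \<open>\<xi> v \<Rightarrow> \<xi> v \<union> S\<close> with \<open>S \<subseteq> N \<xi>\<close> are injective because \<open>N\<close> does not see them; so an event that
  forces a uniformly random set to avoid \<open>c\<close> points has conditional probability at most $2^{-c}$.
  No independence from the adaptively chosen history is needed beyond this invariance.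
\<close>

lemma card_spread:
  assumes fin: "finite E"
    and N: "\<And>\<xi>. \<xi> \<in> B \<Longrightarrow> finite (N \<xi>) \<and> \<xi> v \<inter> N \<xi> = {} \<and> c \<le> card (N \<xi>)"
    and upd: "\<And>\<xi> S. \<xi> \<in> B \<Longrightarrow> S \<subseteq> N \<xi> \<Longrightarrow>
      \<xi>(v := \<xi> v \<union> S) \<in> E \<and> N (\<xi>(v := \<xi> v \<union> S)) = N \<xi>"
  shows "card B * 2 ^ c \<le> card E"
proof -
  have "B \<subseteq> E" using upd[of _ "{}"] by auto
  then have finB: "finite B" using fin finite_subset by blast
  let ?P = "Sigma B (\<lambda>\<xi>. Pow (N \<xi>))"
  let ?f = "\<lambda>(\<xi>, S). \<xi>(v := \<xi> v \<union> S)"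
  have inj: "inj_on ?f ?P"
  proof (rule inj_onI, clarsimp)
    fix \<xi> S \<xi>' S'
    assume A: "\<xi> \<in> B" "\<xi>' \<in> B" "S \<subseteq> N \<xi>" "S' \<subseteq> N \<xi>'"
      and eq: "\<xi>(v := \<xi> v \<union> S) = \<xi>'(v := \<xi>' v \<union> S')"
    have NN: "N \<xi> = N \<xi>'" using upd[OF A(1,3)] upd[OF A(2,4)] eq by simp
    have u: "\<xi> v \<union> S = \<xi>' v \<union> S'" using fun_cong[OF eq, of v] by simp
    have "S = S'" "\<xi> v = \<xi>' v" using u NN N[OF A(1)] N[OF A(2)] A(3,4) by blast+
    moreover have "\<xi> y = \<xi>' y" if "y \<noteq> v" for y using fun_cong[OF eq, of y] that by simp
    ultimately show "\<xi> = \<xi>' \<and> S = S'" by (metis fun_upd_triv fun_upd_upd eq)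
  qed
  have "card B * 2 ^ c = (\<Sum>\<xi>\<in>B. 2 ^ c)" by simp
  also have "\<dots> \<le> (\<Sum>\<xi>\<in>B. card (Pow (N \<xi>)))"
    by (rule sum_mono) (use N in \<open>simp add: card_Pow\<close>)
  also have "\<dots> = card ?P" using finB N by (subst card_SigmaI) auto
  also have "\<dots> = card (?f ` ?P)" using inj by (simp add: card_image)
  also have "\<dots> \<le> card E" by (rule card_mono[OF fin]) (use upd in auto)
  finally show ?thesis .
qed

text \<open>
  Double counting of pairs (world, new value at \<open>v\<close>): the value at \<open>v\<close> can be resampled in \<open>Y \<xi>\<close>
  without changing \<open>X\<close> and \<open>Y\<close>, so it hits \<open>X \<xi>\<close> with probability at most \<open>card (X \<xi>) / card (Y \<xi>)\<close>.
\<close>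

lemma card_resample:
  assumes finE: "finite E" and finB: "finite B"
    and Y: "\<And>\<xi>. \<xi> \<in> B \<Longrightarrow> finite (Y \<xi>) \<and> Y \<xi> \<noteq> {} \<and> \<xi> v \<in> X \<xi>"
    and upd: "\<And>\<xi> a. \<xi> \<in> B \<Longrightarrow> a \<in> Y \<xi> \<Longrightarrow>
      \<xi>(v := a) \<in> E \<and> X (\<xi>(v := a)) = X \<xi> \<and> Y (\<xi>(v := a)) = Y \<xi>"
    and finX: "\<And>\<xi>. \<xi> \<in> E \<Longrightarrow> finite (X \<xi>)"
  shows "real (card B) \<le> (\<Sum>\<xi>\<in>E. real (card (X \<xi>)) / real (card (Y \<xi>)))"
proof -
  let ?P = "Sigma B Y" and ?R = "Sigma E X"
  let ?f = "\<lambda>(\<xi>, a). (\<xi>(v := a), \<xi> v)"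
  let ?h = "\<lambda>(\<xi>, a). 1 / real (card (Y \<xi>))"
  have inj: "inj_on ?f ?P"
  proof (rule inj_onI, clarsimp)
    fix \<xi> a \<xi>' a'
    assume eq: "\<xi>(v := a) = \<xi>'(v := a')" and v: "\<xi> v = \<xi>' v"
    have "a = a'" using fun_cong[OF eq, of v] by simp
    moreover have "\<xi> y = \<xi>' y" for y using fun_cong[OF eq, of y] v by (cases "y = v") auto
    ultimately show "\<xi> = \<xi>' \<and> a = a'" by auto
  qed
  have sub: "?f ` ?P \<subseteq> ?R" using upd Y by auto
  have "real (card B) = (\<Sum>\<xi>\<in>B. \<Sum>a\<in>Y \<xi>. 1 / real (card (Y \<xi>)))"
  proof -
    have "(\<Sum>a\<in>Y \<xi>. 1 / real (card (Y \<xi>))) = 1" if "\<xi> \<in> B" for \<xi>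
      using Y[OF that] by simp
    then show ?thesis by simp
  qed
  also have "\<dots> = (\<Sum>p\<in>?P. ?h p)" using finB Y by (subst sum.Sigma) auto
  also have "\<dots> = (\<Sum>p\<in>?P. ?h (?f p))" by (rule sum.cong) (use upd in auto)
  also have "\<dots> = (\<Sum>p\<in>?f ` ?P. ?h p)" by (subst sum.reindex[OF inj]) simp
  also have "\<dots> \<le> (\<Sum>p\<in>?R. ?h p)"
    by (rule sum_mono2) (use finE finX sub in auto)
  also have "\<dots> = (\<Sum>\<xi>\<in>E. \<Sum>a\<in>X \<xi>. 1 / real (card (Y \<xi>)))"
    using finE finX by (subst sum.Sigma) auto
  also have "\<dots> = (\<Sum>\<xi>\<in>E. real (card (X \<xi>)) / real (card (Y \<xi>)))" by simp
  finally show ?thesis .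
qed

text \<open>Independence of one coordinate from an event that ignores it, stated without division.
  Exchanging the coordinate with a spare value is an involution, so one map serves in both
  directions.\<close>

lemma card_PiE_factor:
  assumes "v \<in> I" "U \<subseteq> D v"
    and P: "\<And>\<xi> a. \<xi> \<in> PiE I D \<Longrightarrow> a \<in> D v \<Longrightarrow> P (\<xi>(v := a)) = P \<xi>"
  shows "card {\<xi> \<in> PiE I D. P \<xi> \<and> \<xi> v \<in> U} * card (D v) = card {\<xi> \<in> PiE I D. P \<xi>} * card U"
proof -
  let ?A = "{\<xi> \<in> PiE I D. P \<xi> \<and> \<xi> v \<in> U} \<times> D v" and ?B = "{\<xi> \<in> PiE I D. P \<xi>} \<times> U"
  have upd: "\<xi>(v := a) \<in> PiE I D" if "\<xi> \<in> PiE I D" "a \<in> D v" for \<xi> a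
    using PiE_fun_upd[OF that(2,1)] assms(1) by (simp add: insert_absorb)
  define f where "f p = ((fst p)(v := snd p), fst p v)" for p :: "('a \<Rightarrow> 'b) \<times> 'b"
  have "bij_betw f ?A ?B"
  proof (rule bij_betwI[where g = f])
    show "f \<in> ?A \<rightarrow> ?B"
    proof (rule Pi_I)
      fix p assume "p \<in> ?A"
      then have "fst p \<in> PiE I D" "P (fst p)" "snd p \<in> D v" "fst p v \<in> U" by (simp_all add: mem_Times_iff)
      then show "f p \<in> ?B" by (simp add: f_def mem_Times_iff upd P)
    qed
    show "f \<in> ?B \<rightarrow> ?A"
    proof (rule Pi_I)
      fix p assume "p \<in> ?B"
      then have h: "fst p \<in> PiE I D" "P (fst p)" "snd p \<in> U" by (simp_all add: mem_Times_iff)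
      moreover have "snd p \<in> D v" "fst p v \<in> D v" using h assms(1,2) by (auto dest: PiE_mem)
      ultimately show "f p \<in> ?A" by (simp add: f_def mem_Times_iff upd P)
    qed
  qed (simp_all add: f_def)
  from bij_betw_same_card[OF this] show ?thesis by (simp add: card_cartesian_product)
qed

text \<open>
  The two least elements. A query answer depends on the index set \<open>A\<close> of satisfied terms (or falsified
  clauses) only through \<open>low2 A\<close>, and removing an index outside \<open>low2 A\<close> is not noticed. Revealing only
  \<open>low2 A\<close> keeps the number of revealed indices at most two per query.
\<close>

definition low2 :: "nat set \<Rightarrow> nat set" where
  "low2 A = {a \<in> A. card {b \<in> A. b < a} < 2}"

lemma card_low2: "finite A \<Longrightarrow> card (low2 A) \<le> 2"
proof -
  assume A: "finite A"
  have mono: "card {b \<in> A. b < x} < card {b \<in> A. b < y}" if "x \<in> A" "x < y" for x y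
    by (rule psubset_card_mono) (use A that in auto)
  have "inj_on (\<lambda>a. card {b \<in> A. b < a}) (low2 A)"
    by (rule linorder_inj_onI') (use mono in \<open>auto simp: low2_def dest: less_imp_neq\<close>)
  then have "card (low2 A) \<le> card {..<2::nat}"
    by (rule card_inj_on_le) (auto simp: low2_def)
  then show ?thesis by simp
qed

lemma low2_subset: "low2 A \<subseteq> A"
  by (auto simp: low2_def)

lemma low2_singleton [simp]: "low2 {a} = {a}"
proof -
  have e: "{b \<in> {a}. b < a} = {}" by blast
  have "a \<in> low2 {a}" unfolding low2_def by (rule CollectI, subst e) simp
  then show ?thesis using low2_subset[of "{a}"] by blast
qed

text \<open>As \<open>i\<close> has two smaller elements in \<open>A\<close>, every element above
  \<open>i\<close> keeps two smaller ones after the removal, and ranks up to \<open>i\<close> do not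
  change.\<close>

lemma low2_remove:
  assumes A: "finite A" "i \<in> A" "i \<notin> low2 A"
  shows "low2 (A - {i}) = low2 A" "card (A - {i}) \<ge> 2" "card A \<ge> 2"
proof -
  have c: "card {b \<in> A. b < i} \<ge> 2" using A by (auto simp: low2_def)
  have big: "card {b \<in> A - {i}. b < a} \<ge> 2" if "a > i" for a
    using c by (rule order_trans) (rule card_mono, use A that in auto)
  have big': "card {b \<in> A. b < a} \<ge> 2" if "a > i" for a
    using c by (rule order_trans) (rule card_mono, use A that in auto)
  have same: "{b \<in> A - {i}. b < a} = {b \<in> A. b < a}" if "a \<le> i" for a using that by auto
  show "low2 (A - {i}) = low2 A"
  proof (intro set_eqI iffI)
    fix a assume "a \<in> low2 (A - {i})"
    then show "a \<in> low2 A" using big[of a] same[of a] by (cases "a \<le> i") (auto simp: low2_def)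
  next
    fix a assume a: "a \<in> low2 A"
    then have "a \<noteq> i" using A by auto
    then show "a \<in> low2 (A - {i})" using a big'[of a] same[of a]
      by (cases "a \<le> i") (auto simp: low2_def)
  qed
  show "card (A - {i}) \<ge> 2" using c by (rule order_trans) (rule card_mono, use A in auto)
  show "card A \<ge> 2" using c by (rule order_trans) (rule card_mono, use A in auto)
qed

text \<open>Prefix sums of natural numbers increase, so the index set is an initial segment. This
  charges exactly the queries made before a budget is exceeded.\<close>

lemma sum_initial_segment_le:
  fixes f :: "nat \<Rightarrow> nat"
  shows "(\<Sum>k\<in>{k. k < n \<and> (\<Sum>l<Suc k. f l) \<le> W}. f k) \<le> W"
proof (cases "(\<Sum>l<n. f l) \<le> W")
  case True
  have "(\<Sum>k\<in>{k. k < n \<and> (\<Sum>l<Suc k. f l) \<le> W}. f k) \<le> (\<Sum>l<n. f l)"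
    by (rule sum_mono2) auto
  then show ?thesis using True by simp
next
  case False
  then show ?thesis
  proof (induction n)
    case 0
    then show ?case by simp
  next
    case (Suc n)
    have "{k. k < Suc n \<and> (\<Sum>l<Suc k. f l) \<le> W} = {k. k < n \<and> (\<Sum>l<Suc k. f l) \<le> W}"
      using Suc.prems less_Suc_eq by auto
    moreover have "(\<Sum>k\<in>{k. k < n \<and> (\<Sum>l<Suc k. f l) \<le> W}. f k) \<le> W"
    proof (cases "(\<Sum>l<n. f l) \<le> W")
      case True
      have "(\<Sum>k\<in>{k. k < n \<and> (\<Sum>l<Suc k. f l) \<le> W}. f k) \<le> (\<Sum>l<n. f l)"
        by (rule sum_mono2) auto
      then show ?thesis using True by simp
    qed (use Suc.IH in auto)
    ultimately show ?case by simp
  qed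
qed

section \<open>The hard functions\<close>

text \<open>
  A world assigns to \<open>TI i\<close> the term $T_i$, to \<open>CI i j\<close> the clause $C_{ij}$, both uniformly random subsets
  of the $4m$ variables, and to \<open>SI i j\<close> the singleton of a secret index below $6m$. Indices from $4m$ on
  are virtual variables that are constantly 0: with them, a point of weight $3m$ contains exactly half
  of the possible secrets. Only points in the two layers \<open>lev\<close> depend on the world; the region
  \<open>inreg \<xi> x i j\<close> consists of those that satisfy only $T_i$ and falsify only $C_{ij}$. The flag \<open>up\<close>
  chooses between the monotone function and the far one.
\<close>

datatype idx = TI nat | CI nat nat | SI nat nat

type_synonym world = "idx \<Rightarrow> nat set"

locale hard_family =
  fixes m :: nat
  assumes m3: "3 \<le> m"
begin

definition lev :: "nat set \<Rightarrow> bool" where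
  "lev x \<longleftrightarrow> x \<subseteq> {..<4 * m} \<and> (card x = 3 * m \<or> card x = 3 * m + 1)"

definition TT :: "world \<Rightarrow> nat set \<Rightarrow> nat set" where
  "TT \<xi> x = {i. i < 2 ^ (m - 3) \<and> \<xi> (TI i) \<subseteq> x}"

definition CC :: "world \<Rightarrow> nat \<Rightarrow> nat set \<Rightarrow> nat set" where
  "CC \<xi> i x = {j. j < 2 ^ (3 * m - 1) \<and> \<xi> (CI i j) \<inter> x = {}}"

text \<open>The default values are those that keep the function monotone: a larger point has more
  satisfied terms and, for a fixed term, fewer falsified clauses. So the value rises from no term to
  several terms, and from several clauses to no clause.\<close>

definition gfun :: "bool \<Rightarrow> world \<Rightarrow> nat set \<Rightarrow> bool" where
  "gfun up \<xi> x =
    (if \<not> lev x then 3 * m + 1 < card x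
     else if TT \<xi> x = {} then False
     else if card (TT \<xi> x) \<noteq> 1 then True
     else let i = the_elem (TT \<xi> x) in
       if CC \<xi> i x = {} then True
       else if card (CC \<xi> i x) \<noteq> 1 then False
       else (\<xi> (SI i (the_elem (CC \<xi> i x))) \<subseteq> x) = up)"

definition inreg :: "world \<Rightarrow> nat set \<Rightarrow> nat \<Rightarrow> nat \<Rightarrow> bool" where
  "inreg \<xi> x i j \<longleftrightarrow> lev x \<and> TT \<xi> x = {i} \<and> CC \<xi> i x = {j}"

definition visT :: "world \<Rightarrow> nat set \<Rightarrow> nat \<Rightarrow> bool" where
  "visT \<xi> x i \<longleftrightarrow> lev x \<and> i \<in> low2 (TT \<xi> x)"

definition visC :: "world \<Rightarrow> nat set \<Rightarrow> nat \<Rightarrow> nat \<Rightarrow> bool" where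
  "visC \<xi> x i j \<longleftrightarrow> lev x \<and> TT \<xi> x = {i} \<and> j \<in> low2 (CC \<xi> i x)"

definition Idx :: "idx set" where
  "Idx = TI ` {..<2 ^ (m - 3)} \<union>
    (\<lambda>(i, j). CI i j) ` ({..<2 ^ (m - 3)} \<times> {..<2 ^ (3 * m - 1)}) \<union>
    (\<lambda>(i, j). SI i j) ` ({..<2 ^ (m - 3)} \<times> {..<2 ^ (3 * m - 1)})"

primrec Dom :: "idx \<Rightarrow> nat set set" where
  "Dom (TI i) = Pow {..<4 * m}"
| "Dom (CI i j) = Pow {..<4 * m}"
| "Dom (SI i j) = (\<lambda>s. {s}) ` {..<6 * m}"

definition W :: "world set" where
  "W = PiE Idx Dom"

lemma finite_TT [simp]: "finite (TT \<xi> x)"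
  by (simp add: TT_def)

lemma finite_CC [simp]: "finite (CC \<xi> i x)"
  by (simp add: CC_def)

lemma finite_Dom [simp]: "finite (Dom v)"
  by (cases v) auto

lemma finite_Idx [simp]: "finite Idx"
  by (auto simp: Idx_def)

lemma finite_W [simp]: "finite W"
  unfolding W_def by (rule finite_PiE) auto

lemma TI_Idx [simp]: "TI i \<in> Idx \<longleftrightarrow> i < 2 ^ (m - 3)"
  by (auto simp: Idx_def)

lemma CI_Idx [simp]: "CI i j \<in> Idx \<longleftrightarrow> i < 2 ^ (m - 3) \<and> j < 2 ^ (3 * m - 1)"
  by (auto simp: Idx_def)

lemma SI_Idx [simp]: "SI i j \<in> Idx \<longleftrightarrow> i < 2 ^ (m - 3) \<and> j < 2 ^ (3 * m - 1)"
  by (auto simp: Idx_def)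

lemma Dom_nonempty: "Dom v \<noteq> {}"
  using m3 by (cases v) (auto simp: lessThan_empty_iff)

lemma W_nonempty: "W \<noteq> {}"
  unfolding W_def using Dom_nonempty by (simp add: PiE_eq_empty_iff)

lemma W_upd: "\<xi> \<in> W \<Longrightarrow> v \<in> Idx \<Longrightarrow> a \<in> Dom v \<Longrightarrow> \<xi>(v := a) \<in> W"
  unfolding W_def using PiE_fun_upd[of a Dom v \<xi> Idx] by (simp add: insert_absorb)

lemma W_mem: "\<xi> \<in> W \<Longrightarrow> v \<in> Idx \<Longrightarrow> \<xi> v \<in> Dom v"
  unfolding W_def by (rule PiE_mem)

lemma lev_finite: "lev x \<Longrightarrow> finite x"
  unfolding lev_def using finite_subset by blast

lemma inreg_bounds: "inreg \<xi> x i j \<Longrightarrow> i < 2 ^ (m - 3) \<and> j < 2 ^ (3 * m - 1)"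
proof -
  assume "inreg \<xi> x i j"
  then have "i \<in> TT \<xi> x" "j \<in> CC \<xi> i x" by (auto simp: inreg_def)
  then show ?thesis by (auto simp: TT_def CC_def)
qed

lemma inreg_visC: "inreg \<xi> x i j \<Longrightarrow> visC \<xi> x i j"
  by (auto simp: inreg_def visC_def)

lemma visC_visT: "visC \<xi> x i j \<Longrightarrow> visT \<xi> x i"
  by (auto simp: visT_def visC_def)

lemma inreg_unique: "inreg \<xi> x i j \<Longrightarrow> inreg \<xi> x i' j' \<Longrightarrow> i = i' \<and> j = j'"
  by (auto simp: inreg_def)

lemma gfun_inreg: "inreg \<xi> x i j \<Longrightarrow> gfun up \<xi> x = ((\<xi> (SI i j) \<subseteq> x) = up)"
  by (simp add: inreg_def gfun_def)

lemma gfun_not_inreg: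
  assumes "\<And>i j. \<not> inreg \<xi> x i j"
  shows "gfun up \<xi> x = gfun up' \<xi> x"
proof -
  have "\<not> (lev x \<and> card (TT \<xi> x) = 1 \<and> card (CC \<xi> (the_elem (TT \<xi> x)) x) = 1)"
    using assms by (auto simp: inreg_def card_1_singleton_iff)
  then show ?thesis by (auto simp: gfun_def Let_def)
qed

lemma gfun_below: "card x < 3 * m \<Longrightarrow> \<not> gfun up \<xi> x"
  by (auto simp: gfun_def lev_def)

lemma gfun_above: "3 * m + 1 < card x \<Longrightarrow> gfun up \<xi> x"
  by (auto simp: gfun_def lev_def)

lemma gfun_mono:
  assumes xy: "x \<subseteq> y" "y \<subseteq> {..<4 * m}" and g: "gfun True \<xi> x"
  shows "gfun True \<xi> y"
proof (cases "lev x \<and> lev y")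
  case False
  have fin: "finite y" using xy(2) finite_subset by blast
  have cxy: "card x \<le> card y" using xy(1) fin by (rule card_mono[rotated])
  have "3 * m \<le> card x" using g gfun_below[of x True \<xi>] by force
  then have "3 * m + 1 < card y" using False cxy xy by (auto simp: lev_def)
  then show ?thesis by (rule gfun_above)
next
  case True
  have TTsub: "TT \<xi> x \<subseteq> TT \<xi> y" using xy(1) by (auto simp: TT_def)
  have nx: "TT \<xi> x \<noteq> {}" using g True by (auto simp: gfun_def)
  show ?thesis
  proof (cases "card (TT \<xi> y) = 1")
    case False
    then show ?thesis using True nx TTsub by (auto simp: gfun_def)
  next
    case one: True
    then obtain i where i: "TT \<xi> y = {i}" by (auto simp: card_1_singleton_iff)
    then have ix: "TT \<xi> x = {i}" using nx TTsub by auto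
    have CCsub: "CC \<xi> i y \<subseteq> CC \<xi> i x" using xy(1) by (auto simp: CC_def)
    show ?thesis
    proof (cases "CC \<xi> i y = {}")
      case True
      then show ?thesis using \<open>lev x \<and> lev y\<close> i by (simp add: gfun_def)
    next
      case ne: False
      then have "CC \<xi> i x \<noteq> {}" using CCsub by auto
      then have "card (CC \<xi> i x) = 1" using g True ix by (auto simp: gfun_def split: if_splits)
      then obtain j where j: "CC \<xi> i x = {j}" by (auto simp: card_1_singleton_iff)
      then have jy: "CC \<xi> i y = {j}" using ne CCsub by auto
      have "inreg \<xi> x i j" "inreg \<xi> y i j" using True i ix j jy by (auto simp: inreg_def)
      then show ?thesis using g xy(1) by (auto simp: gfun_inreg)
    qed
  qed
qed

text \<open>If the enlarged term stops being satisfied at \<open>y\<close>, then \<open>i\<close>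
  was outside \<open>low2\<close>; at least two terms are satisfied before and after, and the value
  is 1 both times.\<close>

lemma TI_upd:
  assumes S: "i \<in> low2 (TT \<xi> y) \<Longrightarrow> S \<subseteq> y" and lev: "lev y"
  defines "\<xi>' \<equiv> \<xi>(TI i := \<xi> (TI i) \<union> S)"
  shows "gfun up \<xi>' y = gfun up \<xi> y \<and> low2 (TT \<xi>' y) = low2 (TT \<xi> y)"
proof -
  have CC: "CC \<xi>' k y = CC \<xi> k y" for k by (simp add: CC_def \<xi>'_def)
  have SI: "\<xi>' (SI k j) = \<xi> (SI k j)" for k j by (simp add: \<xi>'_def)
  show ?thesis
  proof (cases "TT \<xi>' y = TT \<xi> y")
    case True
    then show ?thesis by (simp add: gfun_def CC SI)
  next
    case False
    have "TT \<xi>' y = TT \<xi> y - {i}" "i \<in> TT \<xi> y" "\<not> S \<subseteq> y"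
      using False by (auto simp: TT_def \<xi>'_def split: if_splits)
    moreover have "i \<notin> low2 (TT \<xi> y)" using S \<open>\<not> S \<subseteq> y\<close> by blast
    ultimately have "low2 (TT \<xi>' y) = low2 (TT \<xi> y)" "card (TT \<xi>' y) \<ge> 2" "card (TT \<xi> y) \<ge> 2"
      using low2_remove[of "TT \<xi> y" i] by auto
    moreover have "gfun up \<zeta> y" if "card (TT \<zeta> y) \<ge> 2" for \<zeta>
      using that lev by (auto simp: gfun_def)
    ultimately show ?thesis by blast
  qed
qed

text \<open>Dual to \<open>TI_upd\<close>: a clause that stops being falsified unnoticed leaves at
  least two falsified ones, so the value stays 0. The clause matters only where its term is the
  unique satisfied one.\<close>

lemma CI_upd:
  assumes S: "visC \<xi> y i j \<Longrightarrow> S \<inter> y = {}"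
  defines "\<xi>' \<equiv> \<xi>(CI i j := \<xi> (CI i j) \<union> S)"
  shows "gfun up \<xi>' y = gfun up \<xi> y \<and> visC \<xi>' y i j = visC \<xi> y i j \<and> TT \<xi>' y = TT \<xi> y"
proof -
  have TT: "TT \<xi>' y = TT \<xi> y" by (simp add: TT_def \<xi>'_def)
  have CCo: "CC \<xi>' k y = CC \<xi> k y" if "k \<noteq> i" for k using that by (simp add: CC_def \<xi>'_def)
  have SI: "\<xi>' (SI k l) = \<xi> (SI k l)" for k l by (simp add: \<xi>'_def)
  show ?thesis
  proof (cases "lev y \<and> TT \<xi> y = {i}")
    case False
    have "gfun up \<xi>' y = gfun up \<xi> y"
    proof (cases "lev y \<and> card (TT \<xi> y) = 1")
      case True
      then obtain k where "TT \<xi> y = {k}" by (auto simp: card_1_singleton_iff)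
      then show ?thesis using False True by (simp add: gfun_def TT CCo SI)
    next
      case F: False
      then show ?thesis by (auto simp: gfun_def TT)
    qed
    then show ?thesis using False TT by (auto simp: visC_def)
  next
    case T: True
    show ?thesis
    proof (cases "CC \<xi>' i y = CC \<xi> i y")
      case True
      then show ?thesis using T by (simp add: gfun_def TT SI visC_def)
    next
      case False
      have C: "CC \<xi>' i y = CC \<xi> i y - {j}" "j \<in> CC \<xi> i y" "S \<inter> y \<noteq> {}"
        using False by (auto simp: CC_def \<xi>'_def split: if_splits)
      moreover have nl: "j \<notin> low2 (CC \<xi> i y)" using S C(3) T by (auto simp: visC_def)
      ultimately have c: "low2 (CC \<xi>' i y) = low2 (CC \<xi> i y)" "card (CC \<xi>' i y) \<ge> 2" "card (CC \<xi> i y) \<ge> 2"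
        using low2_remove[of "CC \<xi> i y" j] by auto
      have "\<not> gfun up \<zeta> y" if "card (CC \<zeta> i y) \<ge> 2" "TT \<zeta> y = {i}" for \<zeta>
        using that T by (auto simp: gfun_def)
      then have "\<not> gfun up \<xi>' y" "\<not> gfun up \<xi> y" using c TT T by auto
      then show ?thesis using c TT T by (simp add: visC_def)
    qed
  qed
qed

lemma SI_upd:
  assumes a: "inreg \<xi> y i j \<Longrightarrow> (a \<subseteq> y) = (\<xi> (SI i j) \<subseteq> y)"
  shows "gfun up (\<xi>(SI i j := a)) y = gfun up \<xi> y"
proof -
  let ?\<xi> = "\<xi>(SI i j := a)"
  have TT: "TT ?\<xi> y = TT \<xi> y" and CC: "\<And>k. CC ?\<xi> k y = CC \<xi> k y" by (auto simp: TT_def CC_def)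
  show ?thesis
  proof (cases "inreg \<xi> y i j")
    case True
    then have "inreg ?\<xi> y i j" by (simp add: inreg_def TT CC)
    then show ?thesis using True a by (simp add: gfun_inreg)
  next
    case False
    show ?thesis
    proof (cases "lev y \<and> card (TT \<xi> y) = 1")
      case T: True
      then obtain k where k: "TT \<xi> y = {k}" by (auto simp: card_1_singleton_iff)
      show ?thesis
      proof (cases "card (CC \<xi> k y) = 1")
        case True
        then obtain l where "CC \<xi> k y = {l}" by (auto simp: card_1_singleton_iff)
        then show ?thesis using False T k by (auto simp: gfun_def TT CC inreg_def)
      qed (use T k in \<open>auto simp: gfun_def TT CC\<close>)
    qed (auto simp: gfun_def TT CC)
  qed
qed

lemma SI_upd_simps [simp]:
  "TT (\<xi>(SI i j := a)) y = TT \<xi> y" "CC (\<xi>(SI i j := a)) k y = CC \<xi> k y"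
  "inreg (\<xi>(SI i j := a)) y k l = inreg \<xi> y k l"
  by (auto simp: TT_def CC_def inreg_def)

end

section \<open>Exploring terms and clauses\<close>

lemma sum_card_le:
  assumes "finite W" "finite A" "\<And>\<xi>. \<xi> \<in> W \<Longrightarrow> card {i \<in> A. P \<xi> i} \<le> c"
  shows "(\<Sum>i\<in>A. card {\<xi> \<in> W. P \<xi> i}) \<le> c * card W"
proof -
  have "(\<Sum>i\<in>A. card {\<xi> \<in> W. P \<xi> i}) = (\<Sum>i\<in>A. \<Sum>\<xi>\<in>W. if P \<xi> i then 1 else 0)"
    using assms by (simp add: sum.If_cases Int_def)
  also have "\<dots> = (\<Sum>\<xi>\<in>W. \<Sum>i\<in>A. if P \<xi> i then 1 else 0)" by (rule sum.swap)
  also have "\<dots> = (\<Sum>\<xi>\<in>W. card {i \<in> A. P \<xi> i})"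
    using assms by (simp add: sum.If_cases Int_def)
  also have "\<dots> \<le> (\<Sum>\<xi>\<in>W. c)" using assms by (intro sum_mono) auto
  finally show ?thesis by (simp add: mult.commute)
qed

locale exploration = hard_family +
  fixes d :: dtree and Q LL :: nat
  assumes length_le: "\<xi> \<in> W \<Longrightarrow> length (queries (gfun True \<xi>) d) \<le> Q"
    and LL: "1 \<le> LL"
begin

text \<open>Every event below refers to the run on the monotone function; the far function enters
  only through \<open>recode_agree\<close>.\<close>

definition xs :: "world \<Rightarrow> nat set list" where
  "xs \<xi> = queries (gfun True \<xi>) d"

definition pre :: "world \<Rightarrow> nat \<Rightarrow> nat set set" where
  "pre \<xi> k = set (take k (xs \<xi>))"

definition seenT :: "world \<Rightarrow> nat \<Rightarrow> nat \<Rightarrow> bool" where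
  "seenT \<xi> k i \<longleftrightarrow> (\<exists>y\<in>pre \<xi> k. visT \<xi> y i)"

text \<open>
  \<open>KT\<close> and the complement of \<open>UC\<close> are the best upper bounds on $T_i$ and $C_{ij}$ after \<open>k\<close> queries.
\<close>

definition KT :: "world \<Rightarrow> nat \<Rightarrow> nat \<Rightarrow> nat set" where
  "KT \<xi> k i = {t. t < 4 * m \<and> (\<forall>y\<in>pre \<xi> k. visT \<xi> y i \<longrightarrow> t \<in> y)}"

definition seenC :: "world \<Rightarrow> nat \<Rightarrow> nat \<Rightarrow> nat \<Rightarrow> bool" where
  "seenC \<xi> k i j \<longleftrightarrow> (\<exists>y\<in>pre \<xi> k. visC \<xi> y i j)"

definition UC :: "world \<Rightarrow> nat \<Rightarrow> nat \<Rightarrow> nat \<Rightarrow> nat set" where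
  "UC \<xi> k i j = \<Union>{y \<in> pre \<xi> k. visC \<xi> y i j}"

text \<open>The drop is measured only after an earlier visit: at the first one \<open>KT\<close>
  still contains all variables and any point of the layers drops about \<open>m\<close> of them. The
  same condition limits the union bound to indices already seen.\<close>

definition BadT :: "nat \<Rightarrow> nat \<Rightarrow> world set" where
  "BadT k i = {\<xi> \<in> W. k < length (xs \<xi>) \<and> seenT \<xi> k i \<and> visT \<xi> (xs \<xi> ! k) i \<and>
     LL \<le> card (KT \<xi> k i - xs \<xi> ! k)}"

definition BadC :: "nat \<Rightarrow> nat \<Rightarrow> nat \<Rightarrow> world set" where
  "BadC k i j = {\<xi> \<in> W. k < length (xs \<xi>) \<and> seenC \<xi> k i j \<and> visC \<xi> (xs \<xi> ! k) i j \<and>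
     LL \<le> card (xs \<xi> ! k - UC \<xi> k i j)}"

definition Bad :: "world set" where
  "Bad = (\<Union>k<Q. (\<Union>i<2 ^ (m - 3). BadT k i) \<union>
     (\<Union>(i, j)\<in>{..<2 ^ (m - 3)} \<times> {..<2 ^ (3 * m - 1)}. BadC k i j))"

lemma finite_pre [simp]: "finite (pre \<xi> k)"
  by (simp add: pre_def)

lemma card_pre: "card (pre \<xi> k) \<le> k"
  unfolding pre_def using card_length[of "take k (xs \<xi>)"] by simp

lemma prefix_same:
  assumes "k < length (xs \<xi>)" "\<And>y. y \<in> pre \<xi> k \<Longrightarrow> gfun True \<xi>' y = gfun True \<xi> y"
  shows "k < length (xs \<xi>')" "take (Suc k) (xs \<xi>') = take (Suc k) (xs \<xi>)"
    "pre \<xi>' k = pre \<xi> k" "xs \<xi>' ! k = xs \<xi> ! k"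
proof -
  show T: "take (Suc k) (xs \<xi>') = take (Suc k) (xs \<xi>)"
    unfolding xs_def by (rule queries_agree) (use assms(2) in \<open>auto simp: pre_def xs_def\<close>)
  then have "length (take (Suc k) (xs \<xi>')) = Suc k" using assms(1) by simp
  then show L: "k < length (xs \<xi>')" by simp
  have "take k (xs \<xi>') = take k (xs \<xi>)" using arg_cong[OF T, of "take k"] by (simp add: min_def)
  then show "pre \<xi>' k = pre \<xi> k" by (simp add: pre_def)
  show "xs \<xi>' ! k = xs \<xi> ! k" using arg_cong[OF T, of "\<lambda>l. l ! k"] by simp
qed

text \<open>The dropped variables lie in all earlier points that show the term, so adding any of
  them to the term changes no earlier answer. The term is satisfied by the new query only if it
  avoids all of them, at a cost of \<open>2 ^ LL\<close>.\<close>

lemma card_BadT: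
  assumes i: "i < 2 ^ (m - 3)"
  shows "card (BadT k i) * 2 ^ LL \<le> card {\<xi> \<in> W. k < length (xs \<xi>) \<and> seenT \<xi> k i}"
proof (rule card_spread[where v = "TI i" and N = "\<lambda>\<xi>. KT \<xi> k i - xs \<xi> ! k"])
  show "finite {\<xi> \<in> W. k < length (xs \<xi>) \<and> seenT \<xi> k i}" by simp
next
  fix \<xi> assume b: "\<xi> \<in> BadT k i"
  then have "\<xi> (TI i) \<subseteq> xs \<xi> ! k" using low2_subset by (fastforce simp: BadT_def visT_def TT_def)
  then show "finite (KT \<xi> k i - xs \<xi> ! k) \<and> \<xi> (TI i) \<inter> (KT \<xi> k i - xs \<xi> ! k) = {} \<and>
      LL \<le> card (KT \<xi> k i - xs \<xi> ! k)"
    using b by (auto simp: BadT_def KT_def)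
next
  fix \<xi> S
  assume b: "\<xi> \<in> BadT k i" and S: "S \<subseteq> KT \<xi> k i - xs \<xi> ! k"
  let ?\<xi> = "\<xi>(TI i := \<xi> (TI i) \<union> S)"
  have b': "\<xi> \<in> W" "k < length (xs \<xi>)" "seenT \<xi> k i" using b by (auto simp: BadT_def)
  have agree: "gfun True ?\<xi> y = gfun True \<xi> y \<and> (visT ?\<xi> y i = visT \<xi> y i)" if y: "y \<in> pre \<xi> k" for y
  proof (cases "lev y")
    case True
    have "S \<subseteq> y" if "i \<in> low2 (TT \<xi> y)" using S y True that by (auto simp: KT_def visT_def)
    then show ?thesis using TI_upd[of i \<xi> y S] True by (auto simp: visT_def)
  qed (simp add: gfun_def visT_def)
  note p = prefix_same[OF b'(2), of ?\<xi>]
  have W: "?\<xi> \<in> W"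
  proof (rule W_upd[OF b'(1)])
    have "\<xi> (TI i) \<in> Dom (TI i)" by (rule W_mem[OF b'(1)]) (use i in simp)
    then show "\<xi> (TI i) \<union> S \<in> Dom (TI i)" using S by (auto simp: KT_def)
  qed (use i in simp)
  have "seenT ?\<xi> k i" using b'(3) p(3) agree unfolding seenT_def by simp
  moreover have "KT ?\<xi> k i = KT \<xi> k i" using p(3) agree unfolding KT_def by simp
  ultimately show "?\<xi> \<in> {\<xi> \<in> W. k < length (xs \<xi>) \<and> seenT \<xi> k i} \<and>
      KT ?\<xi> k i - xs ?\<xi> ! k = KT \<xi> k i - xs \<xi> ! k"
    using W p agree by simp
qed

text \<open>Dual: the new variables of the query occur in no earlier point that shows the clause, so
  adding them to the clause goes unnoticed, while a falsified clause has to avoid them all.\<close>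

lemma card_BadC:
  assumes ij: "i < 2 ^ (m - 3)" "j < 2 ^ (3 * m - 1)"
  shows "card (BadC k i j) * 2 ^ LL \<le> card {\<xi> \<in> W. k < length (xs \<xi>) \<and> seenC \<xi> k i j}"
proof (rule card_spread[where v = "CI i j" and N = "\<lambda>\<xi>. xs \<xi> ! k - UC \<xi> k i j"])
  show "finite {\<xi> \<in> W. k < length (xs \<xi>) \<and> seenC \<xi> k i j}" by simp
next
  fix \<xi> assume b: "\<xi> \<in> BadC k i j"
  then have "\<xi> (CI i j) \<inter> xs \<xi> ! k = {}" using low2_subset by (fastforce simp: BadC_def visC_def CC_def)
  moreover have "finite (xs \<xi> ! k)" using b lev_finite by (auto simp: BadC_def visC_def)
  ultimately show "finite (xs \<xi> ! k - UC \<xi> k i j) \<and> \<xi> (CI i j) \<inter> (xs \<xi> ! k - UC \<xi> k i j) = {} \<and>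
      LL \<le> card (xs \<xi> ! k - UC \<xi> k i j)"
    using b by (auto simp: BadC_def)
next
  fix \<xi> S
  assume b: "\<xi> \<in> BadC k i j" and S: "S \<subseteq> xs \<xi> ! k - UC \<xi> k i j"
  let ?\<xi> = "\<xi>(CI i j := \<xi> (CI i j) \<union> S)"
  have b': "\<xi> \<in> W" "k < length (xs \<xi>)" "seenC \<xi> k i j" "lev (xs \<xi> ! k)"
    using b by (auto simp: BadC_def visC_def)
  have agree: "gfun True ?\<xi> y = gfun True \<xi> y \<and> (visC ?\<xi> y i j = visC \<xi> y i j)" if y: "y \<in> pre \<xi> k" for y
  proof -
    have "S \<inter> y = {}" if "visC \<xi> y i j" using S y that by (auto simp: UC_def)
    then show ?thesis using CI_upd[of \<xi> y i j S] by simp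
  qed
  note p = prefix_same[OF b'(2), of ?\<xi>]
  have W: "?\<xi> \<in> W"
  proof (rule W_upd[OF b'(1)])
    have "\<xi> (CI i j) \<in> Dom (CI i j)" by (rule W_mem[OF b'(1)]) (use ij in simp)
    then show "\<xi> (CI i j) \<union> S \<in> Dom (CI i j)" using S b'(4) by (auto simp: lev_def)
  qed (use ij in simp)
  have "seenC ?\<xi> k i j" using b'(3) p(3) agree unfolding seenC_def by simp
  moreover have "UC ?\<xi> k i j = UC \<xi> k i j" using p(3) agree unfolding UC_def
    by (intro arg_cong[where f = Union] Collect_cong) auto
  ultimately show "?\<xi> \<in> {\<xi> \<in> W. k < length (xs \<xi>) \<and> seenC \<xi> k i j} \<and>
      xs ?\<xi> ! k - UC ?\<xi> k i j = xs \<xi> ! k - UC \<xi> k i j"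
    using W p agree by simp
qed

lemma card_visT: "card {i. visT \<xi> y i} \<le> 2"
proof (cases "lev y")
  case True
  then have "{i. visT \<xi> y i} = low2 (TT \<xi> y)" by (auto simp: visT_def)
  then show ?thesis using card_low2[OF finite_TT] by simp
qed (simp add: visT_def)

lemma finite_visT [simp]: "finite {i. visT \<xi> y i}"
  by (rule finite_subset[of _ "TT \<xi> y"]) (use low2_subset in \<open>auto simp: visT_def\<close>)

lemma visC_pairs: "finite {p. visC \<xi> y (fst p) (snd p)} \<and> card {p. visC \<xi> y (fst p) (snd p)} \<le> 2"
proof (cases "lev y \<and> (\<exists>i. TT \<xi> y = {i})")
  case True
  then obtain i where i: "lev y" "TT \<xi> y = {i}" by auto
  have "visC \<xi> y a b \<longleftrightarrow> a = i \<and> b \<in> low2 (CC \<xi> i y)" for a b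
    unfolding visC_def i(2) using i(1) by blast
  then have e: "{p. visC \<xi> y (fst p) (snd p)} = {i} \<times> low2 (CC \<xi> i y)"
    by (intro set_eqI) (simp add: mem_Times_iff)
  have "finite (low2 (CC \<xi> i y))" using finite_subset[OF low2_subset finite_CC] .
  then show ?thesis unfolding e using card_low2[OF finite_CC, of \<xi> i y]
    by (simp add: card_cartesian_product)
next
  case False
  then have "\<not> visC \<xi> y a b" for a b unfolding visC_def by blast
  then show ?thesis by simp
qed

text \<open>Each query shows at most two terms and two clauses, so in a given world only
  \<open>2 * Q\<close> of the exponentially many indices of either kind can be revisited. Two kinds
  and \<open>Q\<close> steps give \<open>4 * Q ^ 2\<close>.\<close>

lemma card_Bad: "card Bad * 2 ^ LL \<le> 4 * Q ^ 2 * card W"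
proof -
  let ?I = "{..<2 ^ (m - 3) :: nat}" and ?J = "{..<2 ^ (3 * m - 1) :: nat}"
  have T: "(\<Sum>i\<in>?I. card (BadT k i)) * 2 ^ LL \<le> 2 * Q * card W" if k: "k < Q" for k
  proof -
    have "(\<Sum>i\<in>?I. card (BadT k i)) * 2 ^ LL \<le> (\<Sum>i\<in>?I. card {\<xi> \<in> W. k < length (xs \<xi>) \<and> seenT \<xi> k i})"
      unfolding sum_distrib_right by (rule sum_mono) (use card_BadT in simp)
    also have "\<dots> \<le> 2 * Q * card W"
    proof (rule sum_card_le)
      fix \<xi> assume "\<xi> \<in> W"
      have "{i \<in> ?I. k < length (xs \<xi>) \<and> seenT \<xi> k i} \<subseteq> (\<Union>y\<in>pre \<xi> k. {i. visT \<xi> y i})"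
        by (auto simp: seenT_def)
      then have "card {i \<in> ?I. k < length (xs \<xi>) \<and> seenT \<xi> k i} \<le> card (\<Union>y\<in>pre \<xi> k. {i. visT \<xi> y i})"
        by (rule card_mono[rotated]) simp
      also have "\<dots> \<le> (\<Sum>y\<in>pre \<xi> k. card {i. visT \<xi> y i})" by (rule card_UN_le) simp
      also have "\<dots> \<le> (\<Sum>y\<in>pre \<xi> k. 2)" by (rule sum_mono) (rule card_visT)
      also have "\<dots> \<le> 2 * Q" using card_pre[of \<xi> k] k by simp
      finally show "card {i \<in> ?I. k < length (xs \<xi>) \<and> seenT \<xi> k i} \<le> 2 * Q" .
    qed simp_all
    finally show ?thesis .
  qed
  have C: "(\<Sum>(i, j)\<in>?I \<times> ?J. card (BadC k i j)) * 2 ^ LL \<le> 2 * Q * card W" if k: "k < Q" for k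
  proof -
    have "(\<Sum>(i, j)\<in>?I \<times> ?J. card (BadC k i j)) * 2 ^ LL
        \<le> (\<Sum>p\<in>?I \<times> ?J. card {\<xi> \<in> W. k < length (xs \<xi>) \<and> seenC \<xi> k (fst p) (snd p)})"
      unfolding sum_distrib_right by (rule sum_mono) (use card_BadC in auto)
    also have "\<dots> \<le> 2 * Q * card W"
    proof (rule sum_card_le)
      fix \<xi> assume "\<xi> \<in> W"
      let ?P = "\<lambda>y. {p. visC \<xi> y (fst p) (snd p)}"
      have "{p \<in> ?I \<times> ?J. k < length (xs \<xi>) \<and> seenC \<xi> k (fst p) (snd p)} \<subseteq> (\<Union>y\<in>pre \<xi> k. ?P y)"
        by (auto simp: seenC_def)
      then have "card {p \<in> ?I \<times> ?J. k < length (xs \<xi>) \<and> seenC \<xi> k (fst p) (snd p)} \<le> card (\<Union>y\<in>pre \<xi> k. ?P y)"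
        by (rule card_mono[rotated]) (use visC_pairs in simp)
      also have "\<dots> \<le> (\<Sum>y\<in>pre \<xi> k. card (?P y))" by (rule card_UN_le) simp
      also have "\<dots> \<le> (\<Sum>y\<in>pre \<xi> k. 2)" by (rule sum_mono) (use visC_pairs in blast)
      also have "\<dots> \<le> 2 * Q" using card_pre[of \<xi> k] k by simp
      finally show "card {p \<in> ?I \<times> ?J. k < length (xs \<xi>) \<and> seenC \<xi> k (fst p) (snd p)} \<le> 2 * Q" .
    qed simp_all
    finally show ?thesis .
  qed
  have "card Bad \<le> (\<Sum>k<Q. card ((\<Union>i\<in>?I. BadT k i) \<union> (\<Union>(i, j)\<in>?I \<times> ?J. BadC k i j)))"
    unfolding Bad_def by (rule card_UN_le) simp
  also have "\<dots> \<le> (\<Sum>k<Q. (\<Sum>i\<in>?I. card (BadT k i)) + (\<Sum>(i, j)\<in>?I \<times> ?J. card (BadC k i j)))"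
  proof (rule sum_mono)
    fix k
    have "card (\<Union>i\<in>?I. BadT k i) \<le> (\<Sum>i\<in>?I. card (BadT k i))" by (rule card_UN_le) simp
    moreover have "card (\<Union>(i, j)\<in>?I \<times> ?J. BadC k i j) \<le> (\<Sum>p\<in>?I \<times> ?J. card (case p of (i, j) \<Rightarrow> BadC k i j))"
      by (rule card_UN_le) simp
    ultimately show "card ((\<Union>i\<in>?I. BadT k i) \<union> (\<Union>(i, j)\<in>?I \<times> ?J. BadC k i j))
        \<le> (\<Sum>i\<in>?I. card (BadT k i)) + (\<Sum>(i, j)\<in>?I \<times> ?J. card (BadC k i j))"
      using card_Un_le[of "\<Union>i\<in>?I. BadT k i" "\<Union>(i, j)\<in>?I \<times> ?J. BadC k i j"]
      by (simp add: case_prod_unfold)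
  qed
  finally have "card Bad * 2 ^ LL \<le>
      (\<Sum>k<Q. (\<Sum>i\<in>?I. card (BadT k i)) + (\<Sum>(i, j)\<in>?I \<times> ?J. card (BadC k i j))) * 2 ^ LL"
    by simp
  also have "\<dots> \<le> (\<Sum>k<Q. 4 * Q * card W)"
    unfolding sum_distrib_right
  proof (rule sum_mono)
    fix k assume "k \<in> {..<Q}"
    then show "((\<Sum>i\<in>?I. card (BadT k i)) + (\<Sum>(i, j)\<in>?I \<times> ?J. card (BadC k i j))) * 2 ^ LL \<le> 4 * Q * card W"
      using T[of k] C[of k] unfolding add_mult_distrib by simp
  qed
  finally show ?thesis by (simp add: power2_eq_square)
qed

end

section \<open>Number of variables tested inside the regions\<close>

context exploration
begin

definition IJ :: "(nat \<times> nat) set" where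
  "IJ = {..<2 ^ (m - 3)} \<times> {..<2 ^ (3 * m - 1)}"

definition vis :: "world \<Rightarrow> nat \<Rightarrow> nat \<Rightarrow> nat \<Rightarrow> nat set list" where
  "vis \<xi> k i j = filter (\<lambda>z. inreg \<xi> z i j) (take k (xs \<xi>))"

text \<open>Comparison with the head loses nothing: of two visited points that differ in
  \<open>t\<close>, one differs from the head.\<close>

definition touched :: "world \<Rightarrow> nat \<Rightarrow> nat \<Rightarrow> nat \<Rightarrow> nat set" where
  "touched \<xi> k i j = {t. \<exists>z\<in>set (vis \<xi> k i j). (t \<in> z) \<noteq> (t \<in> hd (vis \<xi> k i j))}"

definition tot :: "world \<Rightarrow> nat \<Rightarrow> nat" where
  "tot \<xi> k = (\<Sum>(i, j)\<in>IJ. card (touched \<xi> k i j))"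

text \<open>Visits are counted through \<open>visC\<close> instead of \<open>inreg\<close>, because
  points falsifying further clauses of the same term enlarge \<open>UC\<close> too.\<close>

definition rC :: "world \<Rightarrow> nat \<Rightarrow> nat \<Rightarrow> nat \<Rightarrow> nat" where
  "rC \<xi> k i j = card {l. l < k \<and> visC \<xi> (xs \<xi> ! l) i j}"

lemma finite_IJ [simp]: "finite IJ"
  by (simp add: IJ_def)

lemma pre_Suc: "k < length (xs \<xi>) \<Longrightarrow> pre \<xi> (Suc k) = insert (xs \<xi> ! k) (pre \<xi> k)"
  by (simp add: pre_def take_Suc_conv_app_nth)

lemma pre_0 [simp]: "pre \<xi> 0 = {}"
  by (simp add: pre_def)

lemma length_xs: "\<xi> \<in> W \<Longrightarrow> length (xs \<xi>) \<le> Q"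
  unfolding xs_def by (rule length_le)

lemma vis_visC: "z \<in> set (vis \<xi> k i j) \<Longrightarrow> z \<in> pre \<xi> k \<and> inreg \<xi> z i j \<and> visC \<xi> z i j"
  by (auto simp: vis_def pre_def intro: inreg_visC)

lemma touched_lt: "t \<in> touched \<xi> k i j \<Longrightarrow> t < 4 * m"
proof -
  assume "t \<in> touched \<xi> k i j"
  then obtain z where z: "z \<in> set (vis \<xi> k i j)" "(t \<in> z) \<noteq> (t \<in> hd (vis \<xi> k i j))"
    by (auto simp: touched_def)
  then have "hd (vis \<xi> k i j) \<in> set (vis \<xi> k i j)" by (cases "vis \<xi> k i j") auto
  then have "z \<subseteq> {..<4 * m}" "hd (vis \<xi> k i j) \<subseteq> {..<4 * m}"
    using z(1) vis_visC by (auto simp: inreg_def lev_def)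
  then show ?thesis using z(2) by auto
qed

lemma finite_touched [simp]: "finite (touched \<xi> k i j)"
  by (rule finite_subset[of _ "{..<4 * m}"]) (auto dest: touched_lt)

lemma not_Bad:
  assumes "\<xi> \<in> W" "\<xi> \<notin> Bad" "k < length (xs \<xi>)"
  shows "seenT \<xi> k i \<Longrightarrow> visT \<xi> (xs \<xi> ! k) i \<Longrightarrow> card (KT \<xi> k i - xs \<xi> ! k) < LL"
    and "seenC \<xi> k i j \<Longrightarrow> visC \<xi> (xs \<xi> ! k) i j \<Longrightarrow> card (xs \<xi> ! k - UC \<xi> k i j) < LL"
proof -
  have k: "k < Q" using assms length_xs by fastforce
  {
    assume h: "seenT \<xi> k i" "visT \<xi> (xs \<xi> ! k) i"
    have "i < 2 ^ (m - 3)" using h(2) low2_subset by (fastforce simp: visT_def TT_def)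
    then have "\<xi> \<notin> BadT k i" using assms(2) k by (auto simp: Bad_def)
    then show "card (KT \<xi> k i - xs \<xi> ! k) < LL" using assms h by (auto simp: BadT_def)
  next
    assume h: "seenC \<xi> k i j" "visC \<xi> (xs \<xi> ! k) i j"
    have "i \<in> TT \<xi> (xs \<xi> ! k)" using h(2) by (auto simp: visC_def)
    then have "i < 2 ^ (m - 3)" by (auto simp: TT_def)
    moreover have "j < 2 ^ (3 * m - 1)" using h(2) low2_subset by (fastforce simp: visC_def CC_def)
    ultimately have "\<xi> \<notin> BadC k i j" using assms(2) k by (auto simp: Bad_def)
    then show "card (xs \<xi> ! k - UC \<xi> k i j) < LL" using assms h by (auto simp: BadC_def)
  }
qed

lemma KT_large:
  assumes "\<xi> \<in> W" "\<xi> \<notin> Bad"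
  shows "k \<le> length (xs \<xi>) \<Longrightarrow> seenT \<xi> k i \<Longrightarrow> 3 * m + LL \<le> card (KT \<xi> k i) + k * LL"
proof (induction k)
  case 0
  then show ?case by (simp add: seenT_def)
next
  case (Suc k)
  let ?c = "xs \<xi> ! k"
  have k: "k < length (xs \<xi>)" using Suc.prems by simp
  note ps = pre_Suc[OF k]
  show ?case
  proof (cases "visT \<xi> ?c i")
    case False
    then have "KT \<xi> (Suc k) i = KT \<xi> k i" "seenT \<xi> k i"
      using Suc.prems(2) by (auto simp: KT_def ps seenT_def)
    then show ?thesis using Suc.IH k by simp
  next
    case True
    then have K: "KT \<xi> (Suc k) i = KT \<xi> k i \<inter> ?c" by (auto simp: KT_def ps)
    have fin: "finite (KT \<xi> k i)" by (simp add: KT_def)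
    show ?thesis
    proof (cases "seenT \<xi> k i")
      case seen: True
      have "card (KT \<xi> k i) = card (KT \<xi> k i \<inter> ?c) + card (KT \<xi> k i - ?c)"
        using fin by (simp add: card_Int_Diff)
      then show ?thesis using not_Bad(1)[OF assms k seen True] Suc.IH seen k by (simp add: K)
    next
      case False
      then have "KT \<xi> k i = {..<4 * m}" by (auto simp: KT_def seenT_def)
      moreover have "?c \<subseteq> {..<4 * m}" "card ?c \<ge> 3 * m" using True by (auto simp: visT_def lev_def)
      ultimately have "card (KT \<xi> (Suc k) i) \<ge> 3 * m" by (simp add: K Int_absorb1)
      then show ?thesis by simp
    qed
  qed
qed

lemma rC_Suc: "rC \<xi> (Suc k) i j = rC \<xi> k i j + (if visC \<xi> (xs \<xi> ! k) i j then 1 else 0)"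
proof -
  have "{l. l < Suc k \<and> visC \<xi> (xs \<xi> ! l) i j} = (if visC \<xi> (xs \<xi> ! k) i j
      then insert k {l. l < k \<and> visC \<xi> (xs \<xi> ! l) i j} else {l. l < k \<and> visC \<xi> (xs \<xi> ! l) i j})"
    by (auto simp: less_Suc_eq)
  then show ?thesis by (simp add: rC_def)
qed

text \<open>Starting from at most \<open>3 * m + 1\<close> variables, each further visit adds fewer
  than \<open>LL\<close>. Here only visits showing this clause are charged, so the bound is local to
  the region.\<close>

lemma UC_small:
  assumes "\<xi> \<in> W" "\<xi> \<notin> Bad"
  shows "k \<le> length (xs \<xi>) \<Longrightarrow> seenC \<xi> k i j \<Longrightarrow>
    card (UC \<xi> k i j) + LL \<le> 3 * m + 1 + rC \<xi> k i j * LL \<and> 1 \<le> rC \<xi> k i j"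
proof (induction k)
  case 0
  then show ?case by (simp add: seenC_def)
next
  case (Suc k)
  let ?c = "xs \<xi> ! k"
  have k: "k < length (xs \<xi>)" using Suc.prems by simp
  note ps = pre_Suc[OF k]
  show ?case
  proof (cases "visC \<xi> ?c i j")
    case False
    then have "UC \<xi> (Suc k) i j = UC \<xi> k i j" "seenC \<xi> k i j"
      using Suc.prems(2) by (auto simp: UC_def ps seenC_def)
    then show ?thesis using Suc.IH k False by (simp add: rC_Suc)
  next
    case True
    then have K: "UC \<xi> (Suc k) i j = UC \<xi> k i j \<union> (?c - UC \<xi> k i j)" by (auto simp: UC_def ps)
    show ?thesis
    proof (cases "seenC \<xi> k i j")
      case seen: True
      have "card (UC \<xi> (Suc k) i j) \<le> card (UC \<xi> k i j) + card (?c - UC \<xi> k i j)"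
        unfolding K by (rule card_Un_le)
      then show ?thesis using not_Bad(2)[OF assms k seen True] Suc.IH seen k True by (simp add: rC_Suc)
    next
      case False
      then have "UC \<xi> k i j = {}" by (auto simp: UC_def seenC_def)
      moreover have "card ?c \<le> 3 * m + 1" using True by (auto simp: visC_def lev_def)
      ultimately show ?thesis using True by (simp add: K rC_Suc)
    qed
  qed
qed

text \<open>
  The two bounds in the minimum are where the exponent $2/3$ comes from: variables turned off inside a
  region are limited both by the visits to that region and by all visits to its term.
\<close>

lemma card_touched:
  assumes "\<xi> \<in> W" "\<xi> \<notin> Bad" and k: "k \<le> length (xs \<xi>)"
  shows "card (touched \<xi> k i j) \<le> rC \<xi> k i j * LL + min (2 * rC \<xi> k i j ^ 2 * LL) (Q * LL)"
proof (cases "vis \<xi> k i j")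
  case Nil
  then show ?thesis by (simp add: touched_def)
next
  case (Cons y zs)
  let ?V = "set (vis \<xi> k i j)" and ?r = "rC \<xi> k i j" and ?U = "UC \<xi> k i j"
  have y: "y \<in> ?V" using Cons by simp
  have kQ: "k \<le> Q" using k length_xs[OF assms(1)] by simp
  have V: "lev z \<and> z \<subseteq> ?U \<and> visT \<xi> z i \<and> z \<in> pre \<xi> k" if "z \<in> ?V" for z
    using vis_visC[OF that] visC_visT by (auto simp: UC_def visC_def)
  have seen: "seenC \<xi> k i j" "seenT \<xi> k i" using V[OF y] vis_visC[OF y] by (auto simp: seenC_def seenT_def)
  note U = UC_small[OF assms(1,2) k seen(1)]
  have finU: "finite ?U" unfolding UC_def by (intro finite_Union) (auto simp: visC_def intro: lev_finite)
  have cy: "3 * m \<le> card y" "card y \<le> 3 * m + 1" using V[OF y] by (auto simp: lev_def)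
  have Uy: "card (?U - y) \<le> ?r * LL"
  proof -
    have "card (?U - y) = card ?U - card y" using V[OF y] lev_finite by (simp add: card_Diff_subset)
    then show ?thesis using U cy LL by linarith
  qed
  \<comment> \<open>The layers are adjacent, so a point turns off at most one variable more than it
    turns on; that extra one is absorbed into the factor 2.\<close>
  have yz: "card (y - z) \<le> 2 * ?r * LL" if z: "z \<in> ?V" for z
  proof -
    have fin: "finite y" "finite z" using V y z lev_finite by blast+
    have "card (z - y) \<le> card (?U - y)" by (rule card_mono) (use finU V[OF z] in auto)
    moreover have "card y = card (y \<inter> z) + card (y - z)" "card z = card (z \<inter> y) + card (z - y)"
      using fin by (simp_all add: card_Int_Diff)
    moreover have "card y \<le> card z + 1" using V[OF y] V[OF z] by (auto simp: lev_def)
    ultimately have "card (y - z) \<le> 1 + ?r * LL" using Uy by (simp add: Int_commute)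
    moreover have "1 \<le> ?r * LL" using U LL by simp
    moreover have "2 * ?r * LL = ?r * LL + ?r * LL" by simp
    ultimately show ?thesis by linarith
  qed
  have "card ?V \<le> ?r"
  proof -
    have "?V \<subseteq> (\<lambda>l. xs \<xi> ! l) ` {l. l < k \<and> visC \<xi> (xs \<xi> ! l) i j}"
    proof
      fix z assume z: "z \<in> ?V"
      then have "z \<in> set (take k (xs \<xi>))" by (auto simp: vis_def)
      then obtain l where "l < k" "z = xs \<xi> ! l" by (auto simp: in_set_conv_nth)
      then show "z \<in> (\<lambda>l. xs \<xi> ! l) ` {l. l < k \<and> visC \<xi> (xs \<xi> ! l) i j}" using vis_visC[OF z] by auto
    qed
    then have "card ?V \<le> card ((\<lambda>l. xs \<xi> ! l) ` {l. l < k \<and> visC \<xi> (xs \<xi> ! l) i j})"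
      by (rule card_mono[rotated]) simp
    also have "\<dots> \<le> ?r" unfolding rC_def by (rule card_image_le) simp
    finally show ?thesis .
  qed
  moreover have "card (\<Union>z\<in>?V. y - z) \<le> (\<Sum>z\<in>?V. card (y - z))" by (rule card_UN_le) simp
  moreover have "(\<Sum>z\<in>?V. card (y - z)) \<le> card ?V * (2 * ?r * LL)"
    using sum_bounded_above[of ?V "\<lambda>z. card (y - z)" "2 * ?r * LL"] yz by simp
  moreover have "card ?V * (2 * ?r * LL) \<le> ?r * (2 * ?r * LL)" using \<open>card ?V \<le> ?r\<close> by (rule mult_le_mono1)
  moreover have "?r * (2 * ?r * LL) = 2 * ?r ^ 2 * LL" by (simp add: power2_eq_square)
  ultimately have A: "card (\<Union>z\<in>?V. y - z) \<le> 2 * ?r ^ 2 * LL" by linarith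
  \<comment> \<open>All visited points contain \<open>KT\<close>. Hence everything ever turned off
    lies in \<open>y - KT\<close>, no matter how many visits there are.\<close>
  have KTy: "KT \<xi> k i \<subseteq> y" using V[OF y] by (auto simp: KT_def)
  have B: "card (y - KT \<xi> k i) \<le> Q * LL"
  proof -
    have "card (y - KT \<xi> k i) = card y - card (KT \<xi> k i)"
      using KTy V[OF y] lev_finite by (meson card_Diff_subset finite_subset)
    then have "card (y - KT \<xi> k i) \<le> k * LL" using KT_large[OF assms(1,2) k seen(2)] cy LL by linarith
    then show ?thesis using mult_le_mono1[OF kQ, of LL] by linarith
  qed
  have fin1: "finite (\<Union>z\<in>?V. y - z)" using V[OF y] lev_finite by auto
  have sub: "(\<Union>z\<in>?V. y - z) \<subseteq> y - KT \<xi> k i" using V by (auto simp: KT_def)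
  have "card (\<Union>z\<in>?V. y - z) \<le> card (y - KT \<xi> k i)"
    by (rule card_mono[OF _ sub]) (use V[OF y] lev_finite in auto)
  then have AB: "card (\<Union>z\<in>?V. y - z) \<le> min (2 * ?r ^ 2 * LL) (Q * LL)" using A B by simp
  have "touched \<xi> k i j \<subseteq> (?U - y) \<union> (\<Union>z\<in>?V. y - z)"
    using V Cons by (auto simp: touched_def)
  then have "card (touched \<xi> k i j) \<le> card ((?U - y) \<union> (\<Union>z\<in>?V. y - z))"
    by (rule card_mono[rotated]) (use finU fin1 in auto)
  also have "\<dots> \<le> card (?U - y) + card (\<Union>z\<in>?V. y - z)" by (rule card_Un_le)
  finally show ?thesis using Uy AB by linarith
qed

lemma sum_rC: "\<xi> \<in> W \<Longrightarrow> (\<Sum>(i, j)\<in>IJ. rC \<xi> k i j) \<le> 2 * k"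
proof (induction k)
  case 0
  then show ?case by (simp add: rC_def case_prod_unfold)
next
  case (Suc k)
  have "(\<Sum>p\<in>IJ. if visC \<xi> (xs \<xi> ! k) (fst p) (snd p) then 1 else 0) \<le> (2::nat)"
  proof -
    have "(\<Sum>p\<in>IJ. if visC \<xi> (xs \<xi> ! k) (fst p) (snd p) then 1 else 0)
        = card {p \<in> IJ. visC \<xi> (xs \<xi> ! k) (fst p) (snd p)}"
      by (simp add: sum.If_cases Int_def)
    also have "\<dots> \<le> card {p. visC \<xi> (xs \<xi> ! k) (fst p) (snd p)}"
      by (rule card_mono) (use visC_pairs in auto)
    finally show ?thesis using visC_pairs[of \<xi> "xs \<xi> ! k"] by linarith
  qed
  then show ?case using Suc by (simp add: rC_Suc case_prod_unfold sum.distrib)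
qed

text \<open>The geometric mean bounds the minimum by \<open>r * LL * sqrt (2 * Q)\<close>, which is
  linear in the number \<open>r\<close> of visits and can be summed over the regions with
  \<open>sum_rC\<close>.\<close>

lemma tot_le:
  assumes "\<xi> \<in> W" "\<xi> \<notin> Bad" and k: "k \<le> length (xs \<xi>)"
  shows "real (tot \<xi> k) \<le> 2 * real Q * real LL * (1 + sqrt (2 * real Q))"
proof -
  let ?s = "1 + sqrt (2 * real Q)"
  have kQ: "k \<le> Q" using k length_xs[OF assms(1)] by simp
  have one: "real (card (touched \<xi> k i j)) \<le> real LL * ?s * real (rC \<xi> k i j)" for i j
  proof -
    let ?r = "rC \<xi> k i j"
    let ?a = "2 * real ?r ^ 2 * real LL" and ?b = "real Q * real LL"
    have "min ?a ?b \<le> sqrt (?a * ?b)"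
    proof (rule real_le_rsqrt)
      have "min ?a ?b * min ?a ?b \<le> ?a * ?b" by (rule mult_mono) auto
      then show "(min ?a ?b)\<^sup>2 \<le> ?a * ?b" by (simp add: power2_eq_square)
    qed
    also have "?a * ?b = (real ?r * real LL) ^ 2 * (2 * real Q)" by (simp add: power2_eq_square)
    also have "sqrt \<dots> = real ?r * real LL * sqrt (2 * real Q)" by (simp add: real_sqrt_mult)
    finally have "min ?a ?b \<le> real ?r * real LL * sqrt (2 * real Q)" .
    moreover have "real (card (touched \<xi> k i j)) \<le> real (?r * LL + min (2 * ?r ^ 2 * LL) (Q * LL))"
      using card_touched[OF assms] by (simp only: of_nat_le_iff)
    moreover have "real (?r * LL + min (2 * ?r ^ 2 * LL) (Q * LL)) = real ?r * real LL + min ?a ?b"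
      by (simp add: of_nat_min)
    ultimately show ?thesis by (simp add: algebra_simps)
  qed
  have "real (tot \<xi> k) = (\<Sum>p\<in>IJ. real (card (touched \<xi> k (fst p) (snd p))))"
    by (simp add: tot_def case_prod_unfold)
  also have "\<dots> \<le> (\<Sum>p\<in>IJ. real LL * ?s * real (rC \<xi> k (fst p) (snd p)))" by (rule sum_mono) (rule one)
  also have "\<dots> = real LL * ?s * real (\<Sum>p\<in>IJ. rC \<xi> k (fst p) (snd p))" by (simp add: sum_distrib_left)
  also have "\<dots> \<le> real LL * ?s * real (2 * Q)"
  proof (rule mult_left_mono)
    have "(\<Sum>p\<in>IJ. rC \<xi> k (fst p) (snd p)) \<le> 2 * Q"
      using sum_rC[OF assms(1), of k] kQ by (simp add: case_prod_unfold)
    then show "real (\<Sum>p\<in>IJ. rC \<xi> k (fst p) (snd p)) \<le> real (2 * Q)" by (simp only: of_nat_le_iff)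
  qed simp
  finally show ?thesis by (simp add: algebra_simps)
qed

end

section \<open>Coupling the two functions\<close>

text \<open>
  Exchanging the roles of members and nonmembers of \<open>y\<close> among the secrets, up to two exceptions.
\<close>

definition is_flip :: "nat \<Rightarrow> nat set \<Rightarrow> (nat \<Rightarrow> nat) \<Rightarrow> bool" where
  "is_flip m y \<phi> \<longleftrightarrow> inj_on \<phi> {..<6 * m} \<and> \<phi> ` {..<6 * m} \<subseteq> {..<6 * m} \<and>
     card {t \<in> {..<6 * m}. (\<phi> t \<in> y) = (t \<in> y)} \<le> 2"

text \<open>The complement of \<open>y\<close> among the \<open>6 * m\<close> secrets is no larger
  than \<open>y\<close>, so it can be matched with a part \<open>A\<close> of \<open>y\<close>. The
  remaining \<open>2 * card y - 6 * m\<close>, that is 0 or 2, elements of \<open>y\<close> stay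
  fixed and are the exceptions.\<close>

lemma is_flip_exists:
  assumes y: "y \<subseteq> {..<4 * m}" and c: "card y = 3 * m \<or> card y = 3 * m + 1"
  shows "\<exists>\<phi>. is_flip m y \<phi>"
proof -
  let ?S = "{..<6 * m}" and ?B = "{..<6 * m} - y"
  have fy: "finite y" using y finite_subset by blast
  have yS: "y \<subseteq> ?S" using y by auto
  have cB: "card ?B = 6 * m - card y" using fy yS by (simp add: card_Diff_subset)
  then have "card ?B \<le> card y" using c by auto
  then obtain A where A: "A \<subseteq> y" "card A = card ?B" by (meson obtain_subset_with_card_n)
  then have fA: "finite A" using fy finite_subset by blast
  then obtain h where h: "bij_betw h A ?B" using A(2) finite_same_card_bij[of A ?B] by auto
  define h' where "h' = the_inv_into A h"
  have h': "bij_betw h' ?B A" unfolding h'_def using h by (rule bij_betw_the_inv_into)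
  define \<phi> where "\<phi> t = (if t \<in> A then h t else if t \<in> y then t else h' t)" for t
  have hA: "h t \<in> ?B" if "t \<in> A" for t using h that by (auto simp: bij_betw_def)
  have hB: "h' t \<in> A" if "t \<in> ?B" for t using h' that by (auto simp: bij_betw_def)
  have inj: "inj_on \<phi> ?S"
  proof (rule inj_onI)
    fix s t assume st: "s \<in> ?S" "t \<in> ?S" "\<phi> s = \<phi> t"
    have ih: "inj_on h A" "inj_on h' ?B" using h h' by (auto simp: bij_betw_def)
    consider "s \<in> A" "t \<in> A" | "s \<in> A" "t \<notin> A" | "s \<notin> A" "t \<in> A" | "s \<notin> A" "t \<notin> A" by blast
    then show "s = t"
    proof cases
      case 1
      then show ?thesis using st ih(1) by (auto simp: \<phi>_def dest: inj_onD)
    next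
      case 2
      then show ?thesis using st hA[of s] hB[of t] A(1) by (auto simp: \<phi>_def split: if_splits)
    next
      case 3
      then show ?thesis using st hA[of t] hB[of s] A(1) by (auto simp: \<phi>_def split: if_splits)
    next
      case 4
      then show ?thesis using st ih(2) hB[of s] hB[of t]
        by (cases "s \<in> y"; cases "t \<in> y") (auto simp: \<phi>_def dest: inj_onD)
    qed
  qed
  have sub: "\<phi> ` ?S \<subseteq> ?S" using hA hB A(1) yS by (fastforce simp: \<phi>_def)
  have "{t \<in> ?S. (\<phi> t \<in> y) = (t \<in> y)} \<subseteq> y - A"
    using hA hB A(1) by (fastforce simp: \<phi>_def split: if_splits)
  then have "card {t \<in> ?S. (\<phi> t \<in> y) = (t \<in> y)} \<le> card (y - A)" by (rule card_mono[rotated]) (use fy in simp)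
  also have "card (y - A) = card y - card A" using A(1) fA by (simp add: card_Diff_subset)
  also have "\<dots> \<le> 2" using A(2) cB c by auto
  finally show ?thesis using inj sub unfolding is_flip_def by blast
qed

locale coupling = exploration +
  fixes Wm :: nat
  assumes Wm: "2 * real Q * real LL * (1 + sqrt (2 * real Q)) \<le> real Wm" "2 * Wm \<le> m"
begin

definition flip :: "nat set \<Rightarrow> nat \<Rightarrow> nat" where
  "flip y = (SOME \<phi>. is_flip m y \<phi>)"

text \<open>
  Secrets for which the two functions could have been told apart after \<open>k\<close> queries. All points of a
  region are compared with its first queried point, the head of \<open>vis\<close>.
\<close>

definition badset :: "world \<Rightarrow> nat \<Rightarrow> nat \<Rightarrow> nat \<Rightarrow> nat set" where
  "badset \<xi> k i j = (if vis \<xi> k i j = [] then {} else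
     {t. t < 6 * m \<and> ((flip (hd (vis \<xi> k i j)) t \<in> hd (vis \<xi> k i j)) = (t \<in> hd (vis \<xi> k i j)) \<or>
        t \<in> touched \<xi> k i j \<or> flip (hd (vis \<xi> k i j)) t \<in> touched \<xi> k i j)})"

text \<open>Query \<open>k\<close> is the one that exposes the secret. The budget on
  \<open>tot\<close> belongs to the event so that enough alternative secrets remain; worlds over
  budget are already in \<open>Bad\<close>.\<close>

definition BadS :: "nat \<Rightarrow> nat \<Rightarrow> nat \<Rightarrow> world set" where
  "BadS k i j = {\<xi> \<in> W. k < length (xs \<xi>) \<and> tot \<xi> (Suc k) \<le> Wm \<and>
     (\<exists>s. \<xi> (SI i j) = {s} \<and> s \<notin> badset \<xi> k i j \<and> s \<in> badset \<xi> (Suc k) i j)}"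

text \<open>The values the secret could take with the same first \<open>k\<close> answers. The set
  depends on the secret only through those answers, so it is unchanged when the secret is resampled
  inside it, as \<open>card_resample\<close> requires.\<close>

definition alt :: "world \<Rightarrow> nat \<Rightarrow> nat \<Rightarrow> nat \<Rightarrow> nat set" where
  "alt \<xi> k i j = {t. t < 6 * m \<and> t \<notin> badset \<xi> k i j \<and>
     (\<forall>z\<in>set (vis \<xi> k i j). (t \<in> z) = (\<xi> (SI i j) \<subseteq> z))}"

lemma flip: "lev y \<Longrightarrow> is_flip m y (flip y)"
  unfolding flip_def using someI_ex[OF is_flip_exists[of y m]] by (simp add: lev_def)

lemma vis_Suc: "k < length (xs \<xi>) \<Longrightarrow>
    vis \<xi> (Suc k) i j = vis \<xi> k i j @ (if inreg \<xi> (xs \<xi> ! k) i j then [xs \<xi> ! k] else [])"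
  by (simp add: vis_def take_Suc_conv_app_nth)

lemma lev_hd_vis: "vis \<xi> k i j \<noteq> [] \<Longrightarrow> lev (hd (vis \<xi> k i j)) \<and> hd (vis \<xi> k i j) \<in> set (vis \<xi> k i j)"
proof -
  assume "vis \<xi> k i j \<noteq> []"
  then have "hd (vis \<xi> k i j) \<in> set (vis \<xi> k i j)" by simp
  then show ?thesis using vis_visC by (auto simp: visC_def)
qed

lemma touched_mono: "k < length (xs \<xi>) \<Longrightarrow> touched \<xi> k i j \<subseteq> touched \<xi> (Suc k) i j"
  by (cases "vis \<xi> k i j") (auto simp: touched_def vis_Suc)

lemma finite_badset [simp]: "finite (badset \<xi> k i j)"
  by (rule finite_subset[of _ "{..<6 * m}"]) (auto simp: badset_def split: if_splits)

lemma finite_alt [simp]: "finite (alt \<xi> k i j)"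
  by (rule finite_subset[of _ "{..<6 * m}"]) (auto simp: alt_def)

lemma card_flip_vimage:
  assumes "lev y" "finite D"
  shows "card {t. t < 6 * m \<and> flip y t \<in> D} \<le> card D"
proof (rule card_inj_on_le[where f = "flip y"])
  show "inj_on (flip y) {t. t < 6 * m \<and> flip y t \<in> D}"
    using flip[OF assms(1)] unfolding is_flip_def by (auto intro: inj_on_subset)
qed (use assms in auto)

lemma card_badset:
  assumes "vis \<xi> k i j \<noteq> []"
  shows "card (badset \<xi> k i j) \<le> 2 + 2 * card (touched \<xi> k i j)"
proof -
  let ?y = "hd (vis \<xi> k i j)" and ?D = "touched \<xi> k i j"
  have y: "lev ?y" using lev_hd_vis[OF assms] by blast
  have "badset \<xi> k i j \<subseteq> {t \<in> {..<6 * m}. (flip ?y t \<in> ?y) = (t \<in> ?y)} \<union> (?D \<union> {t. t < 6 * m \<and> flip ?y t \<in> ?D})"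
    by (auto simp: badset_def split: if_splits)
  then have "card (badset \<xi> k i j) \<le> card ({t \<in> {..<6 * m}. (flip ?y t \<in> ?y) = (t \<in> ?y)} \<union>
      (?D \<union> {t. t < 6 * m \<and> flip ?y t \<in> ?D}))" by (rule card_mono[rotated]) simp
  also have "\<dots> \<le> card {t \<in> {..<6 * m}. (flip ?y t \<in> ?y) = (t \<in> ?y)} + (card ?D + card {t. t < 6 * m \<and> flip ?y t \<in> ?D})"
    by (meson add_left_mono card_Un_le order_trans)
  also have "\<dots> \<le> 2 + (card ?D + card ?D)"
    using flip[OF y] card_flip_vimage[OF y, of ?D] by (intro add_mono) (auto simp: is_flip_def)
  finally show ?thesis by simp
qed

text \<open>The two exceptions of the flip are paid at the first visit. Later visits keep the head
  and hence the flip, so only newly touched variables and their preimages enter.\<close>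

lemma card_badset_diff:
  assumes k: "k < length (xs \<xi>)"
  shows "card (badset \<xi> (Suc k) i j - badset \<xi> k i j)
    \<le> 2 + 2 * card (touched \<xi> (Suc k) i j - touched \<xi> k i j)"
proof (cases "vis \<xi> k i j")
  case Nil
  show ?thesis
  proof (cases "vis \<xi> (Suc k) i j = []")
    case True
    then show ?thesis by (simp add: badset_def)
  next
    case False
    then have "vis \<xi> (Suc k) i j = [xs \<xi> ! k]" using Nil vis_Suc[OF k, of i j] by (auto split: if_splits)
    then have "touched \<xi> (Suc k) i j = {}" by (simp add: touched_def)
    then have "card (badset \<xi> (Suc k) i j) \<le> 2" using card_badset[OF False] by simp
    then show ?thesis using Nil by (simp add: badset_def)
  qed
next
  case (Cons y zs)
  let ?D = "touched \<xi> (Suc k) i j - touched \<xi> k i j"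
  have hd: "hd (vis \<xi> (Suc k) i j) = y" "vis \<xi> (Suc k) i j \<noteq> []" "vis \<xi> k i j \<noteq> []" "hd (vis \<xi> k i j) = y"
    using Cons vis_Suc[OF k] by auto
  have y: "lev y" using lev_hd_vis[OF hd(3)] hd(4) by simp
  have "badset \<xi> (Suc k) i j - badset \<xi> k i j \<subseteq> ?D \<union> {t. t < 6 * m \<and> flip y t \<in> ?D}"
    using hd by (auto simp: badset_def)
  then have "card (badset \<xi> (Suc k) i j - badset \<xi> k i j) \<le> card (?D \<union> {t. t < 6 * m \<and> flip y t \<in> ?D})"
    by (rule card_mono[rotated]) simp
  also have "\<dots> \<le> card ?D + card {t. t < 6 * m \<and> flip y t \<in> ?D}" by (rule card_Un_le)
  also have "\<dots> \<le> 2 + 2 * card ?D" using card_flip_vimage[OF y, of ?D] by simp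
  finally show ?thesis .
qed

lemma badset_diff_inreg:
  assumes k: "k < length (xs \<xi>)" and "\<not> inreg \<xi> (xs \<xi> ! k) i j"
  shows "badset \<xi> (Suc k) i j = badset \<xi> k i j"
  using assms vis_Suc[OF k, of i j] by (simp add: badset_def touched_def)

lemma card_touched_le_tot: "(i, j) \<in> IJ \<Longrightarrow> card (touched \<xi> k i j) \<le> tot \<xi> k"
  unfolding tot_def using member_le_sum[of "(i, j)" IJ "\<lambda>(i, j). card (touched \<xi> k i j)"] by simp

lemma secret: "\<xi> \<in> W \<Longrightarrow> (i, j) \<in> IJ \<Longrightarrow> \<exists>s<6 * m. \<xi> (SI i j) = {s}"
  using W_mem[of \<xi> "SI i j"] by (auto simp: IJ_def)

text \<open>The virtual variables pay off here: whether or not \<open>s\<close> lies in the head, at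
  least \<open>3 * m - 1\<close> secrets agree with it there. At most
  \<open>2 + 2 * Wm \<le> m + 2\<close> of them are bad, and
  \<open>2 * m - 3 \<ge> m\<close>.\<close>

lemma card_alt:
  assumes \<xi>: "\<xi> \<in> W" "k < length (xs \<xi>)" "tot \<xi> (Suc k) \<le> Wm" "(i, j) \<in> IJ"
    and s: "\<xi> (SI i j) = {s}" "s \<notin> badset \<xi> k i j"
  shows "m \<le> card (alt \<xi> k i j)"
proof (cases "vis \<xi> k i j")
  case Nil
  then have "alt \<xi> k i j = {..<6 * m}" by (auto simp: alt_def badset_def)
  then show ?thesis by simp
next
  case (Cons y zs)
  have ne: "vis \<xi> k i j \<noteq> []" and hd: "hd (vis \<xi> k i j) = y" using Cons by auto
  have y: "lev y" using lev_hd_vis[OF ne] hd by simp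
  let ?B = "{t \<in> {..<6 * m}. (t \<in> y) = (s \<in> y)}"
  have "s < 6 * m" using secret[OF \<xi>(1,4)] s by auto
  then have sn: "s \<notin> touched \<xi> k i j" using s(2) ne by (auto simp: badset_def)
  have B: "3 * m - 1 \<le> card ?B"
  proof (cases "s \<in> y")
    case True
    then have "y \<subseteq> ?B" using y by (auto simp: lev_def)
    then have "card y \<le> card ?B" by (rule card_mono[rotated]) simp
    then show ?thesis using y by (auto simp: lev_def)
  next
    case False
    then have "?B = {..<6 * m} - y" by auto
    moreover have "y \<subseteq> {..<6 * m}" using y by (auto simp: lev_def)
    ultimately have "card ?B = 6 * m - card y" using lev_finite[OF y] by (simp add: card_Diff_subset)
    then show ?thesis using y by (auto simp: lev_def)
  qed
  have "?B - badset \<xi> k i j \<subseteq> alt \<xi> k i j"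
  proof
    fix t assume t: "t \<in> ?B - badset \<xi> k i j"
    then have tn: "t \<notin> touched \<xi> k i j" using ne by (auto simp: badset_def)
    have "(t \<in> z) = (s \<in> z)" if "z \<in> set (vis \<xi> k i j)" for z
      using that tn sn t hd by (auto simp: touched_def)
    then show "t \<in> alt \<xi> k i j" using t s by (auto simp: alt_def)
  qed
  then have "card (?B - badset \<xi> k i j) \<le> card (alt \<xi> k i j)" by (rule card_mono[rotated]) simp
  moreover have "card ?B - card (badset \<xi> k i j) \<le> card (?B - badset \<xi> k i j)"
    by (rule diff_card_le_card_Diff) simp
  moreover have "card (touched \<xi> k i j) \<le> Wm"
  proof -
    have "card (touched \<xi> k i j) \<le> card (touched \<xi> (Suc k) i j)"
      by (rule card_mono) (simp_all add: touched_mono \<xi>(2))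
    also have "\<dots> \<le> tot \<xi> (Suc k)" using card_touched_le_tot[OF \<xi>(4)] .
    finally show ?thesis using \<xi>(3) by simp
  qed
  moreover note card_badset[OF ne]
  ultimately show ?thesis using B Wm(2) m3 by linarith
qed

text \<open>Given the history, the secret is uniform on at least \<open>m\<close> values and has to
  hit a newly bad one. Only worlds whose query \<open>k\<close> lies in this region are summed,
  since otherwise \<open>badset\<close> does not grow; thus each query is charged to a single
  region.\<close>

lemma card_BadS:
  assumes ij: "(i, j) \<in> IJ"
  shows "real (card (BadS k i j)) \<le> (\<Sum>\<xi>\<in>{\<xi> \<in> W. k < length (xs \<xi>) \<and> tot \<xi> (Suc k) \<le> Wm \<and>
      inreg \<xi> (xs \<xi> ! k) i j}. (2 + 2 * real (card (touched \<xi> (Suc k) i j - touched \<xi> k i j))) / real m)"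
proof -
  let ?X = "\<lambda>\<xi>. (\<lambda>s. {s}) ` (badset \<xi> (Suc k) i j - badset \<xi> k i j)"
  let ?Y = "\<lambda>\<xi>. (\<lambda>s. {s}) ` alt \<xi> k i j"
  let ?F = "{\<xi> \<in> W. k < length (xs \<xi>) \<and> tot \<xi> (Suc k) \<le> Wm \<and> inreg \<xi> (xs \<xi> ! k) i j}"
  let ?E = "{\<xi> \<in> ?F. m \<le> card (alt \<xi> k i j)}"
  have cY: "card (?Y \<xi>) = card (alt \<xi> k i j)" and
    cX: "card (?X \<xi>) = card (badset \<xi> (Suc k) i j - badset \<xi> k i j)" for \<xi>
    by (auto intro!: card_image inj_onI)
  have "real (card (BadS k i j)) \<le> (\<Sum>\<xi>\<in>?E. real (card (?X \<xi>)) / real (card (?Y \<xi>)))"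
  proof (rule card_resample[where v = "SI i j"])
    show "finite ?E" "finite (BadS k i j)" by (simp_all add: BadS_def)
    show "finite (?X \<xi>)" for \<xi> by simp
  next
    fix \<xi> assume "\<xi> \<in> BadS k i j"
    then obtain s where s: "\<xi> \<in> W" "k < length (xs \<xi>)" "tot \<xi> (Suc k) \<le> Wm" "\<xi> (SI i j) = {s}"
      "s \<notin> badset \<xi> k i j" "s \<in> badset \<xi> (Suc k) i j" by (auto simp: BadS_def)
    have "m \<le> card (alt \<xi> k i j)" by (rule card_alt[OF s(1-3) ij s(4,5)])
    then have "alt \<xi> k i j \<noteq> {}" using m3 by auto
    then show "finite (?Y \<xi>) \<and> ?Y \<xi> \<noteq> {} \<and> \<xi> (SI i j) \<in> ?X \<xi>" using s by auto
  next
    fix \<xi> a assume b: "\<xi> \<in> BadS k i j" and "a \<in> ?Y \<xi>"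
    then obtain t where t: "a = {t}" "t \<in> alt \<xi> k i j" by auto
    obtain s where s: "\<xi> \<in> W" "k < length (xs \<xi>)" "tot \<xi> (Suc k) \<le> Wm" "\<xi> (SI i j) = {s}"
      "s \<notin> badset \<xi> k i j" "s \<in> badset \<xi> (Suc k) i j" using b by (auto simp: BadS_def)
    have inr: "inreg \<xi> (xs \<xi> ! k) i j" using badset_diff_inreg[OF s(2)] s(5,6) by blast
    let ?\<xi> = "\<xi>(SI i j := a)"
    have agree: "gfun True ?\<xi> y = gfun True \<xi> y" if y: "y \<in> pre \<xi> k" for y
    proof (rule SI_upd)
      assume "inreg \<xi> y i j"
      then have "y \<in> set (vis \<xi> k i j)" using y by (auto simp: vis_def pre_def)
      then show "(a \<subseteq> y) = (\<xi> (SI i j) \<subseteq> y)" using t by (auto simp: alt_def)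
    qed
    note p = prefix_same[OF s(2), of ?\<xi>, OF agree]
    have tk: "take k (xs ?\<xi>) = take k (xs \<xi>)"
      using arg_cong[OF p(2), of "take k"] by (simp add: min_def)
    have vis: "vis ?\<xi> k i' j' = vis \<xi> k i' j'" "vis ?\<xi> (Suc k) i' j' = vis \<xi> (Suc k) i' j'" for i' j'
      using p(2) by (simp_all add: vis_def tk)
    have tot: "tot ?\<xi> (Suc k) = tot \<xi> (Suc k)" by (simp add: tot_def touched_def vis)
    have bs: "badset ?\<xi> k i j = badset \<xi> k i j" "badset ?\<xi> (Suc k) i j = badset \<xi> (Suc k) i j"
      by (simp_all add: badset_def touched_def vis)
    have al: "alt ?\<xi> k i j = alt \<xi> k i j"
      unfolding alt_def bs vis using t by (auto simp: alt_def)
    have "t < 6 * m" using t by (simp add: alt_def)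
    then have W: "?\<xi> \<in> W" using W_upd[OF s(1), of "SI i j" a] t(1) ij by (auto simp: IJ_def)
    have "m \<le> card (alt \<xi> k i j)" by (rule card_alt[OF s(1-3) ij s(4,5)])
    then show "?\<xi> \<in> ?E \<and> ?X ?\<xi> = ?X \<xi> \<and> ?Y ?\<xi> = ?Y \<xi>"
      using W p s tot al inr bs by simp
  qed
  also have "\<dots> \<le> (\<Sum>\<xi>\<in>?E. (2 + 2 * real (card (touched \<xi> (Suc k) i j - touched \<xi> k i j))) / real m)"
  proof (rule sum_mono)
    fix \<xi> assume E: "\<xi> \<in> ?E"
    then have k: "k < length (xs \<xi>)" by simp
    have "real (card (?X \<xi>)) \<le> real (2 + 2 * card (touched \<xi> (Suc k) i j - touched \<xi> k i j))"
      unfolding cX using card_badset_diff[OF k] by (simp only: of_nat_le_iff)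
    then show "real (card (?X \<xi>)) / real (card (?Y \<xi>))
        \<le> (2 + 2 * real (card (touched \<xi> (Suc k) i j - touched \<xi> k i j))) / real m"
      unfolding cY using E m3 by (intro frac_le) auto
  qed
  also have "\<dots> \<le> (\<Sum>\<xi>\<in>?F. (2 + 2 * real (card (touched \<xi> (Suc k) i j - touched \<xi> k i j))) / real m)"
    by (rule sum_mono2) auto
  finally show ?thesis .
qed

lemma tot_Suc:
  assumes "k < length (xs \<xi>)"
  shows "tot \<xi> (Suc k) = tot \<xi> k + (\<Sum>(i, j)\<in>IJ. card (touched \<xi> (Suc k) i j - touched \<xi> k i j))"
proof -
  have "card (touched \<xi> (Suc k) i j) = card (touched \<xi> k i j) + card (touched \<xi> (Suc k) i j - touched \<xi> k i j)" for i j
    using touched_mono[OF assms, of i j] by (simp add: card_Diff_subset card_mono)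
  then show ?thesis by (simp add: tot_def case_prod_unfold sum.distrib)
qed

lemma tot_eq_sum:
  "k \<le> length (xs \<xi>) \<Longrightarrow> tot \<xi> k = (\<Sum>l<k. \<Sum>(i, j)\<in>IJ. card (touched \<xi> (Suc l) i j - touched \<xi> l i j))"
proof (induction k)
  case 0
  then show ?case by (simp add: tot_def touched_def vis_def)
next
  case (Suc k)
  then show ?case using tot_Suc[of k \<xi>] by simp
qed

text \<open>In each world the constants add up to \<open>2 * Q\<close>, because a query lies in at
  most one region, while the newly touched variables telescope to \<open>tot\<close>, which is at
  most \<open>Wm\<close> on the prefixes counted.\<close>

lemma sum_card_BadS:
  "(\<Sum>k<Q. \<Sum>(i, j)\<in>IJ. real (card (BadS k i j))) \<le> real (card W) * ((2 * real Q + 2 * real Wm) / real m)"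
proof -
  let ?n = "\<lambda>\<xi> k p. card (touched \<xi> (Suc k) (fst p) (snd p) - touched \<xi> k (fst p) (snd p))"
  let ?C = "\<lambda>\<xi> k p. k < length (xs \<xi>) \<and> tot \<xi> (Suc k) \<le> Wm \<and> inreg \<xi> (xs \<xi> ! k) (fst p) (snd p)"
  let ?g = "\<lambda>\<xi> k p. if ?C \<xi> k p then (2 + 2 * real (?n \<xi> k p)) / real m else 0"
  have "(\<Sum>k<Q. \<Sum>(i, j)\<in>IJ. real (card (BadS k i j))) \<le> (\<Sum>k<Q. \<Sum>p\<in>IJ. \<Sum>\<xi>\<in>W. ?g \<xi> k p)"
  proof (intro sum_mono)
    fix k p assume p: "p \<in> IJ"
    obtain i j where ij: "p = (i, j)" by (cases p)
    show "(case p of (i, j) \<Rightarrow> real (card (BadS k i j))) \<le> (\<Sum>\<xi>\<in>W. ?g \<xi> k p)"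
      using card_BadS[of i j k] p unfolding ij by (simp add: sum.If_cases Int_def)
  qed
  also have "\<dots> = (\<Sum>\<xi>\<in>W. \<Sum>k<Q. \<Sum>p\<in>IJ. ?g \<xi> k p)"
    by (subst sum.swap) (subst sum.swap, rule refl)
  also have "\<dots> \<le> (\<Sum>\<xi>\<in>W. (2 * real Q + 2 * real Wm) / real m)"
  proof (rule sum_mono)
    fix \<xi> assume \<xi>: "\<xi> \<in> W"
    let ?f = "\<lambda>k. \<Sum>p\<in>IJ. ?n \<xi> k p"
    let ?K = "{k. k < length (xs \<xi>) \<and> tot \<xi> (Suc k) \<le> Wm}"
    have inner: "(\<Sum>p\<in>IJ. ?g \<xi> k p) \<le> (if k \<in> ?K then (2 + 2 * real (?f k)) / real m else 0)" for k
    proof (cases "k \<in> ?K")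
      case True
      have "(\<Sum>p\<in>IJ. if inreg \<xi> (xs \<xi> ! k) (fst p) (snd p) then 1 else 0) \<le> (1::real)"
      proof -
        have "card {p \<in> IJ. inreg \<xi> (xs \<xi> ! k) (fst p) (snd p)} \<le> 1"
          by (rule card_le_Suc0_iff_eq[THEN iffD2, folded One_nat_def]) (auto dest: inreg_unique)
        then show ?thesis by (simp add: sum.If_cases Int_def)
      qed
      moreover have "(\<Sum>p\<in>IJ. ?g \<xi> k p) \<le> (\<Sum>p\<in>IJ. (2 * (if inreg \<xi> (xs \<xi> ! k) (fst p) (snd p) then 1 else 0)
          + 2 * real (?n \<xi> k p)) / real m)"
        by (rule sum_mono) (auto simp: divide_right_mono)
      moreover have "\<dots> = (2 * (\<Sum>p\<in>IJ. if inreg \<xi> (xs \<xi> ! k) (fst p) (snd p) then 1 else 0) + 2 * real (?f k)) / real m"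
        by (simp add: sum_divide_distrib[symmetric] sum.distrib sum_distrib_left)
      ultimately have "(\<Sum>p\<in>IJ. ?g \<xi> k p) \<le> (2 * 1 + 2 * real (?f k)) / real m"
        by (smt (verit) divide_right_mono of_nat_0_le_iff)
      then show ?thesis using True by simp
    qed auto
    have "(\<Sum>k<Q. \<Sum>p\<in>IJ. ?g \<xi> k p) \<le> (\<Sum>k<Q. if k \<in> ?K then (2 + 2 * real (?f k)) / real m else 0)"
      by (rule sum_mono) (rule inner)
    also have "\<dots> = (\<Sum>k\<in>?K. (2 + 2 * real (?f k)) / real m)"
    proof -
      have K: "{..<Q} \<inter> ?K = ?K" using length_xs[OF \<xi>] by auto
      show ?thesis by (simp only: sum.inter_restrict[OF finite_lessThan, symmetric] K)
    qed
    also have "\<dots> = (2 * real (card ?K) + 2 * real (\<Sum>k\<in>?K. ?f k)) / real m"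
      by (simp add: sum_divide_distrib[symmetric] sum.distrib sum_distrib_left)
    also have "\<dots> \<le> (2 * real Q + 2 * real Wm) / real m"
    proof (rule divide_right_mono)
      have "card ?K \<le> card {..<Q}" by (rule card_mono) (use length_xs[OF \<xi>] in auto)
      moreover have "?K = {k. k < length (xs \<xi>) \<and> (\<Sum>l<Suc k. ?f l) \<le> Wm}"
        using tot_eq_sum[of "Suc _" \<xi>] by (auto simp: case_prod_unfold simp del: sum.lessThan_Suc)
      then have "(\<Sum>k\<in>?K. ?f k) \<le> Wm" using sum_initial_segment_le[of ?f "length (xs \<xi>)" Wm] by simp
      ultimately have "2 * card ?K + 2 * (\<Sum>k\<in>?K. ?f k) \<le> 2 * Q + 2 * Wm" by simp
      then show "2 * real (card ?K) + 2 * real (\<Sum>k\<in>?K. ?f k) \<le> 2 * real Q + 2 * real Wm"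
        using of_nat_mono[where 'a = real] by fastforce
    qed simp
    finally show "(\<Sum>k<Q. \<Sum>p\<in>IJ. ?g \<xi> k p) \<le> (2 * real Q + 2 * real Wm) / real m" .
  qed
  finally show ?thesis by simp
qed

end

context hard_family
begin

lemma gfun_same:
  assumes TT: "TT \<xi>' x = TT \<xi> x" and CC: "\<And>k. CC \<xi>' k x = CC \<xi> k x"
    and n: "\<And>i j. \<not> inreg \<xi> x i j"
  shows "gfun up \<xi>' x = gfun up \<xi> x"
proof (cases "lev x \<and> card (TT \<xi> x) = 1")
  case T: True
  then obtain k where k: "TT \<xi> x = {k}" by (auto simp: card_1_singleton_iff)
  have "card (CC \<xi> k x) \<noteq> 1"
  proof
    assume "card (CC \<xi> k x) = 1"
    then obtain l where "CC \<xi> k x = {l}" by (auto simp: card_1_singleton_iff)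
    then show False using n T k by (auto simp: inreg_def)
  qed
  then show ?thesis using k T by (simp add: gfun_def TT CC)
qed (auto simp: gfun_def TT CC)

end

section \<open>Recoding of steady worlds\<close>

context coupling
begin

text \<open>
  On steady worlds, flipping the secret of every visited region turns a run on the monotone function into
  the identical run on the far function.
\<close>

definition steady :: "world set" where
  "steady = {\<xi> \<in> W. \<forall>(i, j)\<in>IJ. \<forall>s. \<xi> (SI i j) = {s} \<longrightarrow> s \<notin> badset \<xi> (length (xs \<xi>)) i j}"

definition recode :: "world \<Rightarrow> world" where
  "recode \<xi> v = (case v of SI i j \<Rightarrow>
      (if vis \<xi> (length (xs \<xi>)) i j = [] then \<xi> v else flip (hd (vis \<xi> (length (xs \<xi>)) i j)) ` \<xi> v)
    | _ \<Rightarrow> \<xi> v)"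

lemma tot_le_Wm: "\<xi> \<in> W \<Longrightarrow> \<xi> \<notin> Bad \<Longrightarrow> k \<le> length (xs \<xi>) \<Longrightarrow> tot \<xi> k \<le> Wm"
  using tot_le[of \<xi> k] Wm(1) by linarith

lemma steadyI:
  assumes \<xi>: "\<xi> \<in> W" "\<xi> \<notin> Bad" and S: "\<And>k i j. k < Q \<Longrightarrow> (i, j) \<in> IJ \<Longrightarrow> \<xi> \<notin> BadS k i j"
  shows "\<xi> \<in> steady"
proof -
  have "s \<notin> badset \<xi> k i j" if "k \<le> length (xs \<xi>)" and ij: "(i, j) \<in> IJ" and s: "\<xi> (SI i j) = {s}" for k i j s
    using that(1)
  proof (induction k)
    case 0
    then show ?case by (simp add: badset_def vis_def)
  next
    case (Suc k)
    have k: "k < length (xs \<xi>)" "k < Q" using Suc.prems length_xs[OF \<xi>(1)] by auto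
    then show ?case using S[OF k(2) ij] s \<xi> tot_le_Wm[OF \<xi>, of "Suc k"] Suc by (auto simp: BadS_def)
  qed
  then show ?thesis using \<xi>(1) by (auto simp: steady_def)
qed

lemma card_unsteady:
  "real (card (W - steady)) \<le> real (card W) * (4 * real Q ^ 2 / 2 ^ LL + (2 * real Q + 2 * real Wm) / real m)"
proof -
  let ?U = "\<Union>k<Q. \<Union>p\<in>IJ. BadS k (fst p) (snd p)"
  have finS: "finite (BadS k i j)" for k i j by (simp add: BadS_def)
  have finB: "finite Bad" by (auto simp: Bad_def BadT_def BadC_def)
  have "W - steady \<subseteq> Bad \<union> ?U" using steadyI by fastforce
  then have "card (W - steady) \<le> card (Bad \<union> ?U)" by (rule card_mono[rotated]) (use finB finS in auto)
  also have "\<dots> \<le> card Bad + card ?U" by (rule card_Un_le)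
  also have "card ?U \<le> (\<Sum>k<Q. card (\<Union>p\<in>IJ. BadS k (fst p) (snd p)))" by (rule card_UN_le) simp
  also have "\<dots> \<le> (\<Sum>k<Q. \<Sum>p\<in>IJ. card (BadS k (fst p) (snd p)))"
    by (rule sum_mono) (rule card_UN_le, simp)
  finally have "real (card (W - steady)) \<le> real (card Bad + (\<Sum>k<Q. \<Sum>p\<in>IJ. card (BadS k (fst p) (snd p))))"
    by (simp only: of_nat_le_iff)
  moreover have "real (\<Sum>k<Q. \<Sum>p\<in>IJ. card (BadS k (fst p) (snd p))) \<le> real (card W) * ((2 * real Q + 2 * real Wm) / real m)"
    using sum_card_BadS by (simp add: case_prod_unfold)
  moreover have "real (card Bad) \<le> real (card W) * (4 * real Q ^ 2 / 2 ^ LL)"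
  proof -
    have "real (card Bad * 2 ^ LL) \<le> real (4 * Q ^ 2 * card W)" using card_Bad by (simp only: of_nat_le_iff)
    then have "real (card Bad) * 2 ^ LL \<le> real (card W) * (4 * real Q ^ 2)" by (simp add: mult.commute)
    then show ?thesis by (simp add: pos_le_divide_eq)
  qed
  ultimately show ?thesis by (simp add: distrib_left)
qed

lemma recode_same [simp]: "TT (recode \<xi>) x = TT \<xi> x" "CC (recode \<xi>) k x = CC \<xi> k x"
  "inreg (recode \<xi>) x i j = inreg \<xi> x i j"
  by (auto simp: TT_def CC_def inreg_def recode_def)

text \<open>Neither the secret nor its flip is touched, so both keep at all visited points the
  membership they have at the head, where they are opposite. The flip negates the test and cancels
  the negation in \<open>gfun False\<close>.\<close>

lemma recode_agree:
  assumes \<xi>: "\<xi> \<in> steady"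
  shows "queries (gfun False (recode \<xi>)) d = xs \<xi> \<and> verdict (gfun False (recode \<xi>)) d = verdict (gfun True \<xi>) d"
  unfolding xs_def
proof (rule verdict_agree, rule subsetI, rule CollectI)
  fix x assume x: "x \<in> set (queries (gfun True \<xi>) d)"
  have W: "\<xi> \<in> W" using \<xi> by (simp add: steady_def)
  show "gfun True \<xi> x = gfun False (recode \<xi>) x"
  proof (cases "\<exists>i j. inreg \<xi> x i j")
    case False
    then have "gfun True \<xi> x = gfun False \<xi> x" by (intro gfun_not_inreg) auto
    also have "\<dots> = gfun False (recode \<xi>) x" using False by (intro gfun_same[symmetric]) auto
    finally show ?thesis .
  next
    case True
    then obtain i j where ij: "inreg \<xi> x i j" by blast
    then have IJ: "(i, j) \<in> IJ" using inreg_bounds by (auto simp: IJ_def)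
    then obtain s where s: "\<xi> (SI i j) = {s}" "s < 6 * m" using secret[OF W] by blast
    let ?v = "vis \<xi> (length (xs \<xi>)) i j"
    have xv: "x \<in> set ?v" using x ij by (auto simp: vis_def xs_def)
    then have ne: "?v \<noteq> []" by auto
    have sb: "s \<notin> badset \<xi> (length (xs \<xi>)) i j" using \<xi> IJ s by (auto simp: steady_def)
    have h: "(flip (hd ?v) s \<in> hd ?v) \<noteq> (s \<in> hd ?v)" "s \<notin> touched \<xi> (length (xs \<xi>)) i j"
      "flip (hd ?v) s \<notin> touched \<xi> (length (xs \<xi>)) i j"
      using sb s(2) ne unfolding badset_def by simp_all
    have "(s \<in> x) = (s \<in> hd ?v)" using h(2) xv unfolding touched_def by blast
    moreover have "(flip (hd ?v) s \<in> x) = (flip (hd ?v) s \<in> hd ?v)" using h(3) xv unfolding touched_def by blast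
    ultimately have "(s \<in> x) \<noteq> (flip (hd ?v) s \<in> x)" using h(1) by blast
    moreover have "recode \<xi> (SI i j) = {flip (hd ?v) s}" using s ne by (simp add: recode_def)
    ultimately show ?thesis using ij s by (simp add: gfun_inreg)
  qed
qed

lemma recode_W: "\<xi> \<in> W \<Longrightarrow> recode \<xi> \<in> W"
proof -
  assume \<xi>: "\<xi> \<in> W"
  show ?thesis unfolding W_def
  proof (rule PiE_I)
    fix v assume v: "v \<in> Idx"
    show "recode \<xi> v \<in> Dom v"
    proof (cases v)
      case (SI i j)
      then have IJ: "(i, j) \<in> IJ" using v by (simp add: IJ_def)
      then obtain s where s: "\<xi> (SI i j) = {s}" "s < 6 * m" using secret[OF \<xi>] by blast
      let ?v = "vis \<xi> (length (xs \<xi>)) i j"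
      show ?thesis
      proof (cases "?v = []")
        case False
        then have "is_flip m (hd ?v) (flip (hd ?v))" using lev_hd_vis flip by blast
        then have "flip (hd ?v) s < 6 * m" using s(2) by (auto simp: is_flip_def)
        then show ?thesis using False s SI by (simp add: recode_def)
      qed (use SI W_mem[OF \<xi> v] in \<open>simp add: recode_def\<close>)
    qed (use W_mem[OF \<xi> v] in \<open>simp_all add: recode_def\<close>)
  next
    fix v assume v: "v \<notin> Idx"
    have "vis \<xi> (length (xs \<xi>)) i j = []" if "v = SI i j" for i j
    proof (rule ccontr)
      assume "vis \<xi> (length (xs \<xi>)) i j \<noteq> []"
      then have "inreg \<xi> (hd (vis \<xi> (length (xs \<xi>)) i j)) i j" using lev_hd_vis vis_visC by blast
      then show False using inreg_bounds v that by simp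
    qed
    then have "recode \<xi> v = \<xi> v" by (cases v) (auto simp: recode_def)
    then show "recode \<xi> v = undefined" using \<xi> v by (auto simp: W_def PiE_def extensional_def)
  qed
qed

text \<open>The recoded world determines the run by \<open>recode_agree\<close>, hence the heads of
  all regions and the flips used; these are injective.\<close>

lemma inj_recode: "inj_on recode steady"
proof (rule inj_onI, rule ext)
  fix \<xi> \<zeta> v
  assume a: "\<xi> \<in> steady" "\<zeta> \<in> steady" "recode \<xi> = recode \<zeta>"
  have W: "\<xi> \<in> W" "\<zeta> \<in> W" using a by (auto simp: steady_def)
  have xs: "xs \<xi> = xs \<zeta>" using recode_agree[OF a(1)] recode_agree[OF a(2)] a(3) by simp
  have inr: "inreg \<xi> x i j = inreg \<zeta> x i j" for x i j using recode_same(3) a(3) by metis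
  have vis: "vis \<xi> (length (xs \<xi>)) i j = vis \<zeta> (length (xs \<zeta>)) i j" for i j by (simp add: vis_def xs inr)
  have r: "recode \<xi> v = recode \<zeta> v" using a(3) by simp
  show "\<xi> v = \<zeta> v"
  proof (cases v)
    case (SI i j)
    let ?v = "vis \<zeta> (length (xs \<zeta>)) i j"
    show ?thesis
    proof (cases "?v = []")
      case True
      then show ?thesis using r SI vis by (simp add: recode_def)
    next
      case False
      then have hd: "lev (hd ?v)" "inreg \<zeta> (hd ?v) i j" using lev_hd_vis vis_visC by blast+
      then have IJ: "(i, j) \<in> IJ" using inreg_bounds by (auto simp: IJ_def)
      obtain s where s: "\<xi> (SI i j) = {s}" "s < 6 * m" using secret[OF W(1) IJ] by blast
      obtain t where t: "\<zeta> (SI i j) = {t}" "t < 6 * m" using secret[OF W(2) IJ] by blast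
      have "flip (hd ?v) s = flip (hd ?v) t" using r SI vis False s t by (simp add: recode_def)
      moreover have "inj_on (flip (hd ?v)) {..<6 * m}" using flip[OF hd(1)] by (simp add: is_flip_def)
      ultimately have "s = t" using s(2) t(2) by (simp add: inj_on_eq_iff)
      then show ?thesis using s t SI by simp
    qed
  qed (use r in \<open>simp_all add: recode_def\<close>)
qed

lemma coupling_bound:
  "real (card {\<xi> \<in> W. verdict (gfun True \<xi>) d}) \<le> real (card {\<xi> \<in> W. verdict (gfun False \<xi>) d})
    + real (card W) * (4 * real Q ^ 2 / 2 ^ LL + (2 * real Q + 2 * real Wm) / real m)"
proof -
  let ?A = "{\<xi> \<in> steady. verdict (gfun True \<xi>) d}"
  have fs: "finite steady" by (rule finite_subset[OF _ finite_W]) (auto simp: steady_def)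
  have "card ?A = card (recode ` ?A)"
    by (rule card_image[symmetric]) (rule inj_on_subset[OF inj_recode], auto)
  also have "\<dots> \<le> card {\<xi> \<in> W. verdict (gfun False \<xi>) d}"
    by (rule card_mono) (use recode_agree recode_W in \<open>auto simp: steady_def\<close>)
  finally have A: "card ?A \<le> card {\<xi> \<in> W. verdict (gfun False \<xi>) d}" .
  have "card {\<xi> \<in> W. verdict (gfun True \<xi>) d} \<le> card (?A \<union> (W - steady))"
    by (rule card_mono) (use fs in auto)
  also have "\<dots> \<le> card ?A + card (W - steady)" by (rule card_Un_le)
  finally have "card {\<xi> \<in> W. verdict (gfun True \<xi>) d} \<le> card {\<xi> \<in> W. verdict (gfun False \<xi>) d} + card (W - steady)"
    using A by simp
  then have "real (card {\<xi> \<in> W. verdict (gfun True \<xi>) d}) \<le> real (card {\<xi> \<in> W. verdict (gfun False \<xi>) d}) + real (card (W - steady))"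
    by linarith
  then show ?thesis using card_unsteady by linarith
qed

end

section \<open>Density of violating edges and of far worlds\<close>

context hard_family
begin

definition layer :: "nat set set" where
  "layer = {x. x \<subseteq> {..<4 * m} \<and> card x = 3 * m}"

text \<open>An edge inside a region along which \<open>gfun False\<close> falls from 1 to 0. The
  region, and with it \<open>s\<close>, is determined by either end of the edge.\<close>

definition violation :: "world \<Rightarrow> nat set \<Rightarrow> nat \<Rightarrow> bool" where
  "violation \<xi> x s \<longleftrightarrow> x \<in> layer \<and> s < 4 * m \<and> s \<notin> x \<and>
     (\<exists>i j. inreg \<xi> x i j \<and> inreg \<xi> (insert s x) i j \<and> \<xi> (SI i j) = {s})"

lemma finite_layer [simp]: "finite layer"
  by (rule finite_subset[of _ "Pow {..<4 * m}"]) (auto simp: layer_def)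

lemma card_layer_pos: "0 < card layer"
  unfolding layer_def using n_subsets[of "{..<4 * m}" "3 * m"] by simp

text \<open>
  The density is $I J m / (6m \cdot 2^{4m+1}) = 1/192$ for $I = 2^{m-3}$ and $J = 2^{3m-1}$, and a union
  bound over a second term or clause costs at most a factor 4.
\<close>

lemma card_violation:
  assumes x: "x \<in> layer"
  shows "card W \<le> 768 * card {\<xi> \<in> W. \<exists>s. violation \<xi> x s}"
proof -
  let ?I = "{..<2 ^ (m - 3) :: nat}" and ?J = "{..<2 ^ (3 * m - 1) :: nat}"
  have xs: "x \<subseteq> {..<4 * m}" and cx: "card x = 3 * m" using x by (auto simp: layer_def)
  have fx: "finite x" using xs finite_subset by blast
  let ?Z = "{..<4 * m} - x"
  have cZ: "card ?Z = m" using fx xs cx by (simp add: card_Diff_subset)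
  define G where "G = (\<lambda>(i, j, s). {\<xi> \<in> W. inreg \<xi> x i j \<and> inreg \<xi> (insert s x) i j \<and> \<xi> (SI i j) = {s}})"
  have one: "real (card W) \<le> real (card (G (i, j, s))) * (4 * (6 * real m * 2 ^ (3 * m + 1) * 2 ^ m))"
    if i: "i \<in> ?I" and j: "j \<in> ?J" and s: "s \<in> ?Z" for i j s
  proof -
    let ?B1 = "{\<xi> \<in> PiE Idx Dom. True \<and> \<xi> (TI i) \<in> Pow x}"
    let ?B2 = "{\<xi> \<in> PiE Idx Dom. \<xi> (TI i) \<in> Pow x \<and> \<xi> (CI i j) \<in> Pow ({..<4 * m} - insert s x)}"
    let ?B = "{\<xi> \<in> PiE Idx Dom. (\<xi> (TI i) \<in> Pow x \<and> \<xi> (CI i j) \<in> Pow ({..<4 * m} - insert s x)) \<and> \<xi> (SI i j) \<in> {{s}}}"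
    let ?P = "\<lambda>\<xi>. (\<xi> (TI i) \<in> Pow x \<and> \<xi> (CI i j) \<in> Pow ({..<4 * m} - insert s x)) \<and> \<xi> (SI i j) \<in> {{s}}"
    \<comment> \<open>Worlds spoiled by another term or clause. The term is tested at the upper end
      of the edge and the clause at the lower end, which covers both ends.\<close>
    let ?A = "\<lambda>i'. {\<xi> \<in> PiE Idx Dom. ?P \<xi> \<and> \<xi> (TI i') \<in> Pow (insert s x)}"
    let ?C = "\<lambda>j'. {\<xi> \<in> PiE Idx Dom. ?P \<xi> \<and> \<xi> (CI i j') \<in> Pow ({..<4 * m} - x)}"
    have ci: "card (insert s x) = 3 * m + 1" using s fx cx by simp
    have si: "insert s x \<subseteq> {..<4 * m}" using s xs by auto
    have cpow: "card ({..<4 * m} - insert s x) = m - 1" using si ci fx by (simp add: card_Diff_subset)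
    have "4 * m = 3 * m + m" "4 * m = (3 * m + 1) + (m - 1)" using m3 by simp_all
    then have e: "(2::nat) ^ (4 * m) = 2 ^ (3 * m) * 2 ^ m" "(2::nat) ^ (4 * m) = 2 ^ (3 * m + 1) * 2 ^ (m - 1)"
      by (metis power_add)+
    have 1: "card ?B1 * 2 ^ m = card W"
    proof -
      have "card ?B1 * card (Dom (TI i)) = card {\<xi> \<in> PiE Idx Dom. True} * card (Pow x)"
        by (rule card_PiE_factor) (use i xs in auto)
      then have "card ?B1 * 2 ^ (4 * m) = card W * 2 ^ (3 * m)" using fx cx by (simp add: card_Pow W_def)
      then show ?thesis unfolding e(1) by simp
    qed
    have 2: "card ?B2 * 2 ^ (3 * m + 1) = card ?B1"
    proof -
      have "card ?B2 * card (Dom (CI i j)) = card {\<xi> \<in> PiE Idx Dom. \<xi> (TI i) \<in> Pow x} * card (Pow ({..<4 * m} - insert s x))"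
        by (rule card_PiE_factor) (use i j in auto)
      then have "card ?B2 * 2 ^ (4 * m) = card ?B1 * 2 ^ (m - 1)" using cpow by (simp add: card_Pow)
      then show ?thesis unfolding e(2) by simp
    qed
    have 3: "card ?B * (6 * m) = card ?B2"
    proof -
      have "card ?B * card (Dom (SI i j)) = card ?B2 * card {{s}}"
        by (rule card_PiE_factor) (use i j s in auto)
      moreover have "card (Dom (SI i j)) = 6 * m" by (simp add: card_image)
      ultimately show ?thesis by simp
    qed
    have 4: "card (?A i') * 2 ^ (m - 1) = card ?B" if "i' \<in> ?I - {i}" for i'
    proof -
      have "card (?A i') * card (Dom (TI i')) = card ?B * card (Pow (insert s x))"
        by (rule card_PiE_factor) (use that si in auto)
      then have "card (?A i') * 2 ^ (4 * m) = card ?B * 2 ^ (3 * m + 1)" using fx ci by (simp add: card_Pow del: card_insert_disjoint)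
      then show ?thesis unfolding e(2) by simp
    qed
    have 5: "card (?C j') * 2 ^ (3 * m) = card ?B" if "j' \<in> ?J - {j}" for j'
    proof -
      have "card (?C j') * card (Dom (CI i j')) = card ?B * card (Pow ({..<4 * m} - x))"
        by (rule card_PiE_factor) (use that i in auto)
      then have "card (?C j') * 2 ^ (4 * m) = card ?B * 2 ^ m" using cZ by (simp add: card_Pow)
      then show ?thesis unfolding e(1) by simp
    qed
    have finP: "finite (PiE Idx Dom)" using finite_W by (simp add: W_def)
    have sub: "?B \<subseteq> G (i, j, s) \<union> ((\<Union>i'\<in>?I - {i}. ?A i') \<union> (\<Union>j'\<in>?J - {j}. ?C j'))"
    proof
      fix \<xi> assume b: "\<xi> \<in> ?B"
      then have \<xi>W: "\<xi> \<in> W" by (simp add: W_def)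
      show "\<xi> \<in> G (i, j, s) \<union> ((\<Union>i'\<in>?I - {i}. ?A i') \<union> (\<Union>j'\<in>?J - {j}. ?C j'))"
      proof (cases "\<xi> \<in> (\<Union>i'\<in>?I - {i}. ?A i') \<union> (\<Union>j'\<in>?J - {j}. ?C j')")
        case False
        have nT: "\<not> \<xi> (TI i') \<subseteq> insert s x" if "i' \<in> ?I" "i' \<noteq> i" for i' using False b that by blast
        have nC: "\<xi> (CI i j') \<inter> x \<noteq> {}" if "j' \<in> ?J" "j' \<noteq> j" for j'
        proof
          assume "\<xi> (CI i j') \<inter> x = {}"
          moreover have "\<xi> (CI i j') \<in> Dom (CI i j')" by (rule W_mem[OF \<xi>W]) (use i that in simp)
          ultimately have "\<xi> (CI i j') \<in> Pow ({..<4 * m} - x)" by auto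
          then show False using False b that by blast
        qed
        have T: "\<xi> (TI i) \<subseteq> x" and C: "\<xi> (CI i j) \<inter> insert s x = {}" using b by auto
        have "TT \<xi> x = {i}" "TT \<xi> (insert s x) = {i}" using i T nT by (auto simp: TT_def)
        moreover have "CC \<xi> i x = {j}" "CC \<xi> i (insert s x) = {j}" using j C nC by (auto simp: CC_def)
        ultimately have "inreg \<xi> x i j" "inreg \<xi> (insert s x) i j" using xs cx si ci by (auto simp: inreg_def lev_def)
        then show ?thesis using \<xi>W b by (auto simp: G_def)
      qed blast
    qed
    have finG: "finite (G (i, j, s))" by (simp add: G_def)
    have "card ?B \<le> card (G (i, j, s) \<union> ((\<Union>i'\<in>?I - {i}. ?A i') \<union> (\<Union>j'\<in>?J - {j}. ?C j')))"
      by (rule card_mono[OF _ sub]) (use finG finP in auto)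
    also have "\<dots> \<le> card (G (i, j, s)) + (card (\<Union>i'\<in>?I - {i}. ?A i') + card (\<Union>j'\<in>?J - {j}. ?C j'))"
      by (meson add_left_mono card_Un_le order_trans)
    also have "card (\<Union>i'\<in>?I - {i}. ?A i') \<le> (\<Sum>i'\<in>?I - {i}. card (?A i'))" by (rule card_UN_le) simp
    also have "card (\<Union>j'\<in>?J - {j}. ?C j') \<le> (\<Sum>j'\<in>?J - {j}. card (?C j'))" by (rule card_UN_le) simp
    finally have "real (card ?B) \<le> real (card (G (i, j, s)) + ((\<Sum>i'\<in>?I - {i}. card (?A i')) + (\<Sum>j'\<in>?J - {j}. card (?C j'))))"
      by (simp only: of_nat_le_iff)
    \<comment> \<open>Fewer than \<open>2 ^ (m - 3)\<close> other terms, each with conditional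
      probability \<open>2 ^ -(m - 1)\<close>, cost at most 1/4. The other clauses cost at most
      \<open>2 ^ (3 * m - 1)\<close> times \<open>2 ^ -(3 * m)\<close>, that is 1/2, so a quarter
      survives.\<close>
    moreover have "real (\<Sum>i'\<in>?I - {i}. card (?A i')) \<le> real (card ?B) / 4"
    proof -
      have "(\<Sum>i'\<in>?I - {i}. card (?A i')) * 2 ^ (m - 1) = (\<Sum>i'\<in>?I - {i}. card ?B)"
        unfolding sum_distrib_right by (rule sum.cong[OF refl]) (rule 4)
      also have "\<dots> \<le> (\<Sum>i'\<in>?I. card ?B)" by (rule sum_mono2) auto
      also have "\<dots> = 2 ^ (m - 3) * card ?B" by simp
      finally have "(\<Sum>i'\<in>?I - {i}. card (?A i')) * 4 * 2 ^ (m - 3) \<le> card ?B * 2 ^ (m - 3)"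
      proof -
        have "m - 1 = 2 + (m - 3)" using m3 by simp
        then have "(2::nat) ^ (m - 1) = 4 * 2 ^ (m - 3)" by (simp add: power_add)
        then show "(\<Sum>i'\<in>?I - {i}. card (?A i')) * 2 ^ (m - 1) \<le> 2 ^ (m - 3) * card ?B \<Longrightarrow> ?thesis"
          by (simp add: mult.commute mult.left_commute)
      qed
      then have "(\<Sum>i'\<in>?I - {i}. card (?A i')) * 4 \<le> card ?B" by simp
      then have "real ((\<Sum>i'\<in>?I - {i}. card (?A i')) * 4) \<le> real (card ?B)" by (simp only: of_nat_le_iff)
      then show ?thesis by simp
    qed
    moreover have "real (\<Sum>j'\<in>?J - {j}. card (?C j')) \<le> real (card ?B) / 2"
    proof -
      have "(\<Sum>j'\<in>?J - {j}. card (?C j')) * 2 ^ (3 * m) = (\<Sum>j'\<in>?J - {j}. card ?B)"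
        unfolding sum_distrib_right by (rule sum.cong[OF refl]) (rule 5)
      also have "\<dots> \<le> (\<Sum>j'\<in>?J. card ?B)" by (rule sum_mono2) auto
      also have "\<dots> = 2 ^ (3 * m - 1) * card ?B" by simp
      finally have "(\<Sum>j'\<in>?J - {j}. card (?C j')) * 2 * 2 ^ (3 * m - 1) \<le> card ?B * 2 ^ (3 * m - 1)"
      proof -
        have "(2::nat) ^ (3 * m) = 2 * 2 ^ (3 * m - 1)" using m3 by (cases "3 * m") auto
        then show "(\<Sum>j'\<in>?J - {j}. card (?C j')) * 2 ^ (3 * m) \<le> 2 ^ (3 * m - 1) * card ?B \<Longrightarrow> ?thesis"
          by (simp add: mult.commute mult.left_commute)
      qed
      then have "(\<Sum>j'\<in>?J - {j}. card (?C j')) * 2 \<le> card ?B" by simp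
      then have "real ((\<Sum>j'\<in>?J - {j}. card (?C j')) * 2) \<le> real (card ?B)" by (simp only: of_nat_le_iff)
      then show ?thesis by simp
    qed
    ultimately have G: "real (card ?B) \<le> 4 * real (card (G (i, j, s)))" by simp
    have "card W = card ?B * (6 * m) * 2 ^ (3 * m + 1) * 2 ^ m" using 1 2 3 by metis
    then have "real (card W) = real (card ?B) * (6 * real m * 2 ^ (3 * m + 1) * 2 ^ m)" by simp
    also have "\<dots> \<le> 4 * real (card (G (i, j, s))) * (6 * real m * 2 ^ (3 * m + 1) * 2 ^ m)"
      by (rule mult_right_mono[OF G]) simp
    finally show ?thesis by (simp add: mult_ac)
  qed
  let ?T = "?I \<times> ?J \<times> ?Z"
  have "real (card ?T) * real (card W) = (\<Sum>p\<in>?T. real (card W))" by simp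
  also have "\<dots> \<le> (\<Sum>p\<in>?T. real (card (G p)) * (4 * (6 * real m * 2 ^ (3 * m + 1) * 2 ^ m)))"
    by (rule sum_mono) (use one in auto)
  also have "\<dots> = real (\<Sum>p\<in>?T. card (G p)) * (4 * (6 * real m * 2 ^ (3 * m + 1) * 2 ^ m))"
    by (simp add: sum_distrib_right)
  also have "(\<Sum>p\<in>?T. card (G p)) = card (\<Union>p\<in>?T. G p)"
  proof (rule card_UN_disjoint[symmetric])
    show "\<forall>p\<in>?T. finite (G p)" by (auto simp: G_def)
    show "\<forall>p\<in>?T. \<forall>q\<in>?T. p \<noteq> q \<longrightarrow> G p \<inter> G q = {}"
      by (auto simp: G_def dest: inreg_unique)
  qed simp
  finally have *: "real (card ?T) * real (card W) \<le>
      real (card (\<Union>p\<in>?T. G p)) * (4 * (6 * real m * 2 ^ (3 * m + 1) * 2 ^ m))" .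
  have "card (\<Union>p\<in>?T. G p) \<le> card {\<xi> \<in> W. \<exists>s. violation \<xi> x s}"
    by (rule card_mono) (use x in \<open>auto simp: G_def violation_def\<close>)
  then have "real (card (\<Union>p\<in>?T. G p)) * (4 * (6 * real m * 2 ^ (3 * m + 1) * 2 ^ m)) \<le>
      real (card {\<xi> \<in> W. \<exists>s. violation \<xi> x s}) * (4 * (6 * real m * 2 ^ (3 * m + 1) * 2 ^ m))"
    by (intro mult_right_mono) auto
  note * = order_trans[OF * this]
  have "real (card ?T) = 2 ^ (m - 3) * (2 ^ (3 * m - 1) * real m)" using cZ by (simp add: card_cartesian_product)
  moreover have "(2::real) ^ m = 8 * 2 ^ (m - 3)"
  proof -
    have "m = 3 + (m - 3)" using m3 by simp
    then have "(2::real) ^ m = 2 ^ (3 + (m - 3))" by simp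
    then show ?thesis by (simp only: power_add) simp
  qed
  moreover have "(2::real) ^ (3 * m + 1) = 4 * 2 ^ (3 * m - 1)"
  proof -
    have "3 * m + 1 = 2 + (3 * m - 1)" using m3 by simp
    then have "(2::real) ^ (3 * m + 1) = 2 ^ (2 + (3 * m - 1))" by simp
    then show ?thesis by (simp only: power_add) simp
  qed
  ultimately have "(2 ^ (m - 3) * (2 ^ (3 * m - 1) * real m)) * real (card W) \<le>
     (2 ^ (m - 3) * (2 ^ (3 * m - 1) * real m)) * (768 * real (card {\<xi> \<in> W. \<exists>s. violation \<xi> x s}))"
    using * by (simp add: mult_ac)
  then have "real (card W) \<le> 768 * real (card {\<xi> \<in> W. \<exists>s. violation \<xi> x s})"
    using m3 by (subst (asm) mult_le_cancel_left_pos) auto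
  then have "real (card W) \<le> real (768 * card {\<xi> \<in> W. \<exists>s. violation \<xi> x s})" by simp
  then show ?thesis by (simp only: of_nat_le_iff)
qed

definition far :: "world set" where
  "far = {\<xi> \<in> W. card layer \<le> 1536 * card {x \<in> layer. \<exists>s. violation \<xi> x s}}"

text \<open>Reverse Markov inequality: the average fraction of violating points is at least 1/768,
  and worlds outside \<open>far\<close> contribute at most 1/1536 to it.\<close>

lemma card_far: "card W \<le> 1536 * card far"
proof -
  let ?X = "\<lambda>\<xi>. card {x \<in> layer. \<exists>s. violation \<xi> x s}"
  have ff: "finite far" by (simp add: far_def)
  have X: "?X \<xi> \<le> card layer" for \<xi> by (rule card_mono) auto
  have "card layer * card W = (\<Sum>x\<in>layer. card W)" by simp
  also have "\<dots> \<le> (\<Sum>x\<in>layer. 768 * card {\<xi> \<in> W. \<exists>s. violation \<xi> x s})"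
    by (rule sum_mono) (rule card_violation)
  also have "\<dots> = 768 * (\<Sum>x\<in>layer. card {\<xi> \<in> W. \<exists>s. violation \<xi> x s})" by (simp add: sum_distrib_left)
  also have "(\<Sum>x\<in>layer. card {\<xi> \<in> W. \<exists>s. violation \<xi> x s}) = (\<Sum>\<xi>\<in>W. ?X \<xi>)"
  proof -
    have "(\<Sum>x\<in>layer. card {\<xi> \<in> W. \<exists>s. violation \<xi> x s}) = (\<Sum>x\<in>layer. \<Sum>\<xi>\<in>W. if \<exists>s. violation \<xi> x s then 1 else 0)"
      by (simp add: sum.If_cases Int_def)
    also have "\<dots> = (\<Sum>\<xi>\<in>W. \<Sum>x\<in>layer. if \<exists>s. violation \<xi> x s then 1 else 0)" by (rule sum.swap)
    finally show ?thesis by (simp add: sum.If_cases Int_def)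
  qed
  also have "(\<Sum>\<xi>\<in>W. ?X \<xi>) = (\<Sum>\<xi>\<in>far. ?X \<xi>) + (\<Sum>\<xi>\<in>W - far. ?X \<xi>)"
    by (subst sum.subset_diff[of far W]) (auto simp: far_def)
  finally have "card layer * card W \<le> 768 * ((\<Sum>\<xi>\<in>far. ?X \<xi>) + (\<Sum>\<xi>\<in>W - far. ?X \<xi>))" .
  moreover have "(\<Sum>\<xi>\<in>far. ?X \<xi>) \<le> card layer * card far"
    using sum_bounded_above[of far ?X "card layer"] X by (simp add: mult.commute)
  moreover have "1536 * (\<Sum>\<xi>\<in>W - far. ?X \<xi>) \<le> card layer * card W"
  proof -
    have "1536 * (\<Sum>\<xi>\<in>W - far. ?X \<xi>) \<le> (\<Sum>\<xi>\<in>W - far. card layer)"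
      unfolding sum_distrib_left by (rule sum_mono) (auto simp: far_def)
    also have "\<dots> \<le> card layer * card W" using card_mono[of W "W - far"] by (simp add: mult.commute)
    finally show ?thesis .
  qed
  moreover have "lw \<le> 1536 * lf" if "lw \<le> 768 * (a + b)" "a \<le> lf" "1536 * b \<le> lw" for a b lf lw :: nat
  proof -
    have "2 * lw \<le> 1536 * a + 1536 * b" using that(1) by simp
    moreover have "1536 * a \<le> 1536 * lf" using that(2) by simp
    ultimately show ?thesis using that(3) by linarith
  qed
  ultimately have "card layer * card W \<le> 1536 * (card layer * card far)" by blast
  then have "card layer * card W \<le> card layer * (1536 * card far)" by (simp add: mult.left_commute)
  then show ?thesis using card_layer_pos by (simp only: mult_le_cancel1)
qed

end

section \<open>Embedding into the cube\<close>

context hard_family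
begin

definition heavy :: "nat set set" where
  "heavy = {x. x \<subseteq> {..<4 * m} \<and> 3 * m \<le> card x}"

lemma finite_heavy [simp]: "finite heavy"
  by (rule finite_subset[of _ "Pow {..<4 * m}"]) (auto simp: heavy_def)

lemma card_layer: "card layer = 4 * m choose (3 * m)"
  unfolding layer_def using n_subsets[of "{..<4 * m}" "3 * m"] by simp

lemma binomial_decay:
  assumes "3 * m \<le> l"
  shows "2 * (4 * m choose Suc l) \<le> 4 * m choose l"
proof -
  have "Suc l * (4 * m choose Suc l) = (4 * m - l) * (4 * m choose l)"
    using binomial_absorption[of l "4 * m"] binomial_absorb_comp[of "4 * m" l] by simp
  also have "\<dots> * 2 \<le> Suc l * (4 * m choose l)"
  proof -
    have "(4 * m - l) * 2 \<le> Suc l" using assms by simp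
    then have "(4 * m - l) * 2 * (4 * m choose l) \<le> Suc l * (4 * m choose l)" by (rule mult_le_mono1)
    then show ?thesis by (simp add: mult_ac)
  qed
  finally have "Suc l * (2 * (4 * m choose Suc l)) \<le> Suc l * (4 * m choose l)"
    by (metis mult.assoc mult.commute)
  then show ?thesis by (simp only: mult_le_cancel1)
qed

text \<open>Geometric series, by induction downwards from the empty level \<open>4 * m + 1\<close>.
  It converts counts on the layer into relative distances.\<close>

lemma card_heavy: "card heavy \<le> 2 * card layer"
proof -
  have "card {x. x \<subseteq> {..<4 * m} \<and> l \<le> card x} \<le> 2 * (4 * m choose l)" if "3 * m \<le> l" "l \<le> 4 * m + 1" for l
    using that(2,1)
  proof (induction l rule: inc_induct)
    case base
    have c: "card x \<le> 4 * m" if "x \<subseteq> {..<4 * m}" for x using card_mono[OF _ that] by simp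
    have "\<not> (x \<subseteq> {..<4 * m} \<and> 4 * m + 1 \<le> card x)" for x using c[of x] by linarith
    then have e: "{x. x \<subseteq> {..<4 * m} \<and> 4 * m + 1 \<le> card x} = {}" by blast
    show ?case unfolding e by simp
  next
    case (step l)
    have eq: "{x. x \<subseteq> {..<4 * m} \<and> l \<le> card x} =
        {x. x \<subseteq> {..<4 * m} \<and> card x = l} \<union> {x. x \<subseteq> {..<4 * m} \<and> Suc l \<le> card x}" by auto
    have "card {x. x \<subseteq> {..<4 * m} \<and> l \<le> card x} \<le>
        card {x. x \<subseteq> {..<4 * m} \<and> card x = l} + card {x. x \<subseteq> {..<4 * m} \<and> Suc l \<le> card x}"
      by (subst eq) (rule card_Un_le)
    also have "card {x. x \<subseteq> {..<4 * m} \<and> card x = l} = 4 * m choose l" using n_subsets[of "{..<4 * m}" l] by simp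
    finally show ?case using step.IH step.prems binomial_decay[OF step.prems] by simp
  qed
  from this[of "3 * m"] show ?thesis by (simp add: heavy_def card_layer)
qed

text \<open>The true fraction is 3/4; the constant 1536 matches the density in \<open>far\<close>,
  so that both cases of \<open>far_distance\<close> end in the same bound.\<close>

lemma card_layer_mem:
  assumes k: "k < 4 * m"
  shows "card layer \<le> 1536 * card {y \<in> layer. k \<in> y}"
proof -
  let ?S = "{y. y \<subseteq> {..<4 * m} - {k} \<and> card y = 3 * m - 1}"
  have "bij_betw (insert k) ?S {y \<in> layer. k \<in> y}"
  proof (rule bij_betwI[where g = "\<lambda>y. y - {k}"])
    show "insert k \<in> ?S \<rightarrow> {y \<in> layer. k \<in> y}"
    proof (rule Pi_I)
      fix y assume y: "y \<in> ?S"
      then have "finite y" "k \<notin> y" using finite_subset[of y "{..<4 * m}"] by auto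
      then have "card (insert k y) = 3 * m" using y m3 by simp
      then show "insert k y \<in> {y \<in> layer. k \<in> y}" using y k by (auto simp: layer_def)
    qed
    show "(\<lambda>y. y - {k}) \<in> {y \<in> layer. k \<in> y} \<rightarrow> ?S"
    proof (rule Pi_I)
      fix y assume y: "y \<in> {y \<in> layer. k \<in> y}"
      then have "card (y - {k}) = 3 * m - 1" by (simp add: layer_def)
      then show "y - {k} \<in> ?S" using y by (auto simp: layer_def)
    qed
  qed auto
  from bij_betw_same_card[OF this] have "card {y \<in> layer. k \<in> y} = card ?S" by (rule sym)
  also have "\<dots> = (4 * m - 1) choose (3 * m - 1)" using n_subsets[of "{..<4 * m} - {k}" "3 * m - 1"] k by simp
  finally have c: "card {y \<in> layer. k \<in> y} = (4 * m - 1) choose (3 * m - 1)" .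
  have "Suc (4 * m - 1) * ((4 * m - 1) choose (3 * m - 1)) = (Suc (4 * m - 1) choose Suc (3 * m - 1)) * Suc (3 * m - 1)"
    by (rule Suc_times_binomial_eq)
  then have "4 * m * card {y \<in> layer. k \<in> y} = card layer * (3 * m)"
    using m3 c card_layer by simp
  then have "m * (4 * card {y \<in> layer. k \<in> y}) = m * (3 * card layer)" by (simp add: mult_ac)
  then have "4 * card {y \<in> layer. k \<in> y} = 3 * card layer" using m3 by (simp only: mult_cancel1) simp
  then show ?thesis by linarith
qed

end

text \<open>
  Coordinate $4m$ is a switch: when it is on, the function is the threshold of the first $4m$ variables.
  This provides, in every direction $k < 4m$, many increasing edges independent of the world, so a unate
  function that is nonincreasing in direction $k$ is far as well; it also makes at least half of \<open>Z\<close>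
  accepting. The next \<open>e\<close> coordinates are irrelevant and the remaining ones must be 1.
\<close>

locale lifted = hard_family +
  fixes n e :: nat
  assumes n: "4 * m + 1 + e \<le> n"
begin

definition V :: "bool list \<Rightarrow> nat set" where
  "V x = {k. k < 4 * m \<and> x ! k}"

definition frame :: "bool list set" where
  "frame = {x. length x = n \<and> (\<forall>k. 4 * m + e < k \<and> k < n \<longrightarrow> x ! k)}"

definition F :: "(nat set \<Rightarrow> bool) \<Rightarrow> bool list \<Rightarrow> bool" where
  "F g x \<longleftrightarrow> x \<in> frame \<and> (if x ! (4 * m) then 3 * m \<le> card (V x) else g (V x))"

text \<open>The proposal set for rejection sampling: independent of the world, and containing every
  point that any of the hard functions accepts.\<close>

definition Z :: "bool list set" where
  "Z = {x \<in> frame. V x \<in> heavy}"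

lemma V_subset: "V x \<subseteq> {..<4 * m}"
  by (auto simp: V_def)

lemma finite_V [simp]: "finite (V x)"
  using V_subset finite_subset by blast

lemma finite_frame [simp]: "finite frame"
  by (rule finite_subset[OF _ finite_cube[of n]]) (auto simp: frame_def cube_def)

lemma card_frame:
  assumes A: "A \<subseteq> Pow {..<4 * m}"
  shows "card {x \<in> frame. x ! (4 * m) = b \<and> V x \<in> A} = card A * 2 ^ e"
proof -
  define mk where "mk p = map (\<lambda>k. if k < 4 * m then k \<in> fst p else if k = 4 * m then b
      else if k \<le> 4 * m + e then k \<in> snd p else True) [0..<n]" for p :: "nat set \<times> nat set"
  let ?C = "Pow {4 * m<..4 * m + e}"
  have nth: "mk p ! k = (if k < 4 * m then k \<in> fst p else if k = 4 * m then b
      else if k \<le> 4 * m + e then k \<in> snd p else True)" if "k < n" for p k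
    using that by (simp add: mk_def)
  have "bij_betw mk (A \<times> ?C) {x \<in> frame. x ! (4 * m) = b \<and> V x \<in> A}"
  proof (rule bij_betwI[where g = "\<lambda>x. (V x, {k \<in> {4 * m<..4 * m + e}. x ! k})"])
    have Vm: "V (mk p) = fst p" if "p \<in> A \<times> ?C" for p
    proof -
      have "fst p \<in> A" using that by (simp add: mem_Times_iff)
      then have "fst p \<subseteq> {..<4 * m}" using A by blast
      moreover have "k < n" if "k < 4 * m" for k using n that by simp
      ultimately show ?thesis by (auto simp: V_def nth)
    qed
    show "mk \<in> A \<times> ?C \<rightarrow> {x \<in> frame. x ! (4 * m) = b \<and> V x \<in> A}"
    proof (rule Pi_I)
      fix p assume p: "p \<in> A \<times> ?C"
      have "mk p \<in> frame" by (simp add: frame_def nth) (simp add: mk_def)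
      moreover have "mk p ! (4 * m) = b" using n by (simp add: nth)
      moreover have "fst p \<in> A" using p by (simp add: mem_Times_iff)
      ultimately show "mk p \<in> {x \<in> frame. x ! (4 * m) = b \<and> V x \<in> A}" using Vm[OF p] by simp
    qed
    show "(V (mk p), {k \<in> {4 * m<..4 * m + e}. mk p ! k}) = p" if p: "p \<in> A \<times> ?C" for p
    proof -
      have "snd p \<subseteq> {4 * m<..4 * m + e}" using p by (simp add: mem_Times_iff)
      then have "{k \<in> {4 * m<..4 * m + e}. mk p ! k} = snd p" using n by (auto simp: nth)
      then show ?thesis using Vm[OF p] by (simp add: prod_eq_iff)
    qed
    show "mk (V x, {k \<in> {4 * m<..4 * m + e}. x ! k}) = x"
      if x: "x \<in> {x \<in> frame. x ! (4 * m) = b \<and> V x \<in> A}" for x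
    proof (rule nth_equalityI)
      show "length (mk (V x, {k \<in> {4 * m<..4 * m + e}. x ! k})) = length x"
        using x by (simp add: mk_def frame_def)
      fix k assume "k < length (mk (V x, {k \<in> {4 * m<..4 * m + e}. x ! k}))"
      then have "k < n" by (simp add: mk_def)
      then show "mk (V x, {k \<in> {4 * m<..4 * m + e}. x ! k}) ! k = x ! k"
        using x by (auto simp: nth V_def frame_def)
    qed
  qed auto
  from bij_betw_same_card[OF this] show ?thesis by (simp add: card_cartesian_product card_Pow)
qed

lemma heavy_Pow: "heavy \<subseteq> Pow {..<4 * m}"
  by (auto simp: heavy_def)

lemma card_Z: "card Z = 2 * card heavy * 2 ^ e"
proof -
  have "Z = {x \<in> frame. x ! (4 * m) = True \<and> V x \<in> heavy} \<union> {x \<in> frame. x ! (4 * m) = False \<and> V x \<in> heavy}"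
    by (auto simp: Z_def)
  moreover have "{x \<in> frame. x ! (4 * m) = True \<and> V x \<in> heavy} \<inter> {x \<in> frame. x ! (4 * m) = False \<and> V x \<in> heavy} = {}"
    by auto
  ultimately have "card Z = card {x \<in> frame. x ! (4 * m) = True \<and> V x \<in> heavy} + card {x \<in> frame. x ! (4 * m) = False \<and> V x \<in> heavy}"
    by (simp add: card_Un_disjoint)
  then show ?thesis unfolding card_frame[OF heavy_Pow] by simp
qed

lemma finite_Z [simp]: "finite Z"
  by (simp add: Z_def)

lemma ones_subset:
  assumes "\<And>x. card x < 3 * m \<Longrightarrow> \<not> g x"
  shows "ones (F g) \<subseteq> Z"
proof
  fix x assume x: "x \<in> ones (F g)"
  have "3 * m \<le> card (V x)" using x assms[of "V x"] by (auto simp: ones_def F_def split: if_splits) (meson not_le)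
  then show "x \<in> Z" using x V_subset by (auto simp: ones_def F_def Z_def heavy_def)
qed

lemma card_ones:
  assumes g: "\<And>x. card x < 3 * m \<Longrightarrow> \<not> g x"
  shows "card heavy * 2 ^ e \<le> card (ones (F g))" "card (ones (F g)) \<le> 2 * card heavy * 2 ^ e"
proof -
  have fin: "finite (ones (F g))" using finite_subset[OF ones_subset[OF g] finite_Z] .
  have "{x \<in> frame. x ! (4 * m) = True \<and> V x \<in> heavy} \<subseteq> ones (F g)"
    by (auto simp: ones_def F_def heavy_def)
  then have "card {x \<in> frame. x ! (4 * m) = True \<and> V x \<in> heavy} \<le> card (ones (F g))" by (rule card_mono[OF fin])
  then show "card heavy * 2 ^ e \<le> card (ones (F g))" unfolding card_frame[OF heavy_Pow] .
  show "card (ones (F g)) \<le> 2 * card heavy * 2 ^ e"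
    unfolding card_Z[symmetric] by (rule card_mono[OF finite_Z ones_subset[OF g]])
qed

lemma card_heavy_pos: "0 < card heavy"
proof -
  have "layer \<subseteq> heavy" by (auto simp: layer_def heavy_def)
  then have "card layer \<le> card heavy" by (rule card_mono[rotated]) simp
  then show ?thesis using card_layer_pos by simp
qed

lemma F_boolfun: "F g \<in> boolfun n"
  by (auto simp: boolfun_def F_def frame_def cube_def)

lemma F_Unate:
  assumes g: "\<And>x. card x < 3 * m \<Longrightarrow> \<not> g x"
    and mono: "\<And>x y. x \<subseteq> y \<Longrightarrow> y \<subseteq> {..<4 * m} \<Longrightarrow> g x \<Longrightarrow> g y"
  shows "F g \<in> Unate n"
proof -
  have "nondecreasing_in n (F g) i" if "i < n" for i
    unfolding nondecreasing_in_def
  proof (intro ballI le_boolI)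
    fix x assume x: "x \<in> cube n" and f: "F g (x[i := False])"
    let ?x0 = "x[i := False]" and ?x1 = "x[i := True]"
    have l: "length x = n" using x by (simp add: cube_def)
    have le: "?x1 ! k" if "?x0 ! k" "k < n" for k using that l by (cases "k = i") auto
    have "?x0 \<in> frame" using f by (simp add: F_def)
    then have fr: "?x1 \<in> frame" using le l by (auto simp: frame_def)
    have sub: "V ?x0 \<subseteq> V ?x1" using le n by (auto simp: V_def)
    then have c: "card (V ?x0) \<le> card (V ?x1)" by (rule card_mono[OF finite_V])
    have h: "3 * m \<le> card (V ?x0)" using f g[of "V ?x0"] by (auto simp: F_def split: if_splits) (meson not_le)
    show "F g ?x1"
    proof (cases "?x1 ! (4 * m)")
      case True
      then show ?thesis using fr h c by (simp add: F_def)
    next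
      case False
      then have "\<not> ?x0 ! (4 * m)" using le n by auto
      then have "g (V ?x0)" using f by (simp add: F_def)
      then show ?thesis using False fr mono[OF sub V_subset] by (simp add: F_def)
    qed
  qed
  then show ?thesis using F_boolfun by (auto simp: Unate_def)
qed

text \<open>The pairs of \<open>x\<close> and \<open>p x\<close> are disjoint edges, each with an
  error at one of its ends; choosing such an end is injective.\<close>

lemma card_le_sym_diff:
  assumes fin: "finite (sym_diff A B)" and p: "\<And>x. x \<in> L \<Longrightarrow> x \<in> sym_diff A B \<or> p x \<in> sym_diff A B"
    and inj: "inj_on p L" and disj: "\<And>x y. x \<in> L \<Longrightarrow> y \<in> L \<Longrightarrow> p x \<noteq> y"
  shows "card L \<le> card (sym_diff A B)"
proof (rule card_inj_on_le[where f = "\<lambda>x. if x \<in> sym_diff A B then x else p x"])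
  show "inj_on (\<lambda>x. if x \<in> sym_diff A B then x else p x) L"
    using disj inj by (fastforce simp: inj_on_def)
  show "(\<lambda>x. if x \<in> sym_diff A B then x else p x) ` L \<subseteq> sym_diff A B" using p by auto
qed (rule fin)

lemma V_update: "length x = n \<Longrightarrow> s < 4 * m \<Longrightarrow> V (x[s := b]) = (if b then insert s (V x) else V x - {s})"
  using n by (auto simp: V_def nth_list_update split: if_splits)

lemma sym_diff_iff: "x \<in> sym_diff (ones f) (ones h) \<longleftrightarrow> f x \<noteq> h x"
  by (auto simp: ones_def)

text \<open>If \<open>h\<close> is nondecreasing in all of the first \<open>4 * m\<close>
  directions, it errs on each violating edge with the switch off; otherwise it errs on each
  threshold edge in one direction \<open>k\<close> with the switch on.\<close>

lemma far_distance:
  assumes \<xi>: "\<xi> \<in> far" and h: "h \<in> Unate n"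
  shows "card layer * 2 ^ e \<le> 1536 * card (sym_diff (ones (F (gfun False \<xi>))) (ones h))"
proof -
  let ?g = "gfun False \<xi>"
  let ?D = "sym_diff (ones (F ?g)) (ones h)"
  have ch: "x \<in> cube n" if "x \<in> frame" for x using that by (simp add: frame_def cube_def)
  have fin: "finite ?D"
    by (rule finite_subset[OF _ finite_cube[of n]])
      (use F_boolfun h in \<open>auto simp: ones_def boolfun_def Unate_def\<close>)
  show ?thesis
  proof (cases "\<forall>k<4 * m. nondecreasing_in n h k")
    case True
    define s where "s y = (SOME s. violation \<xi> y s)" for y
    let ?Vs = "{y \<in> layer. \<exists>s. violation \<xi> y s}"
    let ?L = "{x \<in> frame. x ! (4 * m) = False \<and> V x \<in> ?Vs}"
    have s: "violation \<xi> y (s y)" if "y \<in> ?Vs" for y unfolding s_def using that by (auto intro: someI)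
    have sL: "violation \<xi> (V x) (s (V x))" "s (V x) < 4 * m" "\<not> x ! s (V x)" "x \<in> frame" "length x = n" if "x \<in> ?L" for x
      using s[of "V x"] that by (auto simp: violation_def V_def frame_def)
    let ?p = "\<lambda>x. x[s (V x) := True]"
    have Vp: "V (?p x) = insert (s (V x)) (V x)" if "x \<in> ?L" for x
      using V_update[of x "s (V x)" True] sL[OF that] by simp
    have "card ?L \<le> card ?D"
    proof (rule card_le_sym_diff[OF fin, where p = ?p])
      fix x assume x: "x \<in> ?L"
      note sx = sL[OF x]
      obtain i j where ij: "inreg \<xi> (V x) i j" "inreg \<xi> (insert (s (V x)) (V x)) i j" "\<xi> (SI i j) = {s (V x)}"
        and sn: "s (V x) \<notin> V x" using sx(1) by (auto simp: violation_def)
      have "?g (V x)" using gfun_inreg[OF ij(1)] ij(3) sn by simp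
      then have f1: "F ?g x" using x by (simp add: F_def)
      have "\<not> ?g (V (?p x))" unfolding Vp[OF x] using gfun_inreg[OF ij(2)] ij(3) by simp
      moreover have "?p x ! (4 * m) = False" using x sx(2) by (auto simp: nth_list_update)
      ultimately have f2: "\<not> F ?g (?p x)" by (simp add: F_def)
      have "x[s (V x) := False] = x" using sx by (metis list_update_id)
      then have "h x \<le> h (?p x)" using True sx(2) ch[OF sx(4)] unfolding nondecreasing_in_def by metis
      then show "x \<in> ?D \<or> ?p x \<in> ?D" using f1 f2 unfolding sym_diff_iff by auto
    next
      show "inj_on ?p ?L"
      proof (rule inj_onI)
        fix x y assume x: "x \<in> ?L" and y: "y \<in> ?L" and eq: "?p x = ?p y"
        note sx = sL[OF x] and sy = sL[OF y]
        have u: "insert (s (V x)) (V x) = insert (s (V y)) (V y)" using Vp[OF x] Vp[OF y] eq by simp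
        obtain i j where ij: "inreg \<xi> (insert (s (V x)) (V x)) i j" "\<xi> (SI i j) = {s (V x)}"
          using sx(1) by (auto simp: violation_def)
        obtain i' j' where ij': "inreg \<xi> (insert (s (V y)) (V y)) i' j'" "\<xi> (SI i' j') = {s (V y)}"
          using sy(1) by (auto simp: violation_def)
        \<comment> \<open>Equal upper ends lie in one region and share its secret, so the violating
          edges are disjoint.\<close>
        have "s (V x) = s (V y)" using inreg_unique[OF ij(1), of i' j'] ij' ij(2) u by simp
        then have "x[s (V x) := False] = y[s (V y) := False]" using eq by (metis list_update_overwrite)
        moreover have "x[s (V x) := False] = x" "y[s (V y) := False] = y" using sx sy by (metis list_update_id)+
        ultimately show "x = y" by simp
      qed
    next
      fix x y assume x: "x \<in> ?L" and y: "y \<in> ?L"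
      have "card (V (?p x)) = 3 * m + 1"
        unfolding Vp[OF x] using sL(1)[OF x] by (auto simp: violation_def layer_def)
      moreover have "card (V y) = 3 * m" using y by (auto simp: layer_def)
      ultimately show "?p x \<noteq> y" by auto
    qed
    moreover have "card ?L = card ?Vs * 2 ^ e" by (rule card_frame) (auto simp: layer_def)
    moreover have "card layer \<le> 1536 * card ?Vs" using \<xi> by (simp add: far_def)
    then have "card layer * 2 ^ e \<le> 1536 * card ?Vs * 2 ^ e" by (rule mult_le_mono1)
    ultimately show ?thesis by (simp only: mult.assoc)
  next
    case False
    then obtain k where k1: "k < 4 * m" "\<not> nondecreasing_in n h k" by blast
    moreover have "k < n" using k1 n by simp
    ultimately have k: "k < 4 * m" "nonincreasing_in n h k" using h by (auto simp: Unate_def)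
    let ?Vs = "{y \<in> layer. k \<in> y}"
    let ?L = "{x \<in> frame. x ! (4 * m) = True \<and> V x \<in> ?Vs}"
    let ?p = "\<lambda>x. x[k := False]"
    have xL: "x ! k" "length x = n" "x \<in> frame" "card (V x) = 3 * m" "k \<in> V x" if "x \<in> ?L" for x
      using that by (auto simp: V_def frame_def layer_def)
    have cp: "card (V (?p x)) = 3 * m - 1" if "x \<in> ?L" for x
      using V_update[of x k False] xL[OF that] k(1) by simp
    have id: "x[k := True] = x" if "x \<in> ?L" for x using xL[OF that] by (metis list_update_id)
    have "card ?L \<le> card ?D"
    proof (rule card_le_sym_diff[OF fin, where p = ?p])
      fix x assume x: "x \<in> ?L"
      have f1: "F ?g x" using x xL[OF x] by (simp add: F_def)
      have "?p x ! (4 * m)" using x k(1) by (auto simp: nth_list_update)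
      moreover have "card (V (?p x)) < 3 * m" using cp[OF x] m3 by linarith
      ultimately have f2: "\<not> F ?g (?p x)" by (simp add: F_def)
      have "h x \<le> h (?p x)" using k(2) ch[OF xL(3)[OF x]] id[OF x] unfolding nonincreasing_in_def by metis
      then show "x \<in> ?D \<or> ?p x \<in> ?D" using f1 f2 unfolding sym_diff_iff by auto
    next
      show "inj_on ?p ?L"
      proof (rule inj_onI)
        fix x y assume x: "x \<in> ?L" and y: "y \<in> ?L" and eq: "?p x = ?p y"
        then have "x[k := True] = y[k := True]" by (metis list_update_overwrite)
        then show "x = y" using id[OF x] id[OF y] by simp
      qed
    next
      fix x y assume x: "x \<in> ?L" and y: "y \<in> ?L"
      show "?p x \<noteq> y" using cp[OF x] xL(4)[OF y] m3 by auto
    qed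
    moreover have "card ?L = card ?Vs * 2 ^ e" by (rule card_frame) (auto simp: layer_def)
    moreover have "card layer * 2 ^ e \<le> 1536 * card ?Vs * 2 ^ e"
      by (rule mult_le_mono1) (rule card_layer_mem[OF k(1)])
    ultimately show ?thesis by (simp only: mult.assoc)
  qed
qed

text \<open>The constant is 4 times 1536: one factor 2 for the switch, another for
  \<open>heavy\<close> against \<open>layer\<close>.\<close>

lemma far_reldist:
  assumes \<xi>: "\<xi> \<in> far"
  shows "1 / 6144 \<le> reldist_class (F (gfun False \<xi>)) (Unate n)"
proof -
  let ?f = "F (gfun False \<xi>)"
  have c: "card (ones ?f) \<le> 2 * card heavy * 2 ^ e" "card heavy * 2 ^ e \<le> card (ones ?f)"
    using card_ones[of "gfun False \<xi>"] gfun_below by auto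
  have pos: "0 < card (ones ?f)" using c(2) card_heavy_pos by (metis gr0I le_zero_eq mult_is_0 neq0_conv power_eq_0_iff zero_neq_numeral)
  have "1 / 6144 \<le> reldist ?f h" if h: "h \<in> Unate n" for h
  proof -
    have "card (ones ?f) \<le> 4 * (card layer * 2 ^ e)"
    proof -
      have "card heavy * 2 ^ e \<le> 2 * card layer * 2 ^ e" by (rule mult_le_mono1[OF card_heavy])
      then show ?thesis using c(1) by (simp only: mult.assoc)
    qed
    then have "card (ones ?f) \<le> 6144 * card (sym_diff (ones ?f) (ones h))"
      using far_distance[OF \<xi> h] by linarith
    then have "real (card (ones ?f)) \<le> real (6144 * card (sym_diff (ones ?f) (ones h)))" by (simp only: of_nat_le_iff)
    then show ?thesis unfolding reldist_def using pos by (simp add: field_simps)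
  qed
  then show ?thesis unfolding reldist_class_def by (intro Min.boundedI) (auto simp: finite_Unate Unate_nonempty)
qed

end

section \<open>Simulating and amplifying a tester\<close>

definition accd :: "(bool list \<Rightarrow> bool) \<Rightarrow> alg \<Rightarrow> real" where
  "accd f a = pmf (map_pmf fst (run_det f a)) True"

definition pacc :: "(nat set \<Rightarrow> bool) \<Rightarrow> dtree pmf \<Rightarrow> real" where
  "pacc g D = pmf (map_pmf (verdict g) D) True"

lemma pmf_bool_False: "pmf (p :: bool pmf) False = 1 - pmf p True"
proof -
  have "(\<Sum>b\<in>UNIV. pmf p b) = 1" by (rule sum_pmf_eq_1) auto
  then show ?thesis by (simp add: UNIV_bool)
qed

lemma expectation_bool: "(\<integral>b. h b \<partial>measure_pmf (p :: bool pmf)) = h True * pmf p True + h False * (1 - pmf p True)"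
  for h :: "bool \<Rightarrow> real"
  by (subst integral_measure_pmf_real[of UNIV]) (auto simp: UNIV_bool pmf_bool_False)

lemma accd_simps:
  "accd f (Output b) = (if b then 1 else 0)"
  "accd f (MQ x k) = accd f (k (f x))"
  "finite (ones f) \<Longrightarrow> ones f \<noteq> {} \<Longrightarrow> accd f (SAMP l) = (\<Sum>x\<in>ones f. accd f (l x)) / card (ones f)"
proof -
  have fs: "fst \<circ> apsnd Suc = (fst :: bool \<times> nat \<Rightarrow> bool)" by auto
  show "accd f (Output b) = (if b then 1 else 0)" by (simp add: accd_def)
  show "accd f (MQ x k) = accd f (k (f x))" by (simp add: accd_def pmf.map_comp fs)
  show "accd f (SAMP l) = (\<Sum>x\<in>ones f. accd f (l x)) / card (ones f)"
    if "finite (ones f)" "ones f \<noteq> {}"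
    by (simp add: accd_def map_bind_pmf pmf.map_comp fs pmf_bind integral_pmf_of_set[OF that(2,1)])
qed

lemma accd_bounds: "0 \<le> accd f a" "accd f a \<le> 1"
  by (simp_all add: accd_def pmf_le_1)

lemma pacc_bounds: "0 \<le> pacc g D" "pacc g D \<le> 1"
  by (simp_all add: pacc_def pmf_le_1)

lemma prob_accept_eq: "prob_accept f A = (\<integral>a. accd f a \<partial>measure_pmf A)"
proof -
  have "prob_accept f A = pmf (map_pmf fst (run f A)) True"
    by (simp add: prob_accept_def pmf_map vimage_def)
  then show ?thesis by (simp add: run_def map_bind_pmf pmf_bind accd_def)
qed

lemma prob_reject_eq: "prob_reject f A = 1 - prob_accept f A"
proof -
  have "prob_reject f A = pmf (map_pmf fst (run f A)) False"
    by (simp add: prob_reject_def pmf_map vimage_def)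
  moreover have "prob_accept f A = pmf (map_pmf fst (run f A)) True"
    by (simp add: prob_accept_def pmf_map vimage_def)
  ultimately show ?thesis by (simp add: pmf_bool_False)
qed

lemma pacc_bind: "pacc g (bind_pmf A D) = (\<integral>a. pacc g (D a) \<partial>measure_pmf A)"
  by (simp add: pacc_def map_bind_pmf pmf_bind)

lemma integral_pmf_mono:
  fixes f h :: "'a \<Rightarrow> real"
  assumes "\<And>a. a \<in> set_pmf A \<Longrightarrow> f a \<le> h a" "\<And>a. \<bar>f a\<bar> \<le> B" "\<And>a. \<bar>h a\<bar> \<le> B"
  shows "(\<integral>a. f a \<partial>measure_pmf A) \<le> (\<integral>a. h a \<partial>measure_pmf A)"
  by (rule integral_mono_AE)
    (use assms in \<open>auto intro!: measure_pmf.integrable_const_bound[where B = B] simp: AE_measure_pmf_iff\<close>)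

primrec dbind :: "dtree \<Rightarrow> (bool \<Rightarrow> dtree) \<Rightarrow> dtree" where
  "dbind (Out b) k = k b"
| "dbind (Ask x h) k = Ask x (\<lambda>b. dbind (h b) k)"

lemma verdict_dbind: "verdict g (dbind d k) = verdict g (k (verdict g d))"
  by (induction d) auto

lemma queries_dbind: "queries g (dbind d k) = queries g d @ queries g (k (verdict g d))"
  by (induction d) auto

text \<open>
  Far instances only have constant probability, so the error of the tester is first made tiny by iterated
  majority votes of three.
\<close>

definition maj :: "dtree \<Rightarrow> dtree \<Rightarrow> dtree \<Rightarrow> dtree" where
  "maj d1 d2 d3 = dbind d1 (\<lambda>a. dbind d2 (\<lambda>b. if a = b then Out a else d3))"

definition amp :: "dtree pmf \<Rightarrow> dtree pmf" where
  "amp D = bind_pmf D (\<lambda>d1. bind_pmf D (\<lambda>d2. map_pmf (maj d1 d2) D))"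

text \<open>Probability that the majority of three independent votes accepts if each does so with
  probability \<open>p\<close>.\<close>

definition boost :: "real \<Rightarrow> real" where
  "boost p = 3 * p ^ 2 - 2 * p ^ 3"

lemma pacc_amp: "pacc g (amp D) = boost (pacc g D)"
proof -
  define B where "B = map_pmf (verdict g) D"
  define p where "p = pacc g D"
  have pB: "pmf B True = p" by (simp add: B_def p_def pacc_def)
  have v: "map_pmf (verdict g) (map_pmf (maj d1 d2) D)
      = (if verdict g d1 = verdict g d2 then return_pmf (verdict g d1) else B)" for d1 d2
    by (auto simp: pmf.map_comp o_def maj_def verdict_dbind B_def)
  have "map_pmf (verdict g) (amp D) =
      bind_pmf D (\<lambda>d1. bind_pmf D (\<lambda>d2. if verdict g d1 = verdict g d2 then return_pmf (verdict g d1) else B))"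
    by (simp only: amp_def map_bind_pmf v)
  also have "\<dots> = bind_pmf B (\<lambda>a. bind_pmf B (\<lambda>b. if a = b then return_pmf a else B))"
    by (simp add: B_def bind_map_pmf)
  finally have "pacc g (amp D) = pmf (bind_pmf B (\<lambda>a. bind_pmf B (\<lambda>b. if a = b then return_pmf a else B))) True"
    by (simp add: pacc_def)
  also have "\<dots> = boost p"
    by (simp add: pmf_bind expectation_bool pB if_distrib[of "\<lambda>q. pmf q True"] boost_def
        power2_eq_square power3_eq_cube algebra_simps)
  finally show ?thesis by (simp add: p_def)
qed

lemma boost_mono:
  assumes "0 \<le> a" "a \<le> p" "p \<le> 1"
  shows "boost a \<le> boost p"
proof -
  have "p * p \<le> p" "a * a \<le> a" using assms by (auto intro: mult_left_le)
  moreover have "0 \<le> (p - a) * (p - a)" by simp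
  then have "2 * (p * a) \<le> p * p + a * a" by (simp add: algebra_simps)
  moreover have "3 * (p + a) - 2 * (p * p + p * a + a * a) = 3 * p + 3 * a - 2 * (p * p) - 2 * (p * a) - 2 * (a * a)"
    by (simp add: algebra_simps)
  ultimately have "0 \<le> 3 * (p + a) - 2 * (p * p + p * a + a * a)" by linarith
  then have "0 \<le> (p - a) * (3 * (p + a) - 2 * (p * p + p * a + a * a))"
    using assms by simp
  also have "\<dots> = boost p - boost a" by (simp add: boost_def power2_eq_square power3_eq_cube algebra_simps)
  finally show ?thesis by simp
qed

lemma boost_range: "0 \<le> p \<Longrightarrow> p \<le> 1 \<Longrightarrow> 0 \<le> boost p \<and> boost p \<le> 1"
  using boost_mono[of 0 p] boost_mono[of p 1] by (simp add: boost_def)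

text \<open>The start 13/20 is 2/3 - 1/60, the guarantee of the tester minus the loss from
  simulating samples. Six rounds multiply the number of queries by at most
  \<open>3 ^ 6 = 729\<close>.\<close>

lemma boost_iterate:
  assumes "13 / 20 \<le> p" "p \<le> 1"
  shows "9999 / 10000 \<le> (boost ^^ 6) p"
proof -
  have step: "b \<le> boost p \<and> boost p \<le> 1" if "a \<le> p" "0 \<le> a" "p \<le> 1" "b \<le> boost a" for a b p
    using boost_mono[OF that(2,1,3)] boost_range[of p] that by simp
  have 1: "718 / 1000 \<le> boost p \<and> boost p \<le> 1"
    by (rule step[of "13 / 20"]) (use assms in \<open>simp_all add: boost_def power2_eq_square power3_eq_cube\<close>)
  let ?p = "boost p"
  have 2: "806 / 1000 \<le> boost ?p \<and> boost ?p \<le> 1"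
    by (rule step[of "718 / 1000"]) (use 1 in \<open>simp_all add: boost_def[of "718 / 1000"] boost_def[of "359 / 500"] power2_eq_square power3_eq_cube\<close>)
  let ?q = "boost ?p"
  have 3: "9 / 10 \<le> boost ?q \<and> boost ?q \<le> 1"
    by (rule step[of "806 / 1000"]) (use 2 in \<open>simp_all add: boost_def[of "806 / 1000"] boost_def[of "403 / 500"] power2_eq_square power3_eq_cube\<close>)
  let ?r = "boost ?q"
  have 4: "97 / 100 \<le> boost ?r \<and> boost ?r \<le> 1"
    by (rule step[of "9 / 10"]) (use 3 in \<open>simp_all add: boost_def[of "9 / 10"] power2_eq_square power3_eq_cube\<close>)
  let ?s = "boost ?r"
  have 5: "997 / 1000 \<le> boost ?s \<and> boost ?s \<le> 1"
    by (rule step[of "97 / 100"]) (use 4 in \<open>simp_all add: boost_def[of "97 / 100"] power2_eq_square power3_eq_cube\<close>)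
  let ?t = "boost ?s"
  have 6: "9999 / 10000 \<le> boost ?t \<and> boost ?t \<le> 1"
    by (rule step[of "997 / 1000"]) (use 5 in \<open>simp_all add: boost_def[of "997 / 1000"] power2_eq_square power3_eq_cube\<close>)
  then show ?thesis by (simp add: numeral_eq_Suc)
qed

lemma boost_compl: "(boost ^^ k) (1 - p) = 1 - (boost ^^ k) p"
proof (induction k)
  case (Suc k)
  have "boost (1 - x) = 1 - boost x" for x
    by (simp add: boost_def power2_eq_square power3_eq_cube algebra_simps)
  then show ?case using Suc by simp
qed simp

lemma pacc_amp_iterate: "pacc g ((amp ^^ k) D) = (boost ^^ k) (pacc g D)"
  by (induction k) (simp_all add: pacc_amp)

lemma queries_maj:
  assumes "length (queries g d1) \<le> B" "length (queries g d2) \<le> B" "length (queries g d3) \<le> B"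
  shows "length (queries g (maj d1 d2 d3)) \<le> 3 * B"
  using assms by (auto simp: maj_def queries_dbind)

lemma set_amp:
  assumes "d \<in> set_pmf (amp D)"
  obtains d1 d2 d3 where "d = maj d1 d2 d3" "d1 \<in> set_pmf D" "d2 \<in> set_pmf D" "d3 \<in> set_pmf D"
  using assms by (auto simp: amp_def)

lemma queries_amp:
  assumes "\<And>d. d \<in> set_pmf D \<Longrightarrow> length (queries g d) \<le> B" "d \<in> set_pmf ((amp ^^ k) D)"
  shows "length (queries g d) \<le> 3 ^ k * B"
  using assms(2)
proof (induction k arbitrary: d)
  case (Suc k)
  from Suc.prems have "d \<in> set_pmf (amp ((amp ^^ k) D))" by simp
  then obtain d1 d2 d3 where d: "d = maj d1 d2 d3" and
    "d1 \<in> set_pmf ((amp ^^ k) D)" "d2 \<in> set_pmf ((amp ^^ k) D)" "d3 \<in> set_pmf ((amp ^^ k) D)"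
    by (rule set_amp)
  then have "length (queries g (maj d1 d2 d3)) \<le> 3 * (3 ^ k * B)" by (intro queries_maj Suc.IH)
  then show ?case using d by (simp add: mult.assoc)
qed (use assms(1) in auto)

section \<open>Replacing samples by membership queries\<close>

context lifted
begin

definition askF :: "bool list \<Rightarrow> dtree \<Rightarrow> dtree \<Rightarrow> dtree" where
  "askF x d1 d0 = (if x \<notin> frame then d0
     else if x ! (4 * m) then (if 3 * m \<le> card (V x) then d1 else d0)
     else Ask (V x) (\<lambda>b. if b then d1 else d0))"

text \<open>
  A sample is simulated by rejection: uniform points of \<open>Z\<close> until one is accepted, at most \<open>r\<close> times.
\<close>

primrec tries :: "(bool list \<Rightarrow> dtree pmf) \<Rightarrow> nat \<Rightarrow> dtree pmf" where
  "tries s 0 = return_pmf (Out False)"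
| "tries s (Suc r) = bind_pmf (pmf_of_set Z)
     (\<lambda>z. bind_pmf (s z) (\<lambda>d1. map_pmf (askF z d1) (tries s r)))"

text \<open>The randomness of the samples is drawn in advance, giving a distribution on
  deterministic trees to which the counting of worlds applies. Continuations for both answers are
  drawn, but a run follows only one.\<close>

primrec sim :: "nat \<Rightarrow> alg \<Rightarrow> dtree pmf" where
  "sim R (Output b) = return_pmf (Out b)"
| "sim R (MQ x k) = bind_pmf (sim R (k True)) (\<lambda>d1. map_pmf (askF x d1) (sim R (k False)))"
| "sim R (SAMP k) = tries (\<lambda>x. sim R (k x)) R"

lemma verdict_askF: "verdict g (askF x d1 d0) = verdict g (if F g x then d1 else d0)"
  by (simp add: askF_def F_def)

lemma queries_askF: "length (queries g (askF x d1 d0)) \<le> 1 + length (queries g (if F g x then d1 else d0))"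
  by (simp add: askF_def F_def)

lemma pacc_askF:
  "pacc g (bind_pmf P (\<lambda>d1. map_pmf (askF x d1) Q)) = (if F g x then pacc g P else pacc g Q)"
proof -
  have "map_pmf (verdict g) (bind_pmf P (\<lambda>d1. map_pmf (askF x d1) Q)) =
      bind_pmf P (\<lambda>d1. map_pmf (\<lambda>d0. verdict g (if F g x then d1 else d0)) Q)"
    by (simp add: map_bind_pmf pmf.map_comp o_def verdict_askF)
  also have "\<dots> = (if F g x then map_pmf (verdict g) P else map_pmf (verdict g) Q)"
    by (simp add: map_pmf_def bind_return_pmf)
  finally show ?thesis by (simp add: pacc_def)
qed

lemma Z_nonempty: "Z \<noteq> {}"
  using card_Z card_heavy_pos by (metis card.empty mult_is_0 neq0_conv power_eq_0_iff zero_neq_numeral)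

text \<open>All \<open>r\<close> tries fail with the power in the first factor, and then the tree
  rejects; given a success, the accepted point is uniform.\<close>

lemma pacc_tries:
  assumes g: "\<And>x. card x < 3 * m \<Longrightarrow> \<not> g x"
  shows "pacc g (tries s r) = (1 - (1 - real (card (ones (F g))) / real (card Z)) ^ r) *
    ((\<Sum>x\<in>ones (F g). pacc g (s x)) / real (card (ones (F g))))"
proof (induction r)
  case 0
  then show ?case by (simp add: pacc_def)
next
  case (Suc r)
  let ?O = "ones (F g)" and ?p = "pacc g (tries s r)"
  let ?A = "(\<Sum>x\<in>?O. pacc g (s x)) / real (card ?O)" and ?\<pi> = "real (card ?O) / real (card Z)"
  have sub: "?O \<subseteq> Z" by (rule ones_subset[where g = g, OF g])
  have Zp: "0 < card Z" using Z_nonempty by (simp add: card_gt_0_iff)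
  have "0 < card heavy * 2 ^ e" using card_heavy_pos by simp
  then have Op: "0 < card ?O" using card_ones(1)[where g = g, OF g] by linarith
  have "pacc g (tries s (Suc r)) = (\<Sum>z\<in>Z. if F g z then pacc g (s z) else ?p) / real (card Z)"
    by (simp only: tries.simps pacc_bind[of _ "pmf_of_set Z"] pacc_askF integral_pmf_of_set[OF Z_nonempty finite_Z])
  also have "(\<Sum>z\<in>Z. if F g z then pacc g (s z) else ?p) = (\<Sum>z\<in>?O. pacc g (s z)) + (\<Sum>z\<in>Z - ?O. ?p)"
  proof -
    have "(\<Sum>z\<in>Z. if F g z then pacc g (s z) else ?p) =
        (\<Sum>z\<in>Z - ?O. if F g z then pacc g (s z) else ?p) + (\<Sum>z\<in>?O. if F g z then pacc g (s z) else ?p)"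
      by (rule sum.subset_diff[OF sub finite_Z])
    also have "(\<Sum>z\<in>Z - ?O. if F g z then pacc g (s z) else ?p) = (\<Sum>z\<in>Z - ?O. ?p)"
      by (rule sum.cong) (auto simp: ones_def)
    also have "(\<Sum>z\<in>?O. if F g z then pacc g (s z) else ?p) = (\<Sum>z\<in>?O. pacc g (s z))"
      by (rule sum.cong) (auto simp: ones_def)
    finally show ?thesis by simp
  qed
  also have "(\<Sum>z\<in>Z - ?O. ?p) = (real (card Z) - real (card ?O)) * ?p"
    using sub finite_subset[OF sub finite_Z] by (simp add: card_Diff_subset card_mono of_nat_diff)
  also have "((\<Sum>z\<in>?O. pacc g (s z)) + (real (card Z) - real (card ?O)) * ?p) / real (card Z)
      = ?\<pi> * ?A + (1 - ?\<pi>) * ?p"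
  proof -
    have "(S + (z - w) * p) / z = w / z * (S / w) + (1 - w / z) * p" if "0 < z" "0 < w" for S z w p :: real
      using that by (simp add: add_divide_distrib left_diff_distrib diff_divide_distrib)
    then show ?thesis using Zp Op by simp
  qed
  also have "\<dots> = (1 - (1 - ?\<pi>) ^ Suc r) * ?A"
  proof -
    have "x * A + (1 - x) * ((1 - u) * A) = (1 - (1 - x) * u) * A" for x A u :: real
      by (simp add: algebra_simps)
    then show ?thesis unfolding Suc.IH power_Suc .
  qed
  finally show ?case .
qed

lemma pi_bounds:
  assumes g: "\<And>x. card x < 3 * m \<Longrightarrow> \<not> g x"
  shows "1 / 2 \<le> real (card (ones (F g))) / real (card Z)" "real (card (ones (F g))) / real (card Z) \<le> 1"
    "finite (ones (F g))" "ones (F g) \<noteq> {}" "0 < card (ones (F g))"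
proof -
  have Zp: "0 < card Z" using Z_nonempty by (simp add: card_gt_0_iff)
  have "card Z = 2 * (card heavy * 2 ^ e)" by (simp add: card_Z)
  then have a: "card Z \<le> 2 * card (ones (F g))" "card (ones (F g)) \<le> card Z"
    using card_ones[where g = g, OF g] card_Z by simp_all
  have b: "real (card Z) \<le> 2 * real (card (ones (F g)))" using a(1) by linarith
  show "1 / 2 \<le> real (card (ones (F g))) / real (card Z)" using b Zp by (simp add: field_simps)
  show "real (card (ones (F g))) / real (card Z) \<le> 1" using a(2) Zp by (simp add: field_simps)
  show "0 < card (ones (F g))" using a(1) Zp by linarith
  then show "finite (ones (F g))" "ones (F g) \<noteq> {}" by (auto simp: card_gt_0_iff)
qed

text \<open>A failed sample leads to rejection, so the simulation errs on one side only.\<close>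

lemma sim_le:
  assumes g: "\<And>x. card x < 3 * m \<Longrightarrow> \<not> g x"
  shows "pacc g (sim R a) \<le> accd (F g) a"
proof (induction a)
  case (Output b)
  then show ?case by (simp add: accd_simps pacc_def)
next
  case (MQ x k)
  then show ?case by (simp add: accd_simps pacc_askF)
next
  case (SAMP k)
  note pb = pi_bounds[where g = g, OF g]
  let ?O = "ones (F g)"
  let ?A = "(\<Sum>x\<in>?O. pacc g (sim R (k x))) / real (card ?O)"
  have "0 \<le> ?A" by (simp add: sum_nonneg pacc_bounds)
  moreover have "0 \<le> (1 - real (card ?O) / real (card Z)) ^ R" using pb(2) by simp
  ultimately have "0 \<le> (1 - real (card ?O) / real (card Z)) ^ R * ?A" by (rule mult_nonneg_nonneg[rotated])
  moreover have "pacc g (sim R (SAMP k)) = ?A - (1 - real (card ?O) / real (card Z)) ^ R * ?A"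
    by (simp only: sim.simps pacc_tries[where g = g, OF g] left_diff_distrib mult_1)
  ultimately have "pacc g (sim R (SAMP k)) \<le> ?A" by linarith
  also have "\<dots> \<le> (\<Sum>x\<in>?O. accd (F g) (k x)) / real (card ?O)"
    by (intro divide_right_mono sum_mono) (use SAMP in auto)
  finally show ?case by (simp add: accd_simps(3)[OF pb(3,4)])
qed

lemma SAMP_count:
  assumes "finite (ones f)" "ones f \<noteq> {}" "\<forall>r\<in>set_pmf (run_det f (SAMP k)). snd r \<le> q"
  shows "1 \<le> q \<and> (\<forall>x\<in>ones f. \<forall>r\<in>set_pmf (run_det f (k x)). snd r \<le> q - 1)"
proof -
  have *: "Suc (snd r) \<le> q" if "x \<in> ones f" "r \<in> set_pmf (run_det f (k x))" for x r
    using assms that by force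
  moreover obtain x r where "x \<in> ones f" "r \<in> set_pmf (run_det f (k x))" using assms(2) set_pmf_not_empty by fast
  ultimately have "1 \<le> q" by fastforce
  then show ?thesis using * by fastforce
qed

lemma MQ_count:
  assumes "\<forall>r\<in>set_pmf (run_det f (MQ x k)). snd r \<le> q"
  shows "1 \<le> q \<and> (\<forall>r\<in>set_pmf (run_det f (k (f x))). snd r \<le> q - 1)"
proof -
  have *: "Suc (snd r) \<le> q" if "r \<in> set_pmf (run_det f (k (f x)))" for r using assms that by force
  moreover obtain r where "r \<in> set_pmf (run_det f (k (f x)))" using set_pmf_not_empty by fast
  ultimately have "1 \<le> q" by fastforce
  then show ?thesis using * by fastforce
qed

text \<open>The switch makes at least half of \<open>Z\<close> accepting, so each of the at most
  \<open>q\<close> samples fails with probability at most \<open>2 ^ -R\<close>.\<close>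

lemma sim_ge:
  assumes g: "\<And>x. card x < 3 * m \<Longrightarrow> \<not> g x"
  shows "\<forall>r\<in>set_pmf (run_det (F g) a). snd r \<le> q \<Longrightarrow> accd (F g) a \<le> pacc g (sim R a) + real q / 2 ^ R"
proof (induction a arbitrary: q)
  case (Output b)
  then show ?case by (simp add: accd_simps pacc_def)
next
  case (MQ x k)
  note c = MQ_count[OF MQ.prems]
  have "accd (F g) (k (F g x)) \<le> pacc g (sim R (k (F g x))) + real (q - 1) / 2 ^ R"
    by (rule MQ.IH) (use c in auto)
  moreover have "real (q - 1) / 2 ^ R \<le> real q / 2 ^ R" by (rule divide_right_mono) auto
  moreover have "pacc g (sim R (MQ x k)) = pacc g (sim R (k (F g x)))" by (simp add: pacc_askF)
  ultimately show ?case by (simp add: accd_simps)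
next
  case (SAMP k)
  note pb = pi_bounds[where g = g, OF g]
  let ?O = "ones (F g)"
  note c = SAMP_count[OF pb(3,4) SAMP.prems]
  let ?A = "(\<Sum>x\<in>?O. pacc g (sim R (k x))) / real (card ?O)"
  let ?\<rho> = "1 - real (card ?O) / real (card Z)"
  have "accd (F g) (SAMP k) = (\<Sum>x\<in>?O. accd (F g) (k x)) / real (card ?O)" by (rule accd_simps(3)[OF pb(3,4)])
  also have "\<dots> \<le> (\<Sum>x\<in>?O. pacc g (sim R (k x)) + real (q - 1) / 2 ^ R) / real (card ?O)"
    by (intro divide_right_mono sum_mono SAMP.IH) (use c in auto)
  also have "\<dots> = ?A + real (q - 1) / 2 ^ R" using pb(5) by (simp add: sum.distrib add_divide_distrib)
  finally have 1: "accd (F g) (SAMP k) \<le> ?A + real (q - 1) / 2 ^ R" .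
  have "?A \<le> (\<Sum>x\<in>?O. 1) / real (card ?O)"
    by (intro divide_right_mono sum_mono pacc_bounds) auto
  then have A1: "?A \<le> 1" using pb(5) by simp
  have A0: "0 \<le> ?A" by (simp add: sum_nonneg pacc_bounds)
  have "?\<rho> ^ R \<le> (1 / 2) ^ R" by (rule power_mono) (use pb(1,2) in auto)
  moreover have "0 \<le> ?\<rho> ^ R" using pb(2) by simp
  ultimately have "?\<rho> ^ R * ?A \<le> (1 / 2) ^ R * 1" using A0 A1 by (intro mult_mono) auto
  moreover have "pacc g (sim R (SAMP k)) = ?A - ?\<rho> ^ R * ?A"
    by (simp only: sim.simps pacc_tries[where g = g, OF g] left_diff_distrib mult_1)
  ultimately have "?A \<le> pacc g (sim R (SAMP k)) + 1 / 2 ^ R" by (simp add: power_one_over)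
  moreover have "real (q - 1) / 2 ^ R + 1 / 2 ^ R = real q / 2 ^ R"
    using c by (simp add: of_nat_diff add_divide_distrib[symmetric])
  ultimately show ?case using 1 by linarith
qed

lemma queries_tries:
  assumes "\<And>x d. x \<in> ones (F g) \<Longrightarrow> d \<in> set_pmf (s x) \<Longrightarrow> length (queries g d) \<le> B"
    and "d \<in> set_pmf (tries s r)"
  shows "length (queries g d) \<le> r + B"
  using assms(2)
proof (induction r arbitrary: d)
  case (Suc r)
  then obtain z d1 d0 where d: "d = askF z d1 d0" "d1 \<in> set_pmf (s z)" "d0 \<in> set_pmf (tries s r)"
    by auto
  have "length (queries g (if F g z then d1 else d0)) \<le> r + B"
  proof (cases "F g z")
    case True
    then show ?thesis using assms(1)[of z d1] d by (auto simp: ones_def)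
  next
    case False
    then show ?thesis using Suc.IH[OF d(3)] by simp
  qed
  then show ?case unfolding d(1) using queries_askF[of g z d1 d0] by linarith
qed simp

lemma queries_sim:
  assumes g: "\<And>x. card x < 3 * m \<Longrightarrow> \<not> g x" and R: "1 \<le> R"
  shows "\<forall>r\<in>set_pmf (run_det (F g) a). snd r \<le> q \<Longrightarrow> d \<in> set_pmf (sim R a) \<Longrightarrow> length (queries g d) \<le> q * R"
proof (induction a arbitrary: q d)
  case (Output b)
  then show ?case by simp
next
  case (MQ x k)
  note c = MQ_count[OF MQ.prems(1)]
  obtain d1 d0 where d: "d = askF x d1 d0" "d1 \<in> set_pmf (sim R (k True))" "d0 \<in> set_pmf (sim R (k False))"
    using MQ.prems(2) by auto
  have "length (queries g (if F g x then d1 else d0)) \<le> (q - 1) * R"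
    by (rule MQ.IH[of "k (F g x)"]) (use c d in auto)
  moreover have "q * R = (q - 1) * R + R" using c by (cases q) auto
  ultimately show ?case unfolding d(1) using queries_askF[of g x d1 d0] R by linarith
next
  case (SAMP k)
  note pb = pi_bounds[where g = g, OF g]
  note c = SAMP_count[OF pb(3,4) SAMP.prems(1)]
  have "length (queries g d) \<le> R + (q - 1) * R"
  proof (rule queries_tries)
    show "d \<in> set_pmf (tries (\<lambda>x. sim R (k x)) R)" using SAMP.prems(2) by simp
    fix x d assume "x \<in> ones (F g)" "d \<in> set_pmf (sim R (k x))"
    then show "length (queries g d) \<le> (q - 1) * R" using c by (intro SAMP.IH[of "k x"]) auto
  qed
  moreover have "q * R = (q - 1) * R + R" using c by (cases q) auto
  ultimately show ?case by linarith
qed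

end

section \<open>The lower bound\<close>

lemma sum_pacc:
  assumes "finite S"
  shows "(\<Sum>\<xi>\<in>S. pacc (G \<xi>) D) = (\<integral>d. real (card {\<xi> \<in> S. verdict (G \<xi>) d}) \<partial>measure_pmf D)"
proof -
  have 1: "pacc (G \<xi>) D = (\<integral>d. (if verdict (G \<xi>) d then 1 else 0) \<partial>measure_pmf D)" for \<xi>
  proof -
    have "pacc (G \<xi>) D = measure_pmf.prob D {d. verdict (G \<xi>) d}"
      by (simp add: pacc_def pmf_map vimage_def)
    also have "\<dots> = (\<integral>d. indicat_real {d. verdict (G \<xi>) d} d \<partial>measure_pmf D)" by simp
    also have "\<dots> = (\<integral>d. (if verdict (G \<xi>) d then 1 else 0) \<partial>measure_pmf D)"
      by (rule Bochner_Integration.integral_cong) (auto simp: indicator_def)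
    finally show ?thesis .
  qed
  have "(\<Sum>\<xi>\<in>S. pacc (G \<xi>) D) = (\<integral>d. (\<Sum>\<xi>\<in>S. if verdict (G \<xi>) d then 1 else 0) \<partial>measure_pmf D)"
    unfolding 1 by (rule Bochner_Integration.integral_sum[symmetric])
      (auto intro!: measure_pmf.integrable_const_bound[where B = 1])
  also have "\<dots> = (\<integral>d. real (card {\<xi> \<in> S. verdict (G \<xi>) d}) \<partial>measure_pmf D)"
    using assms by (simp add: sum.If_cases Int_def)
  finally show ?thesis .
qed

context lifted
begin

text \<open>Averaged over the worlds, acceptance is at least 9999/10000 on the monotone side and
  drops by at most 1/4000 on the other. As \<open>far\<close> has density at least 1/1536 and is
  accepted with probability at most 1/10000, a drop of more than 1/2000 would be required.\<close>

lemma no_tester: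
  assumes tester: "two_sided_unateness_tester n (1 / 6144) P A" and q: "makes_at_most q P A"
    and mem: "\<And>\<xi> up. \<xi> \<in> W \<Longrightarrow> F (gfun up \<xi>) \<in> P"
    and R: "1 \<le> R" "real q / 2 ^ R \<le> 1 / 60"
    and LL: "1 \<le> LL" and Wm: "2 * real Q * real LL * (1 + sqrt (2 * real Q)) \<le> real Wm" "2 * Wm \<le> m"
    and Q: "729 * (q * R) \<le> Q"
    and gap: "4 * real Q ^ 2 / 2 ^ LL + (2 * real Q + 2 * real Wm) / real m \<le> 1 / 4000"
  shows False
proof -
  define D0 where "D0 = bind_pmf A (sim R)"
  define D where "D = (amp ^^ 6) D0"
  have low: "\<not> gfun up \<xi> x" if "card x < 3 * m" for up \<xi> x using gfun_below[OF that] .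
  have runs: "\<forall>r\<in>set_pmf (run_det (F (gfun up \<xi>)) a). snd r \<le> q"
    if "\<xi> \<in> W" "a \<in> set_pmf A" for up \<xi> a
    using q mem[OF that(1), of up] that(2) unfolding makes_at_most_def run_def by fastforce
  have p0: "pacc g D0 = (\<integral>a. pacc g (sim R a) \<partial>measure_pmf A)" for g
    by (simp add: D0_def pacc_bind)
  have yes: "9999 / 10000 \<le> pacc (gfun True \<xi>) D" if \<xi>: "\<xi> \<in> W" for \<xi>
  proof -
    have "F (gfun True \<xi>) \<in> Unate n"
      by (rule F_Unate) (use low gfun_mono in blast)+
    then have "2 / 3 \<le> prob_accept (F (gfun True \<xi>)) A"
      using tester mem[OF \<xi>, of True] by (simp add: two_sided_unateness_tester_def)
    also have "\<dots> = (\<integral>a. accd (F (gfun True \<xi>)) a \<partial>measure_pmf A)" by (rule prob_accept_eq)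
    also have "\<dots> \<le> (\<integral>a. pacc (gfun True \<xi>) (sim R a) + 1 / 60 \<partial>measure_pmf A)"
    proof (rule integral_pmf_mono[where B = 2])
      fix a assume a: "a \<in> set_pmf A"
      have "accd (F (gfun True \<xi>)) a \<le> pacc (gfun True \<xi>) (sim R a) + real q / 2 ^ R"
        by (rule sim_ge[OF low runs[OF \<xi> a]])
      then show "accd (F (gfun True \<xi>)) a \<le> pacc (gfun True \<xi>) (sim R a) + 1 / 60" using R(2) by linarith
    next
      show "\<bar>accd (F (gfun True \<xi>)) a\<bar> \<le> 2" "\<bar>pacc (gfun True \<xi>) (sim R a) + 1 / 60\<bar> \<le> 2" for a
        using accd_bounds[of "F (gfun True \<xi>)" a] pacc_bounds[of "gfun True \<xi>" "sim R a"] by linarith+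
    qed
    also have "\<dots> = pacc (gfun True \<xi>) D0 + 1 / 60"
      unfolding p0 by (subst Bochner_Integration.integral_add)
        (auto intro!: measure_pmf.integrable_const_bound[where B = 1] simp: pacc_bounds)
    finally have "13 / 20 \<le> pacc (gfun True \<xi>) D0" by simp
    then show ?thesis unfolding D_def pacc_amp_iterate by (rule boost_iterate) (rule pacc_bounds)
  qed
  have no: "pacc (gfun False \<xi>) D \<le> 1 / 10000" if \<xi>: "\<xi> \<in> far" for \<xi>
  proof -
    have \<xi>W: "\<xi> \<in> W" using \<xi> by (simp add: far_def)
    have "2 / 3 \<le> prob_reject (F (gfun False \<xi>)) A"
      using tester mem[OF \<xi>W, of False] far_reldist[OF \<xi>] by (simp add: two_sided_unateness_tester_def)
    then have "prob_accept (F (gfun False \<xi>)) A \<le> 1 / 3" by (simp add: prob_reject_eq)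
    moreover have "pacc (gfun False \<xi>) D0 \<le> prob_accept (F (gfun False \<xi>)) A"
      unfolding p0 prob_accept_eq
    proof (rule integral_pmf_mono[where B = 2])
      show "pacc (gfun False \<xi>) (sim R a) \<le> accd (F (gfun False \<xi>)) a" for a by (rule sim_le[OF low])
      show "\<bar>accd (F (gfun False \<xi>)) a\<bar> \<le> 2" "\<bar>pacc (gfun False \<xi>) (sim R a)\<bar> \<le> 2" for a
        using accd_bounds[of "F (gfun False \<xi>)" a] pacc_bounds[of "gfun False \<xi>" "sim R a"] by linarith+
    qed
    ultimately have "13 / 20 \<le> 1 - pacc (gfun False \<xi>) D0" by linarith
    then have "9999 / 10000 \<le> (boost ^^ 6) (1 - pacc (gfun False \<xi>) D0)"
      by (rule boost_iterate) (use pacc_bounds in simp)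
    then show ?thesis unfolding D_def pacc_amp_iterate boost_compl by simp
  qed
  have len: "length (queries (gfun True \<xi>) d) \<le> Q" if \<xi>: "\<xi> \<in> W" and d: "d \<in> set_pmf D" for \<xi> d
  proof -
    have "length (queries (gfun True \<xi>) d') \<le> q * R" if "d' \<in> set_pmf D0" for d'
      using that queries_sim[OF low R(1) runs[OF \<xi>]] by (auto simp: D0_def)
    then have "length (queries (gfun True \<xi>) d) \<le> 3 ^ 6 * (q * R)"
      using queries_amp[of D0 "gfun True \<xi>" "q * R" d 6] d by (simp add: D_def)
    then show ?thesis using Q by simp
  qed
  let ?c = "\<lambda>up d. real (card {\<xi> \<in> W. verdict (gfun up \<xi>) d})"
  have bnd: "\<bar>?c up d\<bar> \<le> real (card W)" for up d by (simp add: card_mono)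
  have "(\<integral>d. ?c True d \<partial>measure_pmf D) \<le> (\<integral>d. ?c False d + real (card W) / 4000 \<partial>measure_pmf D)"
  proof (rule integral_pmf_mono[where B = "2 * real (card W)"])
    fix d assume d: "d \<in> set_pmf D"
    interpret c: coupling m d Q LL Wm
      by unfold_locales (use len d LL Wm in auto)
    have "real (card W) * (4 * real Q ^ 2 / 2 ^ LL + (2 * real Q + 2 * real Wm) / real m) \<le> real (card W) * (1 / 4000)"
      by (rule mult_left_mono[OF gap]) simp
    then show "?c True d \<le> ?c False d + real (card W) / 4000" using c.coupling_bound by linarith
  next
    show "\<bar>?c True d\<bar> \<le> 2 * real (card W)" "\<bar>?c False d + real (card W) / 4000\<bar> \<le> 2 * real (card W)" for d
      using bnd[of True d] bnd[of False d] by linarith+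
  qed
  also have "\<dots> = (\<integral>d. ?c False d \<partial>measure_pmf D) + real (card W) / 4000"
    by (subst Bochner_Integration.integral_add)
      (auto intro!: measure_pmf.integrable_const_bound[where B = "real (card W)"] AE_I2 card_mono)
  finally have "(\<Sum>\<xi>\<in>W. pacc (gfun True \<xi>) D) \<le> (\<Sum>\<xi>\<in>W. pacc (gfun False \<xi>) D) + real (card W) / 4000"
    by (simp add: sum_pacc)
  moreover have "real (card W) * (9999 / 10000) \<le> (\<Sum>\<xi>\<in>W. pacc (gfun True \<xi>) D)"
    using sum_bounded_below[of W "9999 / 10000" "\<lambda>\<xi>. pacc (gfun True \<xi>) D"] yes by simp
  moreover have "(\<Sum>\<xi>\<in>W. pacc (gfun False \<xi>) D) \<le> real (card W) - real (card far) + real (card far) / 10000"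
  proof -
    have sub: "far \<subseteq> W" by (auto simp: far_def)
    have "(\<Sum>\<xi>\<in>W. pacc (gfun False \<xi>) D) = (\<Sum>\<xi>\<in>W - far. pacc (gfun False \<xi>) D) + (\<Sum>\<xi>\<in>far. pacc (gfun False \<xi>) D)"
      by (rule sum.subset_diff[OF sub finite_W])
    also have "\<dots> \<le> (\<Sum>\<xi>\<in>W - far. 1) + (\<Sum>\<xi>\<in>far. 1 / 10000)"
      by (intro add_mono sum_mono) (use no pacc_bounds in auto)
    also have "\<dots> = real (card W) - real (card far) + real (card far) / 10000"
      using sub finite_subset[OF sub finite_W] by (simp add: card_Diff_subset card_mono of_nat_diff)
    finally show ?thesis .
  qed
  moreover have "real (card W) \<le> 1536 * real (card far)"
    using card_far by (metis (mono_tags) of_nat_le_iff of_nat_mult of_nat_numeral)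
  moreover have "0 < real (card W)" using W_nonempty by (simp add: card_gt_0_iff)
  ultimately show False by linarith
qed

end

text \<open>With \<open>b = card heavy\<close> and \<open>e\<close> irrelevant coordinates, between
  \<open>b * 2 ^ e\<close> and \<open>2 * b * 2 ^ e\<close> points are accepted. This window places
  that number between \<open>N / 4\<close> and \<open>N\<close>.\<close>

lemma exists_scale:
  fixes b N :: nat
  assumes "0 < b" "2 * b \<le> N"
  obtains e where "2 * b * 2 ^ e \<le> N" "N < 4 * b * 2 ^ e"
proof -
  let ?P = "\<lambda>e. 2 * b * 2 ^ e \<le> N"
  have bd: "e \<le> N" if "?P e" for e
  proof -
    have "e < 2 ^ e" by (rule less_exp)
    also have "\<dots> \<le> 2 * b * 2 ^ e" using assms(1) by simp
    finally show ?thesis using that by simp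
  qed
  define e where "e = (GREATEST e. ?P e)"
  have "?P e" unfolding e_def by (rule GreatestI_nat[where k = 0 and b = N]) (use assms bd in auto)
  moreover have "\<not> ?P (Suc e)"
  proof
    assume "?P (Suc e)"
    then have "Suc e \<le> e" unfolding e_def by (rule Greatest_le_nat[where b = N]) (use bd in auto)
    then show False by simp
  qed
  ultimately show thesis using that by simp
qed

text \<open>
  Here \<open>t\<close> stands for $\log_2 N$; \<open>cost\<close> bounds the queries after simulation and amplification, \<open>spread\<close>
  the number of secrets they can test.
\<close>

definition rate :: "real \<Rightarrow> real" where
  "rate t = (t powr (2 / 3)) / ln (t powr (2 / 3)) ^ 2"

definition cost :: "real \<Rightarrow> real" where
  "cost t = 729 * rate t * (log 2 t + 1)"

definition spread :: "real \<Rightarrow> real" where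
  "spread t = 2 * cost t * (4 * log 2 t + 1) * (1 + sqrt (2 * cost t)) + 1"

text \<open>The squared logarithm in \<open>rate\<close> is what makes this true:
  \<open>cost t\<close> has order \<open>t powr (2 / 3) / ln t\<close>, so \<open>spread t\<close>,
  of order \<open>cost t powr (3 / 2) * ln t\<close>, has order
  \<open>t / sqrt (ln t)\<close>.\<close>

lemma eventually_small:
  assumes "0 < (\<delta>::real)"
  shows "eventually (\<lambda>t. cost t + spread t \<le> \<delta> * t \<and> 4 * cost t ^ 2 / t ^ 4 \<le> 1 / 8000 \<and>
    rate t / t \<le> 1 / 60) at_top"
proof -
  have "((\<lambda>t. (cost t + spread t) / t) \<longlongrightarrow> 0) at_top"
    unfolding cost_def spread_def rate_def by real_asymp
  from order_tendstoD(2)[OF this assms] have 1: "eventually (\<lambda>t. (cost t + spread t) / t < \<delta>) at_top" .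
  have "((\<lambda>t. 4 * cost t ^ 2 / t ^ 4) \<longlongrightarrow> 0) at_top"
    unfolding cost_def rate_def by real_asymp
  from order_tendstoD(2)[OF this, of "1 / 8000"] have 2: "eventually (\<lambda>t. 4 * cost t ^ 2 / t ^ 4 < 1 / 8000) at_top"
    by simp
  have "((\<lambda>t. rate t / t) \<longlongrightarrow> 0) at_top"
    unfolding rate_def by real_asymp
  from order_tendstoD(2)[OF this, of "1 / 60"] have 3: "eventually (\<lambda>t. rate t / t < 1 / 60) at_top" by simp
  show ?thesis using 1 2 3 eventually_gt_at_top[of 0]
  proof eventually_elim
    case (elim t)
    then show ?case by (simp add: pos_divide_less_eq)
  qed
qed

theorem theorem1p4:
  fixes \<alpha>\<^sub>0 :: real
  assumes "\<alpha>\<^sub>0 < 1"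
  shows "\<exists>\<epsilon>\<^sub>0>0. \<exists>c\<^sub>1>0. \<exists>c\<^sub>2\<ge>c\<^sub>1. \<exists>L :: nat \<Rightarrow> nat.
           (\<lambda>N. real (L N)) \<in> soft_Omega (\<lambda>N. (log 2 (real N)) powr (2/3)) \<and>
           (\<forall>n N A q. 1 \<le> N \<longrightarrow> real N \<le> 2 powr (\<alpha>\<^sub>0 * real n) \<longrightarrow>
              two_sided_unateness_tester n \<epsilon>\<^sub>0 (size_promise n c\<^sub>1 c\<^sub>2 N) A \<longrightarrow>
              makes_at_most q (size_promise n c\<^sub>1 c\<^sub>2 N) A \<longrightarrow>
              L N \<le> q)"
proof -
  \<comment> \<open>The \<open>4 * m\<close> variables take up at most half of the
    \<open>(1 - \<alpha>) * n\<close> coordinates left beside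
    \<open>e + 1 \<le> \<alpha> * n\<close>. The maximum with 1/2 gives
    \<open>\<beta> \<le> 1 / 16\<close>, which keeps \<open>4 * m + 1\<close> below
    \<open>log 2 N\<close>.\<close>
  define \<alpha> where "\<alpha> = max \<alpha>\<^sub>0 (1 / 2)"
  define \<beta> where "\<beta> = (1 - \<alpha>) / 8"
  have \<alpha>: "\<alpha>\<^sub>0 \<le> \<alpha>" "\<alpha> < 1" "1 / 2 \<le> \<alpha>" using assms by (auto simp: \<alpha>_def)
  have \<beta>: "0 < \<beta>" "\<beta> \<le> 1 / 16" using \<alpha> by (auto simp: \<beta>_def)
  have "eventually (\<lambda>t. (cost t + spread t \<le> \<beta> / 100000 * t \<and> 4 * cost t ^ 2 / t ^ 4 \<le> 1 / 8000 \<and>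
      rate t / t \<le> 1 / 60) \<and> 8 / \<beta> \<le> t) at_top"
    using \<beta>(1) by (intro eventually_conj eventually_small eventually_ge_at_top) simp
  then obtain T where T: "\<And>t. T \<le> t \<Longrightarrow> cost t + spread t \<le> \<beta> / 100000 * t"
    "\<And>t. T \<le> t \<Longrightarrow> 4 * cost t ^ 2 / t ^ 4 \<le> 1 / 8000" "\<And>t. T \<le> t \<Longrightarrow> rate t / t \<le> 1 / 60"
    "\<And>t. T \<le> t \<Longrightarrow> 8 / \<beta> \<le> t"
    unfolding eventually_at_top_linorder by blast
  \<comment> \<open>Below the threshold \<open>T\<close> the bound is trivially 0, so the claim can
    cover all \<open>N \<ge> 1\<close>.\<close>
  define L where "L N = (if T \<le> log 2 (real N) then nat \<lfloor>rate (log 2 (real N))\<rfloor> else 0)" for N :: nat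
  have soft: "(\<lambda>N. real (L N)) \<in> soft_Omega (\<lambda>N. (log 2 (real N)) powr (2/3))"
  proof -
    have "filterlim (\<lambda>N::nat. rate (log 2 (real N))) at_top at_top" unfolding rate_def by real_asymp
    then have 1: "eventually (\<lambda>N::nat. 2 \<le> rate (log 2 (real N))) at_top" by (simp add: filterlim_at_top)
    have "filterlim (\<lambda>N::nat. log 2 (real N)) at_top at_top" by real_asymp
    then have 2: "eventually (\<lambda>N::nat. T \<le> log 2 (real N)) at_top" by (simp add: filterlim_at_top)
    have "(\<lambda>N. real (L N)) \<in> \<Omega>(\<lambda>N. (log 2 (real N)) powr (2/3) / ln ((log 2 (real N)) powr (2/3)) ^ 2)"
    \<comment> \<open>Rounding down loses at most 1, hence at most half once the rate is at least
      2.\<close>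
    proof (rule landau_omega.bigI[of "1 / 2"])
      show "eventually (\<lambda>N. norm (real (L N)) \<ge> 1 / 2 * norm ((log 2 (real N)) powr (2/3) / ln ((log 2 (real N)) powr (2/3)) ^ 2)) at_top"
        using 1 2
      proof eventually_elim
        case (elim N)
        then have "rate (log 2 (real N)) - 1 \<le> real (L N)" unfolding L_def by simp
        then have "1 / 2 * norm (rate (log 2 (real N))) \<le> norm (real (L N))" using elim(1) by simp
        then show ?case by (simp only: rate_def)
      qed
    qed simp
    then show ?thesis unfolding soft_Omega_def by blast
  qed
  have bound: "L N \<le> q"
    if N: "1 \<le> N" "real N \<le> 2 powr (\<alpha>\<^sub>0 * real n)"
      and tester: "two_sided_unateness_tester n (1 / 6144) (size_promise n (1 / 4) 1 N) A"
      and makes: "makes_at_most q (size_promise n (1 / 4) 1 N) A" for n N A q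
  proof (rule ccontr)
    assume "\<not> L N \<le> q"
    then have qL: "q < L N" by simp
    define t where "t = log 2 (real N)"
    have tT: "T \<le> t" and LN: "L N = nat \<lfloor>rate t\<rfloor>" using qL by (auto simp: L_def t_def split: if_splits)
    have Nt: "real N = 2 powr t" using N(1) by (simp add: t_def)
    have t8: "8 / \<beta> \<le> t" by (rule T(4)[OF tT])
    have \<beta>t: "8 \<le> \<beta> * t" using t8 \<beta>(1) by (simp add: field_simps)
    have "128 \<le> 8 / \<beta>" using \<beta> by (simp add: field_simps)
    then have t128: "128 \<le> t" using t8 by linarith
    have "t \<le> \<alpha>\<^sub>0 * real n" using N(2) Nt by simp
    also have "\<dots> \<le> \<alpha> * real n" using \<alpha>(1) by (rule mult_right_mono) simp
    finally have tn: "t \<le> \<alpha> * real n" .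
    define m where "m = nat \<lfloor>\<beta> * t\<rfloor>"
    have m: "real m \<le> \<beta> * t" "\<beta> * t - 1 < real m" using \<beta>t by (auto simp: m_def)
    have m3: "3 \<le> m" using m(2) \<beta>t by linarith
    interpret hf: hard_family m by unfold_locales (rule m3)
    have \<beta>t16: "\<beta> * t \<le> t / 16" using mult_right_mono[OF \<beta>(2), of t] t128 by simp
    define b where "b = card hf.heavy"
    have b0: "0 < b"
    proof -
      have "hf.layer \<subseteq> hf.heavy" by (auto simp: hf.layer_def hf.heavy_def)
      then have "card hf.layer \<le> b" unfolding b_def by (rule card_mono[rotated]) simp
      then show ?thesis using hf.card_layer_pos by simp
    qed
    have "2 * b \<le> N"
    proof -
      have "b \<le> card (Pow {..<4 * m})" unfolding b_def by (rule card_mono) (auto simp: hf.heavy_def)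
      then have "2 * b \<le> 2 ^ (4 * m + 1)" by (simp add: card_Pow)
      moreover have "real (2 ^ (4 * m + 1)) \<le> real N"
      proof -
        have "real (2 ^ (4 * m + 1)) = 2 powr real (4 * m + 1)" by (simp only: powr_realpow of_nat_power) (simp add: powr_realpow)
        also have "\<dots> \<le> 2 powr t"
        proof (rule powr_mono)
          show "real (4 * m + 1) \<le> t" using m(1) \<beta>t16 t128 by linarith
        qed simp
        finally show ?thesis using Nt by simp
      qed
      then have "2 ^ (4 * m + 1) \<le> N" by (simp only: of_nat_le_iff)
      ultimately show ?thesis by linarith
    qed
    then obtain e where e: "2 * b * 2 ^ e \<le> N" "N < 4 * b * 2 ^ e" using exists_scale[OF b0] by blast
    have et: "real e + 1 \<le> t"
    proof -
      have "2 ^ (e + 1) \<le> 2 * b * 2 ^ e" using b0 by simp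
      then have "2 ^ (e + 1) \<le> N" using e(1) by (rule order_trans)
      then have "real (2 ^ (e + 1)) \<le> real N" by (simp only: of_nat_le_iff)
      moreover have "real (2 ^ (e + 1)) = 2 powr (real e + 1)" by (simp add: powr_add powr_realpow)
      ultimately have "2 powr (real e + 1) \<le> 2 powr t" using Nt by simp
      then show ?thesis by simp
    qed
    have "real (4 * m + 1 + e) \<le> real n"
    proof -
      have "\<alpha> * real n \<le> 1 * real n" using \<alpha>(2) by (intro mult_right_mono) auto
      then have tn1: "t \<le> real n" using tn by linarith
      have "4 * (\<beta> * t) = (1 - \<alpha>) / 2 * t" by (simp add: \<beta>_def)
      also have "\<dots> \<le> (1 - \<alpha>) / 2 * real n" using tn1 \<alpha>(2) by (intro mult_left_mono) auto
      also have "\<dots> \<le> (1 - \<alpha>) * real n" using \<alpha>(2) by (intro mult_right_mono) auto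
      finally have "4 * (\<beta> * t) \<le> real n - \<alpha> * real n" by (simp add: left_diff_distrib)
      then show ?thesis using m(1) et tn by simp
    qed
    then have ne: "4 * m + 1 + e \<le> n" by (simp only: of_nat_le_iff)
    interpret lf: lifted m n e by unfold_locales (rule ne)
    \<comment> \<open>These choices give \<open>2 ^ R \<ge> t\<close>, hence a sampling loss of at
      most \<open>rate t / t\<close>, and \<open>2 ^ LL \<ge> t ^ 4\<close>, which outweighs
      \<open>4 * Q ^ 2\<close>. Both cost only a factor logarithmic in \<open>t\<close>.\<close>
    define R where "R = nat \<lceil>log 2 t\<rceil>"
    define LL where "LL = nat \<lceil>4 * log 2 t\<rceil>"
    define Q where "Q = 729 * (L N * R)"
    define Wm where "Wm = nat \<lceil>2 * real Q * real LL * (1 + sqrt (2 * real Q))\<rceil>"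
    have lt: "1 \<le> log 2 t" using t128 by simp
    have R: "log 2 t \<le> real R" "real R \<le> log 2 t + 1" using lt by (auto simp: R_def)
    have LL: "4 * log 2 t \<le> real LL" "real LL \<le> 4 * log 2 t + 1" using lt by (auto simp: LL_def)
    have R1: "1 \<le> R" "1 \<le> LL" using R(1) LL(1) lt by linarith+
    have R2: "t \<le> 2 ^ R"
    proof -
      have "t = 2 powr (log 2 t)" using t128 by simp
      also have "\<dots> \<le> 2 powr real R" by (rule powr_mono) (use R in auto)
      finally show ?thesis by (simp add: powr_realpow)
    qed
    have LL2: "t ^ 4 \<le> 2 ^ LL"
    proof -
      have "t ^ 4 = t powr 4" using t128 by simp
      also have "\<dots> = (2 powr log 2 t) powr 4" using t128 by simp
      also have "\<dots> = 2 powr (log 2 t * 4)" by (rule powr_powr)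
      also have "\<dots> \<le> 2 powr real LL" by (rule powr_mono) (use LL in simp_all)
      finally show ?thesis by (simp add: powr_realpow)
    qed
    have r0: "0 \<le> rate t" by (simp add: rate_def)
    then have Lr: "real (L N) \<le> rate t" unfolding LN by simp
    have Qc: "real Q \<le> cost t"
    proof -
      have "real (L N) * real R \<le> rate t * (log 2 t + 1)" using Lr R(2) r0 by (intro mult_mono) auto
      then show ?thesis by (simp add: Q_def cost_def)
    qed
    have Ws: "real Wm \<le> spread t"
    proof -
      have "2 * real Q * real LL * (1 + sqrt (2 * real Q)) \<le> 2 * cost t * (4 * log 2 t + 1) * (1 + sqrt (2 * cost t))"
        using Qc LL(2) lt by (intro mult_mono add_mono real_sqrt_le_mono) auto
      moreover have "real Wm \<le> 2 * real Q * real LL * (1 + sqrt (2 * real Q)) + 1"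
      proof -
        have "0 \<le> 2 * real Q * real LL * (1 + sqrt (2 * real Q))" by simp
        then show ?thesis unfolding Wm_def by linarith
      qed
      ultimately show ?thesis by (simp add: spread_def)
    qed
    have QW: "real Q + real Wm \<le> \<beta> / 100000 * t" using T(1)[OF tT] Qc Ws by linarith
    have m2: "\<beta> * t / 2 \<le> real m" using m(2) \<beta>t by linarith
    show False
    proof (rule lf.no_tester[OF tester makes])
      show "lf.F (hf.gfun up \<xi>) \<in> size_promise n (1 / 4) 1 N" for \<xi> up
      proof -
        have c: "b * 2 ^ e \<le> card (ones (lf.F (hf.gfun up \<xi>)))" "card (ones (lf.F (hf.gfun up \<xi>))) \<le> 2 * b * 2 ^ e"
          unfolding b_def by (rule lf.card_ones, rule hf.gfun_below, assumption)+
        have "N \<le> 4 * card (ones (lf.F (hf.gfun up \<xi>)))" using c(1) e(2) by simp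
        moreover have "card (ones (lf.F (hf.gfun up \<xi>))) \<le> N" using c(2) e(1) by simp
        ultimately show ?thesis using lf.F_boolfun by (simp add: size_promise_def)
      qed
      show "1 \<le> R" "1 \<le> LL" by (rule R1)+
      show "real q / 2 ^ R \<le> 1 / 60"
      proof -
        have "real q / 2 ^ R \<le> rate t / t" using qL Lr R2 t128 r0 by (intro frac_le) auto
        then show ?thesis using T(3)[OF tT] by linarith
      qed
      show "2 * real Q * real LL * (1 + sqrt (2 * real Q)) \<le> real Wm" unfolding Wm_def by linarith
      have "2 * real Wm \<le> real m" using QW m2 \<beta>t by linarith
      then show "2 * Wm \<le> m" by linarith
      show "729 * (q * R) \<le> Q" using qL by (simp add: Q_def)
      have "4 * real Q ^ 2 / 2 ^ LL \<le> 4 * cost t ^ 2 / t ^ 4"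
        using Qc LL2 t128 by (intro frac_le mult_left_mono power_mono) auto
      then have "4 * real Q ^ 2 / 2 ^ LL \<le> 1 / 8000" using T(2)[OF tT] by linarith
      moreover have "(2 * real Q + 2 * real Wm) / real m \<le> 1 / 8000"
      proof -
        have "2 * real Q + 2 * real Wm \<le> 1 / 8000 * real m" using QW m2 \<beta>t by linarith
        then show ?thesis using m3 by (simp add: pos_divide_le_eq)
      qed
      ultimately show "4 * real Q ^ 2 / 2 ^ LL + (2 * real Q + 2 * real Wm) / real m \<le> 1 / 4000" by linarith
    qed
  qed
  have "(0::real) < 1 / 6144" "(0::real) < 1 / 4" "(1 / 4 :: real) \<le> 1" by simp_all
  then show ?thesis using soft bound by blast
qed

end
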